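(* Consider the Popularity Adjusted Block Model described in the context. Assume $\boldsymbol\Theta$ has exactly $K^2$ nonzero singular values $\sigma_{1,n}\ge\dots\ge\sigma_{K^2,n}$ with $\sigma_{1,n}/\sigma_{K^2,n}\le C_1\sqrt{\log n}$ for some constant $C_1>0$. Suppose: (A1) there is a constant $C\ge1$ with $\frac{n}{CK}\le n_k(\boldsymbol c^\ast)\le\frac{Cn}{K}$ for all $k\in[K]$; (A2) $n\rho_n^2/K^2\ge C(\log n)^2$ for a large constant $C>0$; and there are sequences $\phi_{1,n}\in(0,1]$ and $\phi_{2,n}$ such that: (A3) with $\mathcal G_i=\{j\in[n]:\boldsymbol c^\ast(j)=\boldsymbol c^\ast(i),\ |\tau_{ij}|\ge\phi_{1,n}\}$ and $\mathcal H=\{i\in[n]:|\mathcal G_i|\ge n_{\boldsymbol c^\ast(i)}(\boldsymbol c^\ast)(1-\tilde\eta_{n,0})\}$, one has $|[n]\setminus\mathcal H|\le\tilde\eta_{n,1}n$ for sequences $\tilde\eta_{n,1}=o((n\rho_n^2)^{-1}(\log n)^2)$ and $\tilde\eta_{n,0}=o((n\rho_n^2)^{-1/2}\log n)$; (A4) with $\mathcal I=\{i\in[n]:D_{\boldsymbol P_{\boldsymbol c^\ast(i)}}^{1/2}(\boldsymbol\lambda_{i\cdot},\boldsymbol\lambda_{i\cdot})\ge\phi_{2,n}\}$, one has $|\mathcal I|>n(1-\tilde\eta_{n,2})$ for some $\tilde\eta_{n,2}=o((\log n)^2(n\rho_n^2)^{-1})$, and $\max_{i\in[n]}D_{\boldsymbol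 P_{\boldsymbol c^\ast(i)}}(\boldsymbol\lambda_{i\cdot},\boldsymbol\lambda_{i\cdot})\lesssim K^2/n$; and moreover, for a large constant $C_2>0$, $$\frac{K}{\sqrt n}\gtrsim\phi_{1,n}\phi_{2,n}\ge C_2\frac{\rho_nK\sqrt{\log n}}{\sigma_{K^2,n}}.$$ If the TCSC algorithm is run with $d_n=\phi_{1,n}/2$ and $\hat{\boldsymbol c}^{(0)}$ is its output, then there exist a constant $C>0$ and a sequence $\tilde\eta_n=o(1)$ such that $$\mathbb P\{\ell(\boldsymbol c^\ast,\hat{\boldsymbol c}^{(0)})\le\tilde\eta_n\}\ge1-Cn^{-4}.$$
   Context: Notation: $[m]=\{1,\dots,m\}$. PABM: integers $n$, $K\ge2$, label vector $\boldsymbol c^\ast\in[K]^n$, popularity matrix $\boldsymbol\Lambda=(\lambda_{ik})\in[0,1]^{n\times K}$ with rows $\boldsymbol\lambda_{i\cdot}$. Edge probabilities $\theta_{ij}=\lambda_{i\boldsymbol c^\ast(j)}\lambda_{j\boldsymbol c^\ast(i)}$, $\boldsymbol\Theta=(\theta_{ij})_{n\times n}$. Adjacency matrix $\boldsymbol A$ symmetric, $A_{ii}=0$, $A_{ij}\sim\mathrm{Bernoulli}(\theta_{ij})$ independently for $i<j$. $n_k(\boldsymbol c)=|\{i:\boldsymbol c(i)=k\}|$. $\boldsymbol\Lambda^{(k,\cdot)}$ = rows of $\boldsymbol\Lambda$ with $\boldsymbol c^\ast(i)=k$; $\boldsymbol P_k=(\boldsymbol\Lambda^{(k,\cdot)\top}\boldsymbol\Lambda^{(k,\cdot)})^{-1}$,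 $D_{\boldsymbol P_k}(\boldsymbol x,\boldsymbol y)=\boldsymbol x^\top\boldsymbol P_k\boldsymbol y$. $\boldsymbol\Xi\in\mathbb R^{n\times K^2}$: orthonormal eigenvectors of $\boldsymbol\Theta$ for its $K^2$ nonzero eigenvalues, rows $\boldsymbol\xi_{i\cdot}$; $\tau_{ij}=|\cos(\boldsymbol\xi_{i\cdot},\boldsymbol\xi_{j\cdot})|$, $\cos(\boldsymbol x,\boldsymbol y)=\boldsymbol x^\top\boldsymbol y/(\|\boldsymbol x\|\|\boldsymbol y\|)$. Loss: $\ell(\boldsymbol c^\ast,\hat{\boldsymbol c})=\min_{\pi}\frac1n\sum_{i}\mathbb I\{\boldsymbol c^\ast(i)\ne\pi(\hat{\boldsymbol c}(i))\}$ over permutations $\pi$ of $[K]$. Asymptotics as $n\to\infty$; $\boldsymbol\Lambda=\rho_n\boldsymbol\Lambda_0$, $\boldsymbol\Lambda_0\in(0,1)^{n\times K}$, $\rho_n\in(0,1]$; $x_n\lesssim y_n$ ($x_n\gtrsim y_n$) means $x_n\le Cy_n$ ($x_n\ge Cy_n$) for a constant $C>0$. TCSC algorithm (input $\boldsymbol A$, $K$, threshold $d_n$, fixed $\varepsilon>0$): let $\hat{\boldsymbol\Xi}$ be the $n\times K^2$ matrix of eigenvectors of $\boldsymbol A$ for its $K^2$ eigenvalues of largest absolute value, rows $\hat{\boldsymbol\xi}_{i\cdot}$; $\hat\tau_{ij}=|\cos(\hat{\boldsymbol\xi}_{i\cdot},\hat{\boldsymbol\xi}_{j\cdot})|$; $\tilde{\boldsymbol\tau}_i=(\mathbb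 I\{\hat\tau_{ij}\ge d_n\})_{j\in[n]}\in\{0,1\}^n$; output any $\hat{\boldsymbol c}^{(0)}\in[K]^n$ satisfying $\sum_{k}\min_{\boldsymbol\nu_k\in\mathbb R^n}\sum_{i:\hat{\boldsymbol c}^{(0)}(i)=k}\|\tilde{\boldsymbol\tau}_i-\boldsymbol\nu_k\|^2\le(1+\varepsilon)\min_{\tilde{\boldsymbol c}\in[K]^n}\sum_k\min_{\boldsymbol\nu_k}\sum_{i:\tilde{\boldsymbol c}(i)=k}\|\tilde{\boldsymbol\tau}_i-\boldsymbol\nu_k\|^2$. *)

theory Defs
  imports "HOL-Probability.Probability" "HOL-Combinatorics.Permutations"
    "HOL-Library.Landau_Symbols"
begin

text \<open>Conventions: indices are 0-based, nodes are 0..<n, communities 0..<K,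
  eigen-directions 0..<m. Matrices are functions nat => nat => real, vectors nat => real,
  only values at in-range indices matter.\<close>

definition comm_size :: "nat \<Rightarrow> (nat \<Rightarrow> nat) \<Rightarrow> nat \<Rightarrow> nat" where
  "comm_size n c k = card {i. i < n \<and> c i = k}"

definition pabm_theta :: "(nat \<Rightarrow> nat) \<Rightarrow> (nat \<Rightarrow> nat \<Rightarrow> real) \<Rightarrow> nat \<Rightarrow> nat \<Rightarrow> real" where
  "pabm_theta c L i j = L i (c j) * L j (c i)"

definition pabm_pmf :: "nat \<Rightarrow> (nat \<Rightarrow> nat \<Rightarrow> real) \<Rightarrow> (nat \<times> nat \<Rightarrow> bool) pmf" where
  "pabm_pmf n Th = Pi_pmf {(i, j). i < j \<and> j < n} False (\<lambda>(i, j). bernoulli_pmf (Th i j))"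

definition adj_of :: "(nat \<times> nat \<Rightarrow> bool) \<Rightarrow> nat \<Rightarrow> nat \<Rightarrow> real" where
  "adj_of \<omega> i j = (if i < j then (if \<omega> (i, j) then 1 else 0)
                    else if j < i then (if \<omega> (j, i) then 1 else 0) else 0)"

definition orthonormal_cols :: "nat \<Rightarrow> nat \<Rightarrow> (nat \<Rightarrow> nat \<Rightarrow> real) \<Rightarrow> bool" where
  "orthonormal_cols n m X \<longleftrightarrow>
     (\<forall>a<m. \<forall>b<m. (\<Sum>i<n. X i a * X i b) = (if a = b then 1 else 0))"

text \<open>X (n x m) consists of orthonormal eigenvectors of the symmetric matrix Th for the nonzero
  eigenvalues mu 0..mu (m-1), and these are all nonzero eigenvalues (with multiplicity):
  Th = sum_a mu_a x_a x_a^T.  Then the nonzero singular values of Th are exactly |mu_a|.\<close>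
definition nonzero_eigdecomp ::
  "nat \<Rightarrow> nat \<Rightarrow> (nat \<Rightarrow> nat \<Rightarrow> real) \<Rightarrow> (nat \<Rightarrow> nat \<Rightarrow> real) \<Rightarrow> (nat \<Rightarrow> real) \<Rightarrow> bool" where
  "nonzero_eigdecomp n m Th X mu \<longleftrightarrow>
     orthonormal_cols n m X \<and> (\<forall>a<m. mu a \<noteq> 0) \<and>
     (\<forall>i<n. \<forall>j<n. Th i j = (\<Sum>a<m. mu a * X i a * X j a))"

definition is_eigvec :: "nat \<Rightarrow> (nat \<Rightarrow> nat \<Rightarrow> real) \<Rightarrow> (nat \<Rightarrow> real) \<Rightarrow> real \<Rightarrow> bool" where
  "is_eigvec n M v \<mu> \<longleftrightarrow> (\<forall>i<n. (\<Sum>j<n. M i j * v j) = \<mu> * v i) \<and> (\<exists>i<n. v i \<noteq> 0)"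

definition top_eigvecs ::
  "nat \<Rightarrow> nat \<Rightarrow> (nat \<Rightarrow> nat \<Rightarrow> real) \<Rightarrow> (nat \<Rightarrow> nat \<Rightarrow> real) \<Rightarrow> (nat \<Rightarrow> real) \<Rightarrow> bool" where
  "top_eigvecs n m M X nu \<longleftrightarrow>
     orthonormal_cols n m X \<and>
     (\<forall>a<m. \<forall>i<n. (\<Sum>j<n. M i j * X j a) = nu a * X i a) \<and>
     (\<forall>u \<mu>. is_eigvec n M u \<mu> \<and> (\<forall>a<m. (\<Sum>i<n. u i * X i a) = 0) \<longrightarrow>
        (\<forall>a<m. \<bar>\<mu>\<bar> \<le> \<bar>nu a\<bar>))"

definition cosv :: "nat \<Rightarrow> (nat \<Rightarrow> real) \<Rightarrow> (nat \<Rightarrow> real) \<Rightarrow> real" where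
  "cosv m x y = (\<Sum>a<m. x a * y a) / (sqrt (\<Sum>a<m. (x a)\<^sup>2) * sqrt (\<Sum>a<m. (y a)\<^sup>2))"

definition row_tau :: "nat \<Rightarrow> (nat \<Rightarrow> nat \<Rightarrow> real) \<Rightarrow> nat \<Rightarrow> nat \<Rightarrow> real" where
  "row_tau m X i j = \<bar>cosv m (X i) (X j)\<bar>"

definition kmeans_obj :: "nat \<Rightarrow> nat \<Rightarrow> (nat \<Rightarrow> nat \<Rightarrow> real) \<Rightarrow> (nat \<Rightarrow> nat) \<Rightarrow> real" where
  "kmeans_obj n K v c =
     (\<Sum>k<K. (INF \<nu>. (\<Sum>i\<in>{i. i < n \<and> c i = k}. \<Sum>j<n. (v i j - \<nu> j)\<^sup>2)))"

definition labelings :: "nat \<Rightarrow> nat \<Rightarrow> (nat \<Rightarrow> nat) set" where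
  "labelings n K = {c. \<forall>i<n. c i < K}"

definition tcsc_output ::
  "nat \<Rightarrow> nat \<Rightarrow> (nat \<Rightarrow> nat \<Rightarrow> real) \<Rightarrow> real \<Rightarrow> real \<Rightarrow> (nat \<Rightarrow> nat) \<Rightarrow> bool" where
  "tcsc_output n K Xh d eps c \<longleftrightarrow>
     (let tt = (\<lambda>i j. if row_tau (K\<^sup>2) Xh i j \<ge> d then 1 else 0 :: real) in
       c \<in> labelings n K \<and>
       kmeans_obj n K tt c \<le> (1 + eps) * (INF c'\<in>labelings n K. kmeans_obj n K tt c'))"

definition mis_loss :: "nat \<Rightarrow> nat \<Rightarrow> (nat \<Rightarrow> nat) \<Rightarrow> (nat \<Rightarrow> nat) \<Rightarrow> real" where
  "mis_loss n K c ch =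
     Min {real (card {i. i < n \<and> c i \<noteq> \<pi> (ch i)}) / real n | \<pi>. \<pi> permutes {0..<K}}"

definition comm_gram :: "nat \<Rightarrow> (nat \<Rightarrow> nat) \<Rightarrow> (nat \<Rightarrow> nat \<Rightarrow> real) \<Rightarrow> nat \<Rightarrow> nat \<Rightarrow> nat \<Rightarrow> real" where
  "comm_gram n c L k a b = (\<Sum>i\<in>{i. i < n \<and> c i = k}. L i a * L i b)"

definition is_inverse_mat :: "nat \<Rightarrow> (nat \<Rightarrow> nat \<Rightarrow> real) \<Rightarrow> (nat \<Rightarrow> nat \<Rightarrow> real) \<Rightarrow> bool" where
  "is_inverse_mat m M P \<longleftrightarrow>
     (\<forall>a<m. \<forall>b<m. (\<Sum>l<m. M a l * P l b) = (if a = b then 1 else 0) \<and>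
                  (\<Sum>l<m. P a l * M l b) = (if a = b then 1 else 0))"

definition D_form :: "nat \<Rightarrow> (nat \<Rightarrow> nat \<Rightarrow> real) \<Rightarrow> (nat \<Rightarrow> real) \<Rightarrow> (nat \<Rightarrow> real) \<Rightarrow> real" where
  "D_form m P x y = (\<Sum>a<m. \<Sum>b<m. x a * P a b * y b)"

end

theory Submission
  imports Defs "HOL-Real_Asymp.Real_Asymp"
begin

text \<open>
  Let \<open>E\<close> be the difference of the adjacency matrix and \<open>Theta\<close>, and \<open>Xi\<close>, \<open>Xh\<close> the two eigenvector
  matrices. The rows of \<open>Xi\<close> satisfy
  \<open>Xi_i . Xi_j = D_{P_k} (lambda_i, lambda_j)\<close> inside a community \<open>k\<close> and are orthogonal across
  communities, so it suffices to control cosines. The residual \<open>Y = (1 - Xi Xi\<^sup>T) Xh\<close> has rows bounded by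
  \<open>|E_i Xi|\<close>, \<open>|E_i Y|\<close> and \<open>|E| |Xi_i|\<close>, all divided by the smallest singular value. The first and third
  are uniformly small by a Chernoff bound and by a trace-method bound
  \<open>|E| = O(rho sqrt (n ln n))\<close>. The second is only small on average: its Frobenius norm is
  of second order, because \<open>|E Xi|\<close> carries no logarithm in the Frobenius norm (Hoeffding's inequality for
  the independent rows of each triangle). Assumption (A3) forces
  \<open>(phi1 phi2)^2 = O(K / n)\<close>, which improves the lower bound on the singular values just enough
  that only \<open>o(n / K)\<close> rows are lost. The thresholded cosines then agree with the community indicators up to
  \<open>o(n^2 / K)\<close> entries, and a near-optimal k-means labelling misclassifies \<open>o(n)\<close> nodes.
\<close>

section \<open>Linear algebra\<close>

text \<open>The row \<open>E_i Y\<close> resists a direct bound because \<open>Y\<close> depends on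
  all of the adjacency matrix, in particular on \<open>E_i\<close> itself, while a Chernoff bound
  wants weights independent of the noise. Bad rows are therefore tolerated: each costs at most
  \<open>n\<close> as a row and \<open>n\<close> as a column in the k-means objective, whereas a
  misclassified node costs about \<open>n / K\<close>, so that \<open>o(n / K)\<close> bad rows are
  affordable. With \<open>s\<close> the smallest singular value, their number is of order
  \<open>(|E| / s)^2 * |E Xi|_F^2 / (s * phi1 * phi2)^2\<close>. The second quotient is
  \<open>O(n / ln n)\<close> exactly because the Frobenius norm carries no logarithm, and the first
  factor is \<open>O(1 / K)\<close> once \<open>(phi1 * phi2)^2 = O(K / n)\<close> is known. All
  comparisons go through the span of \<open>Xi\<close>. The residual does not see rotations inside
  the eigenspace, and the Gram matrix of the rows of \<open>Xi Xi^T Xh\<close> differs from that of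
  \<open>Xi\<close> by the square of \<open>|E| / s\<close>, relative to the row lengths. So no
  aligning rotation and no gap between nonzero eigenvalues enters.\<close>

type_synonym rmat = "nat \<Rightarrow> nat \<Rightarrow> real"

abbreviation vnorm :: "nat \<Rightarrow> (nat \<Rightarrow> real) \<Rightarrow> real" where
  "vnorm n x \<equiv> L2_set x {..<n}"

abbreviation dot :: "nat \<Rightarrow> (nat \<Rightarrow> real) \<Rightarrow> (nat \<Rightarrow> real) \<Rightarrow> real" where
  "dot n x y \<equiv> (\<Sum>i<n. x i * y i)"

abbreviation (input) col :: "rmat \<Rightarrow> nat \<Rightarrow> nat \<Rightarrow> real" where
  "col M a \<equiv> (\<lambda>i. M i a)"

abbreviation mvec :: "nat \<Rightarrow> rmat \<Rightarrow> (nat \<Rightarrow> real) \<Rightarrow> nat \<Rightarrow> real" where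
  "mvec n M x \<equiv> (\<lambda>i. \<Sum>j<n. M i j * x j)"

lemma square_diff_le: "(a - b)^2 \<le> 2 * (x - a)^2 + 2 * (x - b)^2" for a b x :: real
  using zero_le_power2[of "(x - a) + (x - b)"] by (simp add: power2_eq_square algebra_simps)

lemma L2_set_power2: "(L2_set f A)^2 = (\<Sum>i\<in>A. (f i)^2)"
  by (simp add: L2_set_def sum_nonneg)

lemma vnorm_power2_dot: "(vnorm n x)^2 = dot n x x"
  unfolding L2_set_power2 by (simp add: power2_eq_square)

lemma abs_dot_le: "\<bar>dot n x y\<bar> \<le> vnorm n x * vnorm n y"
proof -
  have "\<bar>dot n x y\<bar> \<le> (\<Sum>i<n. \<bar>x i\<bar> * \<bar>y i\<bar>)"
    using sum_abs[of "\<lambda>i. x i * y i" "{..<n}"] by (simp add: abs_mult)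
  also have "\<dots> \<le> vnorm n x * vnorm n y" by (rule L2_set_mult_ineq)
  finally show ?thesis .
qed

lemma vnorm_eq_0_iff: "vnorm n x = 0 \<longleftrightarrow> (\<forall>i<n. x i = 0)"
  by (auto simp: L2_set_eq_0_iff)

lemma vnorm_scale: "vnorm n (\<lambda>i. r * x i) = \<bar>r\<bar> * vnorm n x"
proof -
  have "vnorm n (\<lambda>i. r * x i) = sqrt (r^2 * (\<Sum>i<n. (x i)^2))"
    by (simp add: L2_set_def power_mult_distrib sum_distrib_left)
  thus ?thesis by (simp add: real_sqrt_mult L2_set_def)
qed

lemma vnorm_uminus: "vnorm n (\<lambda>i. - x i) = vnorm n x"
  by (simp add: L2_set_def)

lemma vnorm_abs: "vnorm n (\<lambda>i. \<bar>x i\<bar>) = vnorm n x"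
  by (simp add: L2_set_def)

lemma vnorm_diff_le: "vnorm n (\<lambda>i. x i - y i) \<le> vnorm n x + vnorm n y"
  using L2_set_triangle_ineq[of x "\<lambda>i. - y i" "{..<n}"] by (simp add: vnorm_uminus)

lemma vnorm_diff_ge: "vnorm n x - vnorm n y \<le> vnorm n (\<lambda>i. x i - y i)"
  using L2_set_triangle_ineq[of "\<lambda>i. x i - y i" y "{..<n}"] by simp

lemma vnorm_diff_power2:
  "(vnorm n (\<lambda>i. x i - c * y i))^2 = (vnorm n x)^2 - 2 * c * dot n x y + c^2 * (vnorm n y)^2"
proof -
  have "(\<Sum>i<n. (x i - c * y i)^2) = (\<Sum>i<n. (x i)^2 - 2 * c * (x i * y i) + c^2 * (y i)^2)"
    by (intro sum.cong refl) (simp add: power2_eq_square algebra_simps)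
  then show ?thesis
    by (simp add: L2_set_power2 sum.distrib sum_subtractf sum_distrib_left)
qed

lemma dot_sum_right: "dot n x (\<lambda>i. \<Sum>a<m. u a * M i a) = (\<Sum>a<m. u a * dot n x (\<lambda>i. M i a))"
proof -
  have "dot n x (\<lambda>i. \<Sum>a<m. u a * M i a) = (\<Sum>i<n. \<Sum>a<m. u a * (x i * M i a))"
    by (simp add: sum_distrib_left mult_ac)
  also have "\<dots> = (\<Sum>a<m. \<Sum>i<n. u a * (x i * M i a))" by (rule sum.swap)
  finally show ?thesis by (simp add: sum_distrib_left)
qed

lemma dot_mvec: "dot n x (mvec m M y) = dot m (\<lambda>j. \<Sum>i<n. M i j * x i) y"
proof -
  have "dot n x (mvec m M y) = (\<Sum>i<n. \<Sum>j<m. M i j * x i * y j)"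
    by (simp add: sum_distrib_left mult_ac)
  also have "\<dots> = (\<Sum>j<m. \<Sum>i<n. M i j * x i * y j)" by (rule sum.swap)
  finally show ?thesis by (simp add: sum_distrib_right)
qed

lemma dot_mvec_symmetric:
  assumes "\<And>i j. i < n \<Longrightarrow> j < n \<Longrightarrow> M i j = M j i"
  shows "dot n x (mvec n M y) = dot n (mvec n M x) y"
proof -
  have "(\<Sum>i<n. M i j * x i) = mvec n M x j" if "j < n" for j
    using assms[OF _ that] by (intro sum.cong) auto
  then show ?thesis unfolding dot_mvec by (intro sum.cong) auto
qed

text \<open>Gaussian elimination by induction on the number of equations: the last one is dropped if
  it vanishes identically, otherwise it eliminates a pivot unknown \<open>p\<close>. The unknowns
  are indexed by an arbitrary finite set, so that removing \<open>p\<close> needs no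
  renumbering.\<close>

lemma homogeneous_system_solution:
  fixes M :: "nat \<Rightarrow> 'a \<Rightarrow> real"
  assumes "finite B" "r < card B"
  shows "\<exists>x. (\<exists>b\<in>B. x b \<noteq> 0) \<and> (\<forall>a<r. (\<Sum>b\<in>B. M a b * x b) = 0)"
  using assms
proof (induction r arbitrary: B M)
  case 0
  then have "B \<noteq> {}" by auto
  then show ?case by (intro exI[of _ "\<lambda>_. 1"]) auto
next
  case (Suc r)
  show ?case
  proof (cases "\<forall>b\<in>B. M r b = 0")
    case True
    from Suc.IH[of B M] Suc.prems obtain x where
      "\<exists>b\<in>B. x b \<noteq> 0" "\<forall>a<r. (\<Sum>b\<in>B. M a b * x b) = 0" by auto
    with True show ?thesis by (intro exI[of _ x]) (auto simp: less_Suc_eq)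
  next
    case False
    then obtain p where p: "p \<in> B" "M r p \<noteq> 0" by auto
    define B' where "B' = B - {p}"
    have B': "finite B'" "r < card B'" "B = insert p B'" "p \<notin> B'"
      using Suc.prems p by (auto simp: B'_def)
    from Suc.IH[OF B'(1,2), of "\<lambda>a b. M a b - M a p * M r b / M r p"] obtain x where
      x: "\<exists>b\<in>B'. x b \<noteq> 0" "\<forall>a<r. (\<Sum>b\<in>B'. (M a b - M a p * M r b / M r p) * x b) = 0" by auto
    define s where "s = (\<Sum>b\<in>B'. M r b * x b)"
    define y where "y = x(p := - s / M r p)"
    have *: "(\<Sum>b\<in>B. M a b * y b) = (\<Sum>b\<in>B'. M a b * x b) - M a p * s / M r p" for a
    proof -
      have "(\<Sum>b\<in>B'. M a b * y b) = (\<Sum>b\<in>B'. M a b * x b)"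
        using B'(4) by (intro sum.cong) (auto simp: y_def)
      then show ?thesis using B' by (simp add: y_def)
    qed
    have **: "(\<Sum>b\<in>B'. (M a b - M a p * M r b / M r p) * x b)
            = (\<Sum>b\<in>B'. M a b * x b) - M a p * s / M r p" for a
      by (simp add: s_def left_diff_distrib sum_subtractf sum_distrib_left sum_divide_distrib mult.assoc)
    have "(\<Sum>b\<in>B. M a b * y b) = 0" if "a < Suc r" for a
    proof (cases "a = r")
      case True
      with p(2) show ?thesis unfolding * by (simp add: s_def)
    next
      case False
      with that x(2) show ?thesis unfolding * ** by simp
    qed
    moreover have "\<exists>b\<in>B. y b \<noteq> 0" using x(1) B' by (auto simp: y_def)
    ultimately show ?thesis by (intro exI[of _ y]) auto
  qed
qed

text \<open>The right-hand side is appended as column \<open>m\<close>, which gives \<open>m\<close>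
  homogeneous equations in \<open>m + 1\<close> unknowns. Injectivity forces the last coordinate of
  a nontrivial solution to be nonzero, and dividing by it solves the system.\<close>

lemma injective_square_system_solvable:
  assumes inj: "\<And>x. (\<And>a. a < m \<Longrightarrow> mvec m M x a = 0) \<Longrightarrow> \<forall>a<m. x a = 0"
  shows "\<exists>x. \<forall>a<m. mvec m M x a = y a"
proof -
  let ?M = "\<lambda>a b. if b = m then - y a else M a b"
  obtain x where x: "\<exists>b\<in>{..<Suc m}. x b \<noteq> 0" "\<forall>a<m. (\<Sum>b\<in>{..<Suc m}. ?M a b * x b) = 0"
    using homogeneous_system_solution[of "{..<Suc m}" m ?M] by (metis card_lessThan finite_lessThan lessI)
  have x': "mvec m M x a = y a * x m" if "a < m" for a
  proof -
    have "mvec m M x a = (\<Sum>b<m. (if b = m then - y a else M a b) * x b)"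
      by (intro sum.cong) auto
    also have "\<dots> = (\<Sum>b\<in>{..<Suc m}. ?M a b * x b) + y a * x m" by simp
    finally show ?thesis using x(2) that by simp
  qed
  have "x m \<noteq> 0"
  proof
    assume "x m = 0"
    have "mvec m M x a = 0" if "a < m" for a using x'[OF that] \<open>x m = 0\<close> by simp
    then have "\<forall>a<m. x a = 0" by (rule inj)
    with \<open>x m = 0\<close> x(1) show False by (auto simp: less_Suc_eq)
  qed
  have "mvec m M (\<lambda>b. x b / x m) a = y a" if "a < m" for a
    using x'[OF that] \<open>x m \<noteq> 0\<close> by (simp add: sum_divide_distrib[symmetric])
  then show ?thesis by (intro exI[of _ "\<lambda>b. x b / x m"]) simp
qed

section \<open>Orthogonal projection onto the span of orthonormal columns\<close>

context
  fixes n m :: nat and X :: rmat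
  assumes on: "orthonormal_cols n m X"
begin

lemma orthonormal_cols_coeff:
  assumes "b < m"
  shows "dot n (\<lambda>i. \<Sum>a<m. u a * X i a) (col X b) = u b"
proof -
  have "dot n (\<lambda>i. \<Sum>a<m. u a * X i a) (col X b)
      = dot n (col X b) (\<lambda>i. \<Sum>a<m. u a * X i a)"
    by (simp only: mult.commute)
  also have "\<dots> = (\<Sum>a<m. u a * (if b = a then 1 else 0))"
    by (subst dot_sum_right, intro sum.cong) (use on assms in \<open>auto simp: orthonormal_cols_def\<close>)
  also have "\<dots> = u b" using assms by (simp add: if_distrib cong: if_cong)
  finally show ?thesis .
qed

lemma orthonormal_cols_dot:
  "dot n (\<lambda>i. \<Sum>a<m. u a * X i a) (\<lambda>i. \<Sum>a<m. v a * X i a) = dot m u v"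
  by (subst dot_sum_right, intro sum.cong) (auto simp: orthonormal_cols_coeff)

lemma orthonormal_cols_vnorm: "vnorm n (\<lambda>i. \<Sum>a<m. u a * X i a) = vnorm m u"
proof -
  have "(vnorm n (\<lambda>i. \<Sum>a<m. u a * X i a))^2 = (vnorm m u)^2"
    unfolding vnorm_power2_dot by (rule orthonormal_cols_dot)
  then show ?thesis by (simp add: power2_eq_iff_nonneg)
qed

abbreviation "residual x \<equiv> (\<lambda>i. x i - (\<Sum>a<m. dot n x (col X a) * X i a))"

text \<open>The residual is the orthogonal projection onto the complement of the columns. The form
  with two vectors is what \<open>proj_rows_dot\<close> needs; \<open>x = y\<close> gives
  Pythagoras.\<close>

lemma dot_residual:
  "dot n (residual x) (residual y)
    = dot n x y - dot m (\<lambda>a. dot n x (col X a)) (\<lambda>a. dot n y (col X a))"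
proof -
  define c where "c x a = dot n x (col X a)" for x a
  define p where "p x i = (\<Sum>a<m. c x a * X i a)" for x i
  have xp: "dot n x (p y) = dot m (c y) (c x)" for x y
    unfolding p_def c_def by (rule dot_sum_right)
  have pp: "dot n (p x) (p y) = dot m (c x) (c y)" for x y
    unfolding p_def by (rule orthonormal_cols_dot)
  have "dot n (\<lambda>i. x i - p x i) (\<lambda>i. y i - p y i)
      = dot n x y - dot n x (p y) - dot n y (p x) + dot n (p x) (p y)"
    by (simp add: algebra_simps sum_subtractf sum.distrib)
  also have "\<dots> = dot n x y - dot m (c x) (c y)"
    unfolding xp[of x y] xp[of y x] pp by (simp add: mult.commute)
  finally show ?thesis by (simp only: p_def c_def)
qed

lemma orthonormal_cols_pythagoras:
  "(vnorm n x)^2 = (vnorm m (\<lambda>a. dot n x (col X a)))^2 + (vnorm n (residual x))^2"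
  unfolding vnorm_power2_dot dot_residual by simp

lemma bessel: "vnorm m (\<lambda>a. dot n x (col X a)) \<le> vnorm n x"
  by (rule power2_le_imp_le) (simp_all add: orthonormal_cols_pythagoras[of x])

lemma orthonormal_cols_residual:
  "vnorm n (residual x) \<le> vnorm n x"
  by (rule power2_le_imp_le) (simp_all add: orthonormal_cols_pythagoras[of x])

end

text \<open>Vectors are functions on all of \<open>nat\<close>, so compactness is that of the
  product topology. Vanishing beyond \<open>n\<close> and having coordinates in
  \<open>[-1, 1]\<close> puts the set into a product of compact sets, in which the remaining
  conditions are closed.\<close>

lemma compact_coordinate_subspace_sphere:
  fixes X :: rmat
  shows "compact {x :: nat \<Rightarrow> real. (\<forall>i\<ge>n. x i = 0) \<and> dot n x x = 1 \<and> (\<forall>a<m. dot n x (col X a) = 0)}"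
    (is "compact ?S")
proof -
  define P where "P = PiE (UNIV :: nat set) (\<lambda>i. if i < n then {-1..1::real} else {0})"
  have "compactin (product_topology (\<lambda>_. euclidean) UNIV) P"
    unfolding P_def by (subst compactin_PiE) auto
  then have "compact P" by (simp add: euclidean_product_topology)
  have c: "continuous_on UNIV (\<lambda>x :: nat \<Rightarrow> real. x i)" for i
    by (rule continuous_on_product_coordinates)
  have "closed ({x :: nat \<Rightarrow> real. dot n x x = 1} \<inter> (\<Inter>a\<in>{..<m}. {x. dot n x (col X a) = 0}))"
    by (intro closed_Int closed_INT ballI closed_Collect_eq continuous_intros c)
  with \<open>compact P\<close> have "compact (P \<inter> ({x. dot n x x = 1} \<inter> (\<Inter>a\<in>{..<m}. {x. dot n x (col X a) = 0})))"
    by (rule compact_Int_closed)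
  also have "P \<inter> ({x. dot n x x = 1} \<inter> (\<Inter>a\<in>{..<m}. {x. dot n x (col X a) = 0})) = ?S"
  proof (intro equalityI subsetI)
    fix x assume x: "x \<in> ?S"
    have "x i \<in> {-1..1}" if "i < n" for i
    proof -
      have "(x i)^2 \<le> dot n x x" using that
        by (auto simp: power2_eq_square intro!: member_le_sum[of i "{..<n}" "\<lambda>i. x i * x i"])
      then have "(x i)^2 \<le> 1^2" using x by simp
      then have "\<bar>x i\<bar> \<le> 1" by (metis abs_le_square_iff abs_one)
      then show ?thesis by auto
    qed
    with x show "x \<in> P \<inter> ({x. dot n x x = 1} \<inter> (\<Inter>a\<in>{..<m}. {x. dot n x (col X a) = 0}))"
      by (auto simp: P_def)
  next
    fix x assume "x \<in> P \<inter> ({x. dot n x x = 1} \<inter> (\<Inter>a\<in>{..<m}. {x. dot n x (col X a) = 0}))"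
    moreover from this have "x i = 0" if "i \<ge> n" for i
      using that by (auto simp: P_def PiE_def Pi_def split: if_splits dest: spec[of _ i])
    ultimately show "x \<in> ?S" by auto
  qed
  finally show ?thesis .
qed

text \<open>A replacement for the spectral theorem that starts from what \<open>top_eigvecs\<close>
  offers, a bound on eigenvalues. The complement \<open>V\<close> of the given eigenvectors is
  invariant under the symmetric \<open>M\<close>. The norm of \<open>M\<close> on \<open>V\<close>
  is attained at some unit vector \<open>u\<close>, and \<open>u\<close> yields an eigenvector in
  \<open>V\<close> whose eigenvalue has that norm as its absolute value.\<close>

lemma symmetric_bounded_by_eigenvalues:
  fixes M X :: rmat
  assumes sym: "\<And>i j. i < n \<Longrightarrow> j < n \<Longrightarrow> M i j = M j i"
    and inv: "\<And>a i. a < m \<Longrightarrow> i < n \<Longrightarrow> mvec n M (col X a) i = nu a * X i a"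
    and eig: "\<And>u \<mu>. is_eigvec n M u \<mu> \<Longrightarrow> (\<And>a. a < m \<Longrightarrow> dot n u (col X a) = 0) \<Longrightarrow> \<bar>\<mu>\<bar> \<le> B"
    and x: "\<And>a. a < m \<Longrightarrow> dot n x (col X a) = 0"
    and "B \<ge> 0"
  shows "vnorm n (mvec n M x) \<le> B * vnorm n x"
proof (cases "vnorm n x = 0")
  case True
  then have "mvec n M x i = 0" for i by (simp add: vnorm_eq_0_iff)
  then show ?thesis using True by (simp add: L2_set_def)
next
  case False
  define V where "V = {x. \<forall>a<m. dot n x (col X a) = 0}"
  define S where "S = {x :: nat \<Rightarrow> real. (\<forall>i\<ge>n. x i = 0) \<and> dot n x x = 1 \<and> (\<forall>a<m. dot n x (col X a) = 0)}"
  define f where "f x = dot n (mvec n M x) (mvec n M x)" for x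
  define unit where "unit y i = (if i < n then y i / vnorm n y else 0)" for y :: "nat \<Rightarrow> real" and i
  have V_inv: "mvec n M y \<in> V" if "y \<in> V" for y
  proof -
    have "dot n (mvec n M y) (col X a) = 0" if "a < m" for a
    proof -
      have "dot n (mvec n M y) (col X a) = dot n y (mvec n M (col X a))"
        using dot_mvec_symmetric[OF sym] by simp
      also have "\<dots> = (\<Sum>i<n. nu a * (y i * X i a))"
        by (intro sum.cong refl) (simp add: inv[OF that])
      also have "\<dots> = 0" using \<open>y \<in> V\<close> that by (simp add: V_def sum_distrib_left[symmetric])
      finally show ?thesis .
    qed
    then show ?thesis by (simp add: V_def)
  qed
  have unit: "unit y \<in> S" if "y \<in> V" "vnorm n y \<noteq> 0" for y
  proof -
    have "dot n (unit y) (unit y) = (vnorm n y)^2 / (vnorm n y)^2"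
    proof -
      have "dot n (unit y) (unit y) = dot n y y / (vnorm n y)^2"
        by (simp add: unit_def sum_divide_distrib power2_eq_square)
      then show ?thesis by (simp add: vnorm_power2_dot)
    qed
    moreover have "dot n (unit y) (col X a) = dot n y (col X a) / vnorm n y" for a
      by (simp add: unit_def sum_divide_distrib)
    moreover have "unit y i = 0" if "i \<ge> n" for i using that by (simp add: unit_def)
    ultimately show ?thesis using that by (simp add: S_def V_def vnorm_power2_dot[symmetric])
  qed
  have f_unit: "f y = f (unit y) * (vnorm n y)^2" if "vnorm n y \<noteq> 0" for y
  proof -
    have "mvec n M (unit y) i = mvec n M y i / vnorm n y" for i
      by (simp add: unit_def sum_divide_distrib)
    then show ?thesis using that
      by (simp add: f_def power2_eq_square sum_divide_distrib[symmetric])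
  qed
  have "x \<in> V" using x by (simp add: V_def)
  have c: "continuous_on S (\<lambda>x :: nat \<Rightarrow> real. x i)" for i
    by (rule continuous_on_subset[OF continuous_on_product_coordinates subset_UNIV])
  have "continuous_on S f" unfolding f_def by (intro continuous_intros c)
  moreover have "S \<noteq> {}" using unit[OF \<open>x \<in> V\<close> False] by auto
  moreover have "compact S" unfolding S_def by (rule compact_coordinate_subspace_sphere)
  ultimately obtain u where u: "u \<in> S" "\<And>y. y \<in> S \<Longrightarrow> f y \<le> f u"
    using continuous_attains_sup[of S f] by auto
  define l where "l = vnorm n (mvec n M u)"
  have l2: "l^2 = f u" "l \<ge> 0" by (simp_all add: l_def f_def vnorm_power2_dot)
  have "u \<in> V" and u1: "vnorm n u = 1"
    using u(1) vnorm_power2_dot[of u n] by (auto simp: S_def V_def L2_set_def power2_eq_square)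
  have bd: "vnorm n (mvec n M y) \<le> l * vnorm n y" if "y \<in> V" for y
  proof (cases "vnorm n y = 0")
    case True
    then have "mvec n M y i = 0" for i by (simp add: vnorm_eq_0_iff)
    then show ?thesis using True by (simp add: L2_set_def)
  next
    case False
    have "(vnorm n (mvec n M y))^2 = f y" by (simp add: f_def vnorm_power2_dot)
    also have "\<dots> \<le> l^2 * (vnorm n y)^2"
      unfolding f_unit[OF False] l2 using u(2)[OF unit[OF that False]] by (intro mult_right_mono) auto
    also have "\<dots> = (l * vnorm n y)^2" by (simp add: power_mult_distrib)
    finally show ?thesis by (rule power2_le_imp_le) (simp add: l2)
  qed
  define w where "w = mvec n M u"
  have "w \<in> V" unfolding w_def by (rule V_inv[OF \<open>u \<in> V\<close>])
  have nw: "vnorm n w = l" by (simp add: w_def l_def)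
  \<comment> \<open>Equality in the Cauchy--Schwarz inequality for \<open>u\<close> and \<open>M (M u)\<close>.\<close>
  have Mw: "mvec n M w i = l^2 * u i" if "i < n" for i
  proof -
    let ?z = "\<lambda>i. mvec n M w i - l^2 * u i"
    have uMw: "dot n (mvec n M w) u = l^2"
      using dot_mvec_symmetric[of n M w u] sym nw vnorm_power2_dot[of w n] by (simp add: w_def)
    have "(vnorm n ?z)^2 = (vnorm n (mvec n M w))^2 - (l * l)^2"
      unfolding vnorm_diff_power2 uMw u1 by (simp add: power2_eq_square)
    also have "\<dots> \<le> 0"
    proof -
      have "(vnorm n (mvec n M w))^2 \<le> (l * l)^2"
        using bd[OF \<open>w \<in> V\<close>] nw by (intro power_mono) auto
      then show ?thesis by simp
    qed
    finally have "vnorm n ?z = 0" by simp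
    then show ?thesis using that by (simp add: vnorm_eq_0_iff)
  qed
  \<comment> \<open>Since \<open>(M - l) (M + l) u = 0\<close>, either \<open>M u + l u\<close> is
    an eigenvector for \<open>l\<close>, or it vanishes and \<open>u\<close> is one for
    \<open>- l\<close>.\<close>
  have "l \<le> B"
  proof (cases "\<exists>i<n. w i + l * u i \<noteq> 0")
    case True
    have "mvec n M (\<lambda>i. w i + l * u i) i = l * (w i + l * u i)" if "i < n" for i
    proof -
      have "mvec n M (\<lambda>i. w i + l * u i) i = mvec n M w i + l * mvec n M u i"
        by (simp add: algebra_simps sum.distrib sum_distrib_left)
      then show ?thesis using Mw[OF that] by (simp add: w_def power2_eq_square algebra_simps)
    qed
    then have "is_eigvec n M (\<lambda>i. w i + l * u i) l" using True by (simp add: is_eigvec_def)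
    moreover have "dot n (\<lambda>i. w i + l * u i) (col X a) = 0" if "a < m" for a
    proof -
      have "dot n (\<lambda>i. w i + l * u i) (col X a) = dot n w (col X a) + l * dot n u (col X a)"
        by (simp add: algebra_simps sum.distrib sum_distrib_left)
      then show ?thesis using that \<open>w \<in> V\<close> \<open>u \<in> V\<close> by (simp add: V_def)
    qed
    ultimately have "\<bar>l\<bar> \<le> B" by (rule eig)
    then show ?thesis by simp
  next
    case False
    then have "mvec n M u i = - l * u i" if "i < n" for i
      using that by (auto simp: w_def eq_neg_iff_add_eq_0)
    moreover have "\<exists>i<n. u i \<noteq> 0" using u1 vnorm_eq_0_iff[of u n] by auto
    ultimately have "is_eigvec n M u (- l)" by (simp add: is_eigvec_def)
    then have "\<bar>- l\<bar> \<le> B" by (rule eig) (use \<open>u \<in> V\<close> in \<open>simp add: V_def\<close>)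
    then show ?thesis by simp
  qed
  then show ?thesis using bd[OF \<open>x \<in> V\<close>] mult_right_mono[of l B "vnorm n x"] by simp
qed

section \<open>Perturbation of eigenvectors\<close>

lemma dot_sum_left: "dot n (\<lambda>i. \<Sum>a<m. u a * M i a) x = (\<Sum>a<m. u a * dot n (\<lambda>i. M i a) x)"
  using dot_sum_right[of x u M m n] by (simp only: mult.commute)

lemma mvec_sum: "mvec n M (\<lambda>j. \<Sum>a<m. u a * X j a) i = (\<Sum>a<m. u a * mvec n M (col X a) i)"
  by (rule dot_sum_right)

lemma mvec_diff: "mvec n M (\<lambda>j. x j - y j) i = mvec n M x i - mvec n M y i"
  by (simp add: right_diff_distrib sum_subtractf)

lemma mult_diff_sum:
  fixes k :: real
  shows "k * (y - (\<Sum>a<m. c a * z a)) = k * y - (\<Sum>a<m. k * c a * z a)"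
  by (simp add: right_diff_distrib sum_distrib_left mult.assoc)

lemma sum_mult_sum_swap:
  fixes c :: "nat \<Rightarrow> real"
  shows "(\<Sum>b<k. \<Sum>a<m. c b * (w b a * z a)) = (\<Sum>a<m. (\<Sum>b<k. c b * w b a) * z a)"
  by (subst sum.swap) (simp only: sum_distrib_right mult.assoc)

context
  fixes n m :: nat and Th A X Xh :: rmat and mu nu :: "nat \<Rightarrow> real" and sg e :: real
  assumes dec: "nonzero_eigdecomp n m Th X mu"
    and top: "top_eigvecs n m A Xh nu"
    and A_sym: "\<And>i j. A i j = A j i"
    and sg: "\<And>a. a < m \<Longrightarrow> sg \<le> \<bar>mu a\<bar>"
    and E_bound: "\<And>x. vnorm n (mvec n (\<lambda>i j. A i j - Th i j) x) \<le> e * vnorm n x"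
    and e: "0 \<le> e" "4 * e \<le> sg" "0 < sg"
begin

private abbreviation (input) "E \<equiv> \<lambda>i j. A i j - Th i j"

private lemma on: "orthonormal_cols n m X" using dec by (simp add: nonzero_eigdecomp_def)
private lemma onh: "orthonormal_cols n m Xh" using top by (simp add: top_eigvecs_def)

private lemma Th_eq: "i < n \<Longrightarrow> j < n \<Longrightarrow> Th i j = (\<Sum>a<m. mu a * X i a * X j a)"
  using dec by (simp add: nonzero_eigdecomp_def)

private lemma E_sym: "i < n \<Longrightarrow> j < n \<Longrightarrow> E i j = E j i"
  using A_sym[of i j] by (simp add: Th_eq mult_ac)

private lemma Th_mvec: "i < n \<Longrightarrow> mvec n Th x i = (\<Sum>a<m. (mu a * dot n x (col X a)) * X i a)"
proof -
  assume i: "i < n"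
  have "mvec n Th x i = (\<Sum>j<n. \<Sum>a<m. mu a * X i a * X j a * x j)"
    by (intro sum.cong refl) (simp add: Th_eq[OF i] sum_distrib_right)
  also have "\<dots> = (\<Sum>a<m. \<Sum>j<n. mu a * X i a * X j a * x j)" by (rule sum.swap)
  finally show ?thesis by (simp add: sum_distrib_left mult_ac)
qed

private lemma A_mvec: "mvec n A x i = mvec n Th x i + mvec n E x i"
  by (simp add: left_diff_distrib sum_subtractf)

text \<open>Weyl's inequality by counting dimensions: the span of the \<open>m\<close> columns of
  \<open>X\<close> contains a nonzero \<open>x\<close> orthogonal to the \<open>m - 1\<close>
  columns of \<open>Xh\<close> other than \<open>b\<close>. On it \<open>Th\<close> stretches by at
  least \<open>sg\<close>, and \<open>A\<close> by at most \<open>\<bar>nu b\<bar>\<close>.\<close>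

lemma top_eigenvalue_lower_bound:
  assumes b: "b < m"
  shows "sg - e \<le> \<bar>nu b\<bar>"
proof -
  \<comment> \<open>An enumeration of the indices below \<open>m\<close> that skips
    \<open>b\<close>.\<close>
  define k where "k a = (if a < b then a else Suc a)" for a
  have k: "k a < m" "k a \<noteq> b" if "a < m - 1" for a using that b by (auto simp: k_def)
  have k_ex: "\<exists>a'<m - 1. a = k a'" if "a < m" "a \<noteq> b" for a
  proof (cases "a < b")
    case True
    then show ?thesis using b by (intro exI[of _ a]) (auto simp: k_def)
  next
    case False
    then show ?thesis using that by (intro exI[of _ "a - 1"]) (auto simp: k_def)
  qed
  obtain y where y: "\<exists>c\<in>{..<m}. y c \<noteq> 0"
      "\<forall>a<m - 1. (\<Sum>c\<in>{..<m}. dot n (col X c) (\<lambda>i. Xh i (k a)) * y c) = 0"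
  proof -
    have "m - 1 < card {..<m}" using b by simp
    from homogeneous_system_solution[OF finite_lessThan this, of "\<lambda>a c. dot n (col X c) (\<lambda>i. Xh i (k a))"]
    show thesis by (elim exE conjE) (rule that)
  qed
  define x where "x i = (\<Sum>c<m. y c * X i c)" for i
  have nx: "vnorm n x = vnorm m y" unfolding x_def by (rule orthonormal_cols_vnorm[OF on])
  have x_orth: "dot n x (\<lambda>i. Xh i (k a)) = 0" if "a < m - 1" for a
    unfolding x_def dot_sum_left using y(2) that by (simp add: mult.commute)
  have "mvec n Th x i = (\<Sum>a<m. (mu a * y a) * X i a)" if "i < n" for i
    unfolding Th_mvec[OF that] unfolding x_def
    by (intro sum.cong refl) (simp add: orthonormal_cols_coeff[OF on])
  then have "vnorm n (mvec n Th x) = vnorm n (\<lambda>i. \<Sum>a<m. (mu a * y a) * X i a)"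
    by (intro L2_set_cong) auto
  also have "\<dots> = vnorm m (\<lambda>a. mu a * y a)" by (rule orthonormal_cols_vnorm[OF on])
  also have "\<dots> \<ge> vnorm m (\<lambda>a. sg * \<bar>y a\<bar>)"
  proof -
    have "vnorm m (\<lambda>a. sg * \<bar>y a\<bar>) \<le> vnorm m (\<lambda>a. \<bar>mu a * y a\<bar>)"
      using sg e by (intro L2_set_mono) (auto simp: abs_mult intro!: mult_right_mono)
    then show ?thesis by (simp only: vnorm_abs)
  qed
  finally have "sg * vnorm n x \<le> vnorm n (mvec n Th x)"
    using e nx by (simp add: vnorm_scale vnorm_abs)
  moreover have "vnorm n (mvec n Th x) \<le> vnorm n (mvec n A x) + vnorm n (mvec n E x)"
    using vnorm_diff_le[of "mvec n A x" "mvec n E x" n] by (simp add: A_mvec)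
  moreover have "vnorm n (mvec n A x) \<le> \<bar>nu b\<bar> * vnorm n x"
  proof (rule symmetric_bounded_by_eigenvalues[where m="m - 1" and X="\<lambda>i a. Xh i (k a)" and nu="nu \<circ> k"])
    show "A i j = A j i" for i j by (rule A_sym)
    show "mvec n A (\<lambda>i. Xh i (k a)) i = (nu \<circ> k) a * Xh i (k a)" if "a < m - 1" "i < n" for a i
      using top k(1)[OF that(1)] that(2) by (simp add: top_eigvecs_def)
    show "dot n x (\<lambda>i. Xh i (k a)) = 0" if "a < m - 1" for a by (rule x_orth[OF that])
    \<comment> \<open>If \<open>u\<close> is orthogonal to column \<open>b\<close> as well, the
      maximality in \<open>top_eigvecs\<close> applies. Otherwise the symmetry of \<open>A\<close>
      forces \<open>\<mu> = nu b\<close>, as eigenvectors for distinct eigenvalues are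
      orthogonal.\<close>
    fix u \<mu> assume u: "is_eigvec n A u \<mu>" "\<And>a. a < m - 1 \<Longrightarrow> dot n u (\<lambda>i. Xh i (k a)) = 0"
    show "\<bar>\<mu>\<bar> \<le> \<bar>nu b\<bar>"
    proof (cases "dot n u (col Xh b) = 0")
      case True
      have "dot n u (col Xh a) = 0" if "a < m" for a
        using k_ex[OF that] u(2) True by (cases "a = b") auto
      then show ?thesis using top u(1) b unfolding top_eigvecs_def by blast
    next
      case False
      have "\<mu> * dot n u (col Xh b) = dot n (mvec n A u) (col Xh b)"
        using u(1) by (simp add: is_eigvec_def sum_distrib_left mult.assoc)
      also have "\<dots> = dot n u (mvec n A (col Xh b))"
        by (rule dot_mvec_symmetric[symmetric]) (rule A_sym)
      also have "\<dots> = (\<Sum>i<n. nu b * (u i * Xh i b))"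
        using top b by (intro sum.cong refl) (simp add: top_eigvecs_def)
      finally have "\<mu> * dot n u (col Xh b) = nu b * dot n u (col Xh b)"
        by (simp add: sum_distrib_left)
      with False show ?thesis by simp
    qed
  qed simp
  ultimately have "sg * vnorm n x \<le> \<bar>nu b\<bar> * vnorm n x + e * vnorm n x"
    using E_bound[of x] by linarith
  then have "(sg - e) * vnorm n x \<le> \<bar>nu b\<bar> * vnorm n x" by (simp add: left_diff_distrib)
  moreover have "vnorm n x > 0"
    using y(1) nx vnorm_eq_0_iff[of y m] L2_set_nonneg[of y "{..<m}"] by (auto simp: less_le)
  ultimately show ?thesis by simp
qed

abbreviation (input) "proj_error \<equiv> \<lambda>i b. Xh i b - (\<Sum>a<m. dot n (col Xh b) (col X a) * X i a)"

private lemma nu_ge: "b < m \<Longrightarrow> sg / 2 \<le> \<bar>nu b\<bar>" "b < m \<Longrightarrow> nu b \<noteq> 0"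
  using top_eigenvalue_lower_bound[of b] e by auto

text \<open>The projection \<open>1 - X X^T\<close> annihilates \<open>Th\<close>, so applied to the
  eigenvalue equation of column \<open>b\<close> of \<open>Xh\<close> it leaves only the noise
  term.\<close>

private lemma nu_proj_error:
  assumes b: "b < m" and i: "i < n"
  defines "w \<equiv> mvec n E (col Xh b)"
  shows "nu b * proj_error i b = w i - (\<Sum>a<m. dot n w (col X a) * X i a)"
proof -
  have *: "nu b * Xh i b = (\<Sum>a<m. (mu a * dot n (col Xh b) (col X a)) * X i a) + w i" if "i < n" for i
  proof -
    have "nu b * Xh i b = mvec n A (col Xh b) i" using top that b by (simp add: top_eigvecs_def)
    then show ?thesis by (simp only: A_mvec Th_mvec[OF that] w_def)
  qed
  have **: "nu b * dot n (col Xh b) (col X a)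
      = mu a * dot n (col Xh b) (col X a) + dot n w (col X a)" if a: "a < m" for a
  proof -
    have "nu b * dot n (col Xh b) (col X a) = dot n (\<lambda>i. nu b * Xh i b) (col X a)"
      by (simp add: sum_distrib_left mult.assoc)
    also have "\<dots> = dot n (\<lambda>i. (\<Sum>a<m. (mu a * dot n (col Xh b) (col X a)) * X i a) + w i) (col X a)"
      by (intro sum.cong refl) (simp only: * lessThan_iff)
    also have "\<dots> = dot n (\<lambda>i. \<Sum>a<m. (mu a * dot n (col Xh b) (col X a)) * X i a) (col X a)
        + dot n w (col X a)"
      by (simp only: distrib_right sum.distrib)
    also have "dot n (\<lambda>i. \<Sum>a<m. (mu a * dot n (col Xh b) (col X a)) * X i a) (col X a)
        = mu a * dot n (col Xh b) (col X a)"
      by (rule orthonormal_cols_coeff[OF on a])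
    finally show ?thesis .
  qed
  have "nu b * proj_error i b = nu b * Xh i b - (\<Sum>a<m. nu b * dot n (col Xh b) (col X a) * X i a)"
    by (rule mult_diff_sum)
  also have "(\<Sum>a<m. nu b * dot n (col Xh b) (col X a) * X i a)
      = (\<Sum>a<m. (mu a * dot n (col Xh b) (col X a)) * X i a) + (\<Sum>a<m. dot n w (col X a) * X i a)"
    unfolding sum.distrib[symmetric] by (intro sum.cong refl) (simp only: ** lessThan_iff distrib_right)
  finally show ?thesis unfolding *[OF i] by simp
qed

text \<open>The left-hand side is the length of the row \<open>E_i X\<close> times the cross Gram
  matrix \<open>X^T Xh\<close>, which is a contraction since both factors have orthonormal
  columns.\<close>

private lemma vnorm_E_proj_le:
  "vnorm m (\<lambda>b. mvec n E (\<lambda>j. \<Sum>a<m. dot n (col Xh b) (col X a) * X j a) i)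
    \<le> vnorm m (\<lambda>a. mvec n E (col X a) i)"
proof -
  let ?z = "\<lambda>j. \<Sum>a<m. mvec n E (col X a) i * X j a"
  have "vnorm m (\<lambda>b. mvec n E (\<lambda>j. \<Sum>a<m. dot n (col Xh b) (col X a) * X j a) i)
      = vnorm m (\<lambda>b. dot n ?z (col Xh b))"
  proof (rule L2_set_cong[OF refl])
    fix b
    have "mvec n E (\<lambda>j. \<Sum>a<m. dot n (col Xh b) (col X a) * X j a) i
        = (\<Sum>a<m. dot n (col Xh b) (col X a) * mvec n E (col X a) i)" by (rule mvec_sum)
    also have "\<dots> = (\<Sum>a<m. mvec n E (col X a) i * dot n (col X a) (col Xh b))"
      by (intro sum.cong refl) (simp only: mult.commute)
    also have "\<dots> = dot n ?z (col Xh b)" by (rule dot_sum_left[symmetric])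
    finally show "mvec n E (\<lambda>j. \<Sum>a<m. dot n (col Xh b) (col X a) * X j a) i = dot n ?z (col Xh b)" .
  qed
  also have "\<dots> \<le> vnorm n ?z" by (rule bessel[OF onh])
  also have "\<dots> = vnorm m (\<lambda>a. mvec n E (col X a) i)" by (rule orthonormal_cols_vnorm[OF on])
  finally show ?thesis .
qed

private lemma E_Xh_split:
  "mvec n E (col Xh b) i = mvec n E (\<lambda>j. \<Sum>a<m. dot n (col Xh b) (col X a) * X j a) i
     + mvec n E (\<lambda>j. proj_error j b) i"
proof -
  have "mvec n E (\<lambda>j. proj_error j b) i = mvec n E (col Xh b) i
      - mvec n E (\<lambda>j. \<Sum>a<m. dot n (col Xh b) (col X a) * X j a) i" by (rule mvec_diff)
  then show ?thesis by linarith
qed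

private lemma divide_nu_le: "b < m \<Longrightarrow> \<bar>t / nu b\<bar> \<le> 2 / sg * \<bar>t\<bar>"
proof -
  assume b: "b < m"
  have "\<bar>t\<bar> * (sg / 2) \<le> \<bar>t\<bar> * \<bar>nu b\<bar>" using nu_ge(1)[OF b] by (intro mult_left_mono) auto
  then show ?thesis using nu_ge(2)[OF b] e by (simp add: field_simps abs_divide)
qed

text \<open>By \<open>nu_proj_error\<close> the row is made of \<open>E_i Xh\<close> and
  \<open>X_i (X^T E Xh)\<close>. In the former, \<open>Xh = X X^T Xh + Y\<close> separates a term
  with the fixed weights \<open>X\<close> from \<open>E_i Y\<close>; the latter is
  \<open>(E X X_i)^T Xh\<close> and is bounded through the operator norm.\<close>

lemma proj_error_row_bound:
  assumes i: "i < n"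
  shows "vnorm m (proj_error i) \<le> 2 / sg * (vnorm m (\<lambda>a. mvec n E (col X a) i)
           + vnorm m (\<lambda>b. mvec n E (\<lambda>j. proj_error j b) i) + e * vnorm m (X i))"
proof -
  define w where "w b = mvec n E (col Xh b)" for b
  define v where "v b = w b i - (\<Sum>a<m. dot n (w b) (col X a) * X i a)" for b
  let ?z = "\<lambda>j. \<Sum>a<m. X i a * X j a"
  have "vnorm m (proj_error i) = vnorm m (\<lambda>b. \<bar>v b / nu b\<bar>)"
  proof -
    have divide: "p = t / k" if "k * p = t" "k \<noteq> 0" for k p t :: real
      using that by (simp add: field_simps)
    have "proj_error i b = v b / nu b" if "b < m" for b
      using divide[OF nu_proj_error[OF that i] nu_ge(2)[OF that]] unfolding v_def w_def .
    then have "vnorm m (proj_error i) = vnorm m (\<lambda>b. v b / nu b)" by (intro L2_set_cong) auto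
    then show ?thesis by (simp only: vnorm_abs)
  qed
  also have "\<dots> \<le> vnorm m (\<lambda>b. 2 / sg * \<bar>v b\<bar>)"
    by (intro L2_set_mono divide_nu_le) auto
  also have "\<dots> = 2 / sg * vnorm m v" unfolding vnorm_scale vnorm_abs using e by simp
  finally have row: "vnorm m (proj_error i) \<le> 2 / sg * vnorm m v" .
  have "vnorm m v \<le> vnorm m (\<lambda>b. w b i) + vnorm m (\<lambda>b. \<Sum>a<m. dot n (w b) (col X a) * X i a)"
    unfolding v_def by (rule vnorm_diff_le)
  also have "vnorm m (\<lambda>b. w b i) \<le> vnorm m (\<lambda>a. mvec n E (col X a) i)
      + vnorm m (\<lambda>b. mvec n E (\<lambda>j. proj_error j b) i)"
    unfolding w_def E_Xh_split using vnorm_E_proj_le[of i]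
    by (intro order.trans[OF L2_set_triangle_ineq] add_mono) auto
  also have "vnorm m (\<lambda>b. \<Sum>a<m. dot n (w b) (col X a) * X i a) \<le> e * vnorm m (X i)"
  proof -
    have "(\<Sum>a<m. dot n (w b) (col X a) * X i a) = dot n (mvec n E ?z) (col Xh b)" for b
    proof -
      have "(\<Sum>a<m. dot n (w b) (col X a) * X i a) = dot n (w b) ?z"
        using dot_sum_right[of "w b" "X i" X m n] by (simp only: mult.commute)
      also have "\<dots> = dot n ?z (mvec n E (col Xh b))" by (simp only: w_def mult.commute)
      also have "\<dots> = dot n (mvec n E ?z) (col Xh b)" by (rule dot_mvec_symmetric) (rule E_sym)
      finally show ?thesis .
    qed
    then have "vnorm m (\<lambda>b. \<Sum>a<m. dot n (w b) (col X a) * X i a)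
        = vnorm m (\<lambda>b. dot n (mvec n E ?z) (col Xh b))" by (simp only:)
    also have "\<dots> \<le> vnorm n (mvec n E ?z)" by (rule bessel[OF onh])
    also have "\<dots> \<le> e * vnorm n ?z" by (rule E_bound)
    also have "vnorm n ?z = vnorm m (X i)" by (rule orthonormal_cols_vnorm[OF on])
    finally show ?thesis .
  qed
  finally have "vnorm m v \<le> vnorm m (\<lambda>a. mvec n E (col X a) i)
      + vnorm m (\<lambda>b. mvec n E (\<lambda>j. proj_error j b) i) + e * vnorm m (X i)" by simp
  then show ?thesis by (intro order.trans[OF row] mult_left_mono) (use e in auto)
qed

private lemma sum_vnorm_swap: "(\<Sum>b<m. (vnorm n (\<lambda>i. f i b))^2) = (\<Sum>i<n. (vnorm m (f i))^2)"
  unfolding L2_set_power2 by (rule sum.swap)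

text \<open>Up to the factor \<open>1 / (sg - e)\<close>, a column of \<open>Y\<close> is bounded by
  the same column of \<open>E X X^T Xh\<close> plus \<open>e\<close> times itself, and the latter is
  absorbed because \<open>4 * e \<le> sg\<close>. What remains is the Frobenius norm of
  \<open>E X\<close>; estimating it through the operator norm of \<open>E\<close> would bring back a
  logarithm.\<close>

lemma E_proj_error_frobenius:
  "(\<Sum>i<n. (vnorm m (\<lambda>b. mvec n E (\<lambda>j. proj_error j b) i))^2)
    \<le> (2 * e / sg)^2 * (\<Sum>i<n. (vnorm m (\<lambda>a. mvec n E (col X a) i))^2)"
proof -
  let ?Y = "\<lambda>b. vnorm n (\<lambda>i. proj_error i b)"
  let ?P = "\<lambda>b. vnorm n (mvec n E (\<lambda>j. \<Sum>a<m. dot n (col Xh b) (col X a) * X j a))"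
  let ?F = "L2_set (\<lambda>i. vnorm m (\<lambda>a. mvec n E (col X a) i)) {..<n}"
  have Y_le: "(sg - e) * ?Y b \<le> ?P b + e * ?Y b" if b: "b < m" for b
  proof -
    let ?w = "mvec n E (col Xh b)"
    have "(sg - e) * ?Y b \<le> \<bar>nu b\<bar> * ?Y b"
      using top_eigenvalue_lower_bound[OF b] by (intro mult_right_mono) auto
    also have "\<dots> = vnorm n (\<lambda>i. nu b * proj_error i b)" by (simp only: vnorm_scale)
    also have "\<dots> = vnorm n (\<lambda>i. ?w i - (\<Sum>a<m. dot n ?w (col X a) * X i a))"
      by (intro L2_set_cong refl nu_proj_error[OF b]) simp
    also have "\<dots> \<le> vnorm n ?w" by (rule orthonormal_cols_residual[OF on])
    also have "\<dots> \<le> ?P b + vnorm n (mvec n E (\<lambda>j. proj_error j b))"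
      unfolding E_Xh_split by (rule L2_set_triangle_ineq)
    also have "vnorm n (mvec n E (\<lambda>j. proj_error j b)) \<le> e * ?Y b" by (rule E_bound)
    finally show ?thesis by simp
  qed
  have "(sg - e) * L2_set ?Y {..<m} = L2_set (\<lambda>b. (sg - e) * ?Y b) {..<m}"
    using e by (intro L2_set_right_distrib) auto
  also have "\<dots> \<le> L2_set (\<lambda>b. ?P b + e * ?Y b) {..<m}"
    using e by (intro L2_set_mono Y_le) auto
  also have "\<dots> \<le> L2_set ?P {..<m} + L2_set (\<lambda>b. e * ?Y b) {..<m}" by (rule L2_set_triangle_ineq)
  also have "L2_set (\<lambda>b. e * ?Y b) {..<m} = e * L2_set ?Y {..<m}"
    using e by (intro L2_set_right_distrib[symmetric]) auto
  also have "L2_set ?P {..<m} \<le> ?F"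
  proof (rule power2_le_imp_le)
    show "(L2_set ?P {..<m})^2 \<le> ?F^2"
      unfolding L2_set_power2[of ?P] L2_set_power2[of "\<lambda>i. vnorm m (\<lambda>a. mvec n E (col X a) i)"] sum_vnorm_swap
      by (intro sum_mono power_mono vnorm_E_proj_le L2_set_nonneg)
  qed simp
  finally have "(sg - 2 * e) * L2_set ?Y {..<m} \<le> ?F" by (simp add: left_diff_distrib)
  moreover have "sg / 2 * L2_set ?Y {..<m} \<le> (sg - 2 * e) * L2_set ?Y {..<m}"
    using e by (intro mult_right_mono) auto
  ultimately have YF: "L2_set ?Y {..<m} \<le> 2 / sg * ?F" using e by (simp add: field_simps)
  have "(\<Sum>i<n. (vnorm m (\<lambda>b. mvec n E (\<lambda>j. proj_error j b) i))^2)
      = (\<Sum>b<m. (vnorm n (mvec n E (\<lambda>j. proj_error j b)))^2)"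
    by (rule sum_vnorm_swap[symmetric])
  also have "\<dots> \<le> (\<Sum>b<m. (e * ?Y b)^2)"
    by (intro sum_mono power_mono E_bound L2_set_nonneg)
  also have "\<dots> = e^2 * (L2_set ?Y {..<m})^2"
    unfolding L2_set_power2[of ?Y] by (simp only: power_mult_distrib sum_distrib_left)
  also have "\<dots> \<le> e^2 * (2 / sg * ?F)^2"
    by (intro mult_left_mono power_mono YF) auto
  also have "\<dots> = (2 * e / sg)^2 * ?F^2" by (simp add: power_mult_distrib power_divide)
  finally show ?thesis unfolding L2_set_power2[of "\<lambda>i. vnorm m (\<lambda>a. mvec n E (col X a) i)"] .
qed

text \<open>A bound on the operator norm of \<open>Y\<close>, the sine of the largest angle between
  the two eigenspaces. \<open>Y u\<close> is the residual of \<open>E\<close> applied to the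
  combination of the columns of \<open>Xh\<close> with coefficients \<open>u b / nu b\<close>, whose
  length is at most \<open>2 / sg\<close> times that of \<open>u\<close>.\<close>

private lemma proj_error_comb:
  "vnorm n (\<lambda>i. \<Sum>b<m. u b * proj_error i b) \<le> 2 * e / sg * vnorm m u"
proof -
  let ?x = "\<lambda>j. \<Sum>b<m. (u b / nu b) * Xh j b"
  let ?w = "mvec n E ?x"
  have "(\<Sum>b<m. u b * proj_error i b) = ?w i - (\<Sum>a<m. dot n ?w (col X a) * X i a)" if i: "i < n" for i
  proof -
    have 1: "?w i = (\<Sum>b<m. (u b / nu b) * mvec n E (col Xh b) i)" for i by (rule mvec_sum)
    have 2: "dot n ?w (col X a) = (\<Sum>b<m. (u b / nu b) * dot n (mvec n E (col Xh b)) (col X a))" for a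
      unfolding 1 by (rule dot_sum_left)
    have "(\<Sum>b<m. u b * proj_error i b) = (\<Sum>b<m. (u b / nu b) * (nu b * proj_error i b))"
      by (intro sum.cong refl) (simp add: nu_ge)
    also have "\<dots> = (\<Sum>b<m. (u b / nu b) * (mvec n E (col Xh b) i -
        (\<Sum>a<m. dot n (mvec n E (col Xh b)) (col X a) * X i a)))"
      by (intro sum.cong refl) (simp only: nu_proj_error[OF _ i] lessThan_iff)
    also have "\<dots> = ?w i - (\<Sum>b<m. \<Sum>a<m. (u b / nu b) * (dot n (mvec n E (col Xh b)) (col X a) * X i a))"
      unfolding 1 by (simp only: right_diff_distrib sum_subtractf sum_distrib_left)
    also have "(\<Sum>b<m. \<Sum>a<m. (u b / nu b) * (dot n (mvec n E (col Xh b)) (col X a) * X i a))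
       = (\<Sum>a<m. dot n ?w (col X a) * X i a)"
      unfolding 2 by (rule sum_mult_sum_swap)
    finally show ?thesis .
  qed
  then have "vnorm n (\<lambda>i. \<Sum>b<m. u b * proj_error i b)
      = vnorm n (\<lambda>i. ?w i - (\<Sum>a<m. dot n ?w (col X a) * X i a))" by (intro L2_set_cong) auto
  also have "\<dots> \<le> vnorm n ?w" by (rule orthonormal_cols_residual[OF on])
  also have "\<dots> \<le> e * vnorm n ?x" by (rule E_bound)
  finally have comb: "vnorm n (\<lambda>i. \<Sum>b<m. u b * proj_error i b) \<le> e * vnorm n ?x" .
  have "vnorm n ?x = vnorm m (\<lambda>b. u b / nu b)" by (rule orthonormal_cols_vnorm[OF onh])
  also have "\<dots> = vnorm m (\<lambda>b. \<bar>u b / nu b\<bar>)" by (rule vnorm_abs[symmetric])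
  also have "\<dots> \<le> vnorm m (\<lambda>b. 2 / sg * \<bar>u b\<bar>)" by (intro L2_set_mono divide_nu_le) auto
  also have "\<dots> = 2 / sg * vnorm m u" unfolding vnorm_scale vnorm_abs using e by simp
  finally have "e * vnorm n ?x \<le> e * (2 / sg * vnorm m u)" using e by (intro mult_left_mono)
  with comb show ?thesis by (simp add: mult_ac)
qed

text \<open>The rows of \<open>Xh - Y\<close> are those of \<open>X\<close> multiplied by the square
  matrix \<open>g = X^T Xh\<close>. Their inner products differ from those of the rows of
  \<open>X\<close> by the inner product of the residuals \<open>r (X i)\<close> and
  \<open>r (X j)\<close>, so the error is quadratic in the angle and relative to the row
  lengths.\<close>

lemma proj_rows_dot:
  assumes i: "i < n" and j: "j < n"
  shows "\<bar>dot m (\<lambda>b. Xh i b - proj_error i b) (\<lambda>b. Xh j b - proj_error j b) - dot m (X i) (X j)\<bar>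
    \<le> (2 * e / sg)^2 * (vnorm m (X i) * vnorm m (X j))"
proof -
  define eps where "eps = 2 * e / sg"
  have eps: "0 \<le> eps" "eps < 1" using e by (auto simp: eps_def)
  then have eps2: "0 \<le> eps^2" "eps^2 < 1" by (auto simp: power_less_one_iff)
  define g where "g a b = dot n (col X a) (col Xh b)" for a b
  define Xx where "Xx x i = (\<Sum>a<m. x a * X i a)" for x i
  define Gt where "Gt x b = dot n (Xx x) (col Xh b)" for x b
  define r where "r x i = Xx x i - (\<Sum>b<m. Gt x b * Xh i b)" for x i
  have Gt_eq: "Gt x b = (\<Sum>a<m. x a * g a b)" for x b
    unfolding Gt_def Xx_def g_def by (rule dot_sum_left)
  have XX: "dot n (Xx x) (Xx y) = dot m x y" for x y
    unfolding Xx_def by (rule orthonormal_cols_dot[OF on])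
  have rr: "dot n (r x) (r y) = dot m x y - dot m (Gt x) (Gt y)" for x y
    unfolding r_def Gt_def dot_residual[OF onh] XX ..
  \<comment> \<open>Pythagoras for \<open>Xh u\<close>, whose component outside the span of
    \<open>X\<close> is \<open>Y u\<close>.\<close>
  have G_lower: "(1 - eps^2) * (vnorm m u)^2 \<le> (vnorm m (mvec m g u))^2" for u
  proof -
    let ?x = "\<lambda>i. \<Sum>b<m. u b * Xh i b"
    have 1: "dot n ?x (col X a) = mvec m g u a" for a
    proof -
      have "dot n ?x (col X a) = (\<Sum>b<m. u b * dot n (col Xh b) (col X a))" by (rule dot_sum_left)
      also have "\<dots> = mvec m g u a" by (intro sum.cong refl) (simp only: g_def mult.commute)
      finally show ?thesis .
    qed
    have "?x i - (\<Sum>a<m. dot n ?x (col X a) * X i a) = (\<Sum>b<m. u b * proj_error i b)" for i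
    proof -
      have 2: "dot n ?x (col X a) = (\<Sum>b<m. u b * dot n (col Xh b) (col X a))" for a
        by (rule dot_sum_left)
      have "(\<Sum>a<m. dot n ?x (col X a) * X i a)
          = (\<Sum>b<m. \<Sum>a<m. u b * (dot n (col Xh b) (col X a) * X i a))"
        unfolding 2 by (rule sum_mult_sum_swap[symmetric])
      then show ?thesis by (simp only: right_diff_distrib sum_subtractf sum_distrib_left)
    qed
    then have "(vnorm n ?x)^2 = (vnorm m (mvec m g u))^2 + (vnorm n (\<lambda>i. \<Sum>b<m. u b * proj_error i b))^2"
      using orthonormal_cols_pythagoras[OF on, of ?x] unfolding 1 by simp
    moreover have "vnorm n ?x = vnorm m u" by (rule orthonormal_cols_vnorm[OF onh])
    moreover have "(vnorm n (\<lambda>i. \<Sum>b<m. u b * proj_error i b))^2 \<le> (eps * vnorm m u)^2"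
      unfolding eps_def by (intro power_mono proj_error_comb) auto
    ultimately show ?thesis by (simp add: power_mult_distrib left_diff_distrib)
  qed
  \<comment> \<open>The bound passes from \<open>g\<close> to its transpose because \<open>g\<close>
    is square: it is injective, hence \<open>x = g u\<close> for some \<open>u\<close>, and
    \<open>|x|^2\<close> is the inner product of \<open>g^T x\<close> and \<open>u\<close>, where
    \<open>|u|\<close> is controlled by \<open>G_lower\<close>.\<close>
  have Gt_lower: "(1 - eps^2) * (vnorm m x)^2 \<le> (vnorm m (Gt x))^2" for x
  proof (cases "vnorm m x = 0")
    case False
    have "\<exists>u. \<forall>a<m. mvec m g u a = x a"
    proof (rule injective_square_system_solvable)
      fix u assume "\<And>a. a < m \<Longrightarrow> mvec m g u a = 0"
      then have "vnorm m (mvec m g u) = 0" by (simp add: vnorm_eq_0_iff)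
      with G_lower[of u] have "(1 - eps^2) * (vnorm m u)^2 \<le> 0" by simp
      then have "vnorm m u = 0" using eps2 by (simp add: mult_le_0_iff)
      then show "\<forall>a<m. u a = 0" by (simp add: vnorm_eq_0_iff)
    qed
    then obtain u where u: "\<And>a. a < m \<Longrightarrow> mvec m g u a = x a" by auto
    have nu: "vnorm m (mvec m g u) = vnorm m x" by (intro L2_set_cong) (auto simp: u)
    have "(vnorm m x)^2 = dot m x (mvec m g u)"
      unfolding vnorm_power2_dot by (intro sum.cong refl) (simp add: u)
    also have "\<dots> = dot m (Gt x) u" unfolding dot_mvec Gt_eq by (simp only: mult.commute)
    also have "\<dots> \<le> vnorm m (Gt x) * vnorm m u" using abs_dot_le[of "Gt x" u m] by linarith
    finally have "((vnorm m x)^2)^2 \<le> (vnorm m (Gt x) * vnorm m u)^2" by (intro power_mono) auto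
    then have "(1 - eps^2) * ((vnorm m x)^2)^2 \<le> (1 - eps^2) * (vnorm m (Gt x) * vnorm m u)^2"
      using eps2 by (intro mult_left_mono) auto
    also have "\<dots> = (vnorm m (Gt x))^2 * ((1 - eps^2) * (vnorm m u)^2)" by (simp add: power_mult_distrib)
    also have "\<dots> \<le> (vnorm m (Gt x))^2 * (vnorm m x)^2"
      using G_lower[of u] nu by (intro mult_left_mono) auto
    finally have "((1 - eps^2) * (vnorm m x)^2) * (vnorm m x)^2 \<le> (vnorm m (Gt x))^2 * (vnorm m x)^2"
      by (simp add: power2_eq_square)
    then show ?thesis using False by (simp add: mult_le_cancel_right)
  qed simp
  have r_le: "vnorm n (r x) \<le> eps * vnorm m x" for x
  proof (rule power2_le_imp_le)
    have "(vnorm n (r x))^2 = (vnorm m x)^2 - (vnorm m (Gt x))^2" unfolding vnorm_power2_dot by (rule rr)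
    with Gt_lower[of x] show "(vnorm n (r x))^2 \<le> (eps * vnorm m x)^2"
      by (simp add: power_mult_distrib left_diff_distrib)
  qed (use eps in simp)
  have Z: "Xh i b - proj_error i b = Gt (X i) b" for i b
    unfolding Gt_eq g_def by (simp add: mult.commute)
  have "\<bar>dot m (Gt (X i)) (Gt (X j)) - dot m (X i) (X j)\<bar> = \<bar>dot n (r (X i)) (r (X j))\<bar>" unfolding rr by simp
  also have "\<dots> \<le> vnorm n (r (X i)) * vnorm n (r (X j))" by (rule abs_dot_le)
  also have "\<dots> \<le> (eps * vnorm m (X i)) * (eps * vnorm m (X j))"
    using eps by (intro mult_mono r_le) auto
  also have "\<dots> = eps^2 * (vnorm m (X i) * vnorm m (X j))" by (simp add: power2_eq_square)
  finally show ?thesis unfolding Z eps_def .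
qed

end

section \<open>Operator norm of the noise\<close>

lemma expectation_prod_Pi_pmf_real:
  fixes f :: "'a \<Rightarrow> 'b \<Rightarrow> real"
  assumes "finite A" "\<And>x. x \<in> A \<Longrightarrow> integrable (measure_pmf (p x)) (f x)"
  shows "measure_pmf.expectation (Pi_pmf A dflt p) (\<lambda>y. \<Prod>x\<in>A. f x (y x))
       = (\<Prod>x\<in>A. measure_pmf.expectation (p x) (f x))"
proof -
  have comp: "map_pmf (\<lambda>g. g x) (Pi_pmf A dflt p) = p x" if "x \<in> A" for x
    using that assms(1) by (simp add: Pi_pmf_component)
  have "prob_space.indep_vars (measure_pmf (Pi_pmf A dflt p)) (\<lambda>_. borel) (\<lambda>x y. f x (y x)) A"
    by (rule prob_space.indep_vars_compose2[OF measure_pmf.prob_space_axioms indep_vars_Pi_pmf[OF assms(1)]]) simp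
  moreover have "integrable (measure_pmf (Pi_pmf A dflt p)) (\<lambda>y. f x (y x))" if "x \<in> A" for x
    using assms(2)[OF that] unfolding comp[OF that, symmetric] by simp
  ultimately have "measure_pmf.expectation (Pi_pmf A dflt p) (\<lambda>y. \<Prod>x\<in>A. f x (y x))
      = (\<Prod>x\<in>A. measure_pmf.expectation (Pi_pmf A dflt p) (\<lambda>y. f x (y x)))"
    by (intro prob_space.indep_vars_lebesgue_integral[OF measure_pmf.prob_space_axioms assms(1)])
  also have "measure_pmf.expectation (Pi_pmf A dflt p) (\<lambda>y. f x (y x)) = measure_pmf.expectation (p x) (f x)"
    if "x \<in> A" for x
    unfolding comp[OF that, symmetric] by simp
  then have "(\<Prod>x\<in>A. measure_pmf.expectation (Pi_pmf A dflt p) (\<lambda>y. f x (y x)))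
      = (\<Prod>x\<in>A. measure_pmf.expectation (p x) (f x))" by (intro prod.cong) auto
  finally show ?thesis .
qed

section \<open>Edge noise and its moments\<close>

definition "node_pairs n = {(i, j). i < j \<and> j < (n :: nat)}"

lemma finite_node_pairs [simp]: "finite (node_pairs n)"
proof -
  have "node_pairs n \<subseteq> {..<n} \<times> {..<n}" by (auto simp: node_pairs_def)
  then show ?thesis by (rule finite_subset) simp
qed

lemma pabm_pmf_alt: "pabm_pmf n Th = Pi_pmf (node_pairs n) False (\<lambda>(i, j). bernoulli_pmf (Th i j))"
  by (simp add: pabm_pmf_def node_pairs_def)

lemma finite_set_pabm_pmf [simp]: "finite (set_pmf (pabm_pmf n Th))"
proof -
  have "finite (PiE_dflt (node_pairs n) False (\<lambda>_. UNIV :: bool set))"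
    by (rule finite_PiE_dflt) auto
  moreover have "set_pmf (pabm_pmf n Th) \<subseteq> PiE_dflt (node_pairs n) False (\<lambda>_. UNIV)"
    unfolding pabm_pmf_alt set_Pi_pmf[OF finite_node_pairs] by (auto simp: PiE_dflt_def)
  ultimately show ?thesis by (rule finite_subset[rotated])
qed

lemma integrable_pabm_pmf [simp]: "integrable (measure_pmf (pabm_pmf n Th)) (f :: _ \<Rightarrow> real)"
  by (rule integrable_measure_pmf_finite) simp

text \<open>The value 0 on the diagonal matches the zero diagonal of the adjacency matrix; the
  diagonal of \<open>Th\<close> is subtracted separately, in
  \<open>adjacency_minus_mean\<close>.\<close>

definition edge_noise :: "rmat \<Rightarrow> (nat \<times> nat \<Rightarrow> bool) \<Rightarrow> nat \<times> nat \<Rightarrow> real" where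
  "edge_noise Th G e = (if fst e = snd e then 0 else of_bool (G e) - Th (fst e) (snd e))"

definition node_pair :: "nat \<Rightarrow> nat \<Rightarrow> nat \<times> nat" where
  "node_pair i j = (min i j, max i j)"

definition noise :: "rmat \<Rightarrow> (nat \<times> nat \<Rightarrow> bool) \<Rightarrow> nat \<Rightarrow> nat \<Rightarrow> real" where
  "noise Th G i j = edge_noise Th G (node_pair i j)"

lemma noise_commute: "noise Th G i j = noise Th G j i"
  by (simp add: noise_def node_pair_def min.commute max.commute)

lemma node_pair_inj: "inj (node_pair i)"
  by (auto simp: node_pair_def inj_def min_def max_def split: if_splits)

text \<open>The vanishing first moment kills every walk with an edge traversed only once. All higher
  moments share the bound \<open>p\<close>, so that only the number of distinct edges
  matters.\<close>

lemma centered_bernoulli_moment: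
  assumes p: "0 \<le> p" "p \<le> 1" and c: "c \<noteq> 0"
  shows "\<bar>measure_pmf.expectation (bernoulli_pmf p) (\<lambda>b. (of_bool b - p) ^ c)\<bar> \<le> (if c = 1 then 0 else p)"
proof -
  have E: "measure_pmf.expectation (bernoulli_pmf p) (\<lambda>b. (of_bool b - p) ^ c)
      = p * (1 - p) ^ c + (1 - p) * (- p) ^ c"
    using p by (simp add: mult.commute)
  show ?thesis
  proof (cases "c = 1")
    case True
    then show ?thesis unfolding E by (simp add: algebra_simps)
  next
    case False
    with c obtain d where d: "c = Suc (Suc d)" by (metis One_nat_def not0_implies_Suc)
    have "\<bar>p * (1 - p) ^ c + (1 - p) * (- p) ^ c\<bar> \<le> \<bar>p * (1 - p) ^ c\<bar> + \<bar>(1 - p) * (- p) ^ c\<bar>"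
      by (rule abs_triangle_ineq)
    also have "\<dots> = p * (1 - p) * ((1 - p) ^ Suc d + p ^ Suc d)"
    proof -
      have "\<bar>p * (1 - p) ^ c\<bar> = p * (1 - p) ^ c" "\<bar>(1 - p) * (- p) ^ c\<bar> = (1 - p) * p ^ c"
        using p by (simp_all add: abs_mult power_abs)
      then show ?thesis by (simp add: d algebra_simps)
    qed
    also have "\<dots> \<le> p * (1 - p) * ((1 - p) + p)"
    proof (rule mult_left_mono)
      have "(1 - p) ^ Suc d \<le> (1 - p) ^ 1" "p ^ Suc d \<le> p ^ 1"
        using p by (intro power_decreasing; simp)+
      then show "(1 - p) ^ Suc d + p ^ Suc d \<le> (1 - p) + p" by simp
    qed (use p in simp)
    also have "\<dots> \<le> p * 1 * 1" using p by (intro mult_mono) auto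
    finally show ?thesis using False unfolding E by simp
  qed
qed

section \<open>Walks and the trace method\<close>

fun walk_edges :: "nat \<Rightarrow> nat list \<Rightarrow> (nat \<times> nat) list" where
  "walk_edges v [] = []"
| "walk_edges v (u # us) = node_pair v u # walk_edges u us"

lemma length_walk_edges [simp]: "length (walk_edges v us) = length us"
  by (induction us arbitrary: v) auto

lemma walk_edges_range:
  "v < n \<Longrightarrow> set us \<subseteq> {..<n} \<Longrightarrow> set (walk_edges v us) \<subseteq> {(i, j). i \<le> j \<and> j < n}"
  by (induction us arbitrary: v) (auto simp: node_pair_def)

definition "walks n k = {us. set us \<subseteq> {..<(n::nat)} \<and> length us = k}"

lemma walks_0: "walks n 0 = {[]}" by (auto simp: walks_def)

lemma finite_walks [simp]: "finite (walks n k)"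
  unfolding walks_def by (rule finite_lists_length_eq) simp

lemma sum_walks_Suc: "(\<Sum>us\<in>walks n (Suc k). f us) = (\<Sum>u<n. \<Sum>us\<in>walks n k. f (u # us))"
proof -
  have "(\<Sum>us\<in>walks n (Suc k). f us) = (\<Sum>x\<in>walks n k \<times> {..<n}. f (snd x # fst x))"
    unfolding walks_def lists_length_Suc_eq
    by (subst sum.reindex) (auto simp: inj_on_def case_prod_beta)
  also have "\<dots> = (\<Sum>us\<in>walks n k. \<Sum>u<n. f (u # us))"
    by (simp add: sum.cartesian_product case_prod_beta)
  also have "\<dots> = (\<Sum>u<n. \<Sum>us\<in>walks n k. f (u # us))" by (rule sum.swap)
  finally show ?thesis .
qed

text \<open>A step of the walk either uses a new edge, at a cost of \<open>q\<close> for each of \<open>n\<close> possible endpoints,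
  or one of at most \<open>N\<close> old ones.\<close>

lemma sum_walks_distinct_edges:
  fixes q :: real
  assumes "finite S" "card S + k \<le> N" "0 \<le> q"
  shows "(\<Sum>us\<in>walks n k. q ^ card (S \<union> set (walk_edges v us))) \<le> q ^ card S * (real n * q + real N) ^ k"
  using assms(1,2)
proof (induction k arbitrary: S v)
  case (Suc k)
  define old where "old = {u\<in>{..<n}. node_pair v u \<in> S}"
  have "card old \<le> card S"
    by (rule card_inj_on_le[where f="node_pair v"])
       (use Suc.prems node_pair_inj in \<open>auto simp: old_def inj_on_def inj_def\<close>)
  then have old: "real (card old) \<le> real N" using Suc.prems by simp
  let ?B = "(real n * q + real N) ^ k"
  have "(\<Sum>us\<in>walks n (Suc k). q ^ card (S \<union> set (walk_edges v us)))
      = (\<Sum>u<n. \<Sum>us\<in>walks n k. q ^ card (insert (node_pair v u) S \<union> set (walk_edges u us)))"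
    unfolding sum_walks_Suc by simp
  also have "\<dots> \<le> (\<Sum>u<n. q ^ card (insert (node_pair v u) S) * ?B)"
    using Suc.prems by (intro sum_mono Suc.IH) (auto simp: card_insert_if)
  also have "\<dots> \<le> (\<Sum>u<n. (q ^ Suc (card S) + (if u \<in> old then q ^ card S else 0)) * ?B)"
    using Suc.prems assms(3) by (intro sum_mono mult_right_mono) (auto simp: card_insert_if old_def)
  also have "\<dots> = (real n * q ^ Suc (card S) + real (card old) * q ^ card S) * ?B"
  proof -
    have "(\<Sum>u<n. if u \<in> old then q ^ card S else 0) = (\<Sum>u\<in>old. q ^ card S)"
      unfolding old_def by (simp add: sum.inter_filter[symmetric])
    then show ?thesis by (simp add: sum_distrib_right[symmetric] sum.distrib)
  qed
  also have "\<dots> \<le> (real n * q ^ Suc (card S) + real N * q ^ card S) * ?B"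
    using old assms(3) by (intro mult_right_mono add_left_mono) auto
  also have "\<dots> = q ^ card S * (real n * q + real N) ^ Suc k" by (simp add: algebra_simps)
  finally show ?case .
qed (simp add: walks_0)

lemma prod_list_map_eq_prod_count:
  fixes f :: "'a \<Rightarrow> 'b :: comm_monoid_mult"
  assumes "finite A" "set es \<subseteq> A"
  shows "prod_list (map f es) = (\<Prod>e\<in>A. f e ^ count_list es e)"
  using assms(2)
proof (induction es)
  case (Cons a es)
  have "prod_list (map f (a # es)) = f a * (f a ^ count_list es a * (\<Prod>e\<in>A - {a}. f e ^ count_list es e))"
    using Cons assms(1) by (simp add: prod.remove[of A a])
  also have "(\<Prod>e\<in>A - {a}. f e ^ count_list es e) = (\<Prod>e\<in>A - {a}. f e ^ count_list (a # es) e)"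
    by (intro prod.cong) auto
  also have "f a * (f a ^ count_list es a * \<dots>) = f a ^ count_list (a # es) a * \<dots>"
    by (simp add: mult.assoc)
  also have "\<dots> = (\<Prod>e\<in>A. f e ^ count_list (a # es) e)"
    using Cons.prems assms(1) by (intro prod.remove[symmetric]) auto
  finally show ?case .
qed simp

text \<open>Only products in which every edge occurs at least twice survive. They have at most
  \<open>p\<close> distinct edges, and the expectation is at most \<open>r\<close> to the power of
  their number. The weight \<open>z\<close> turns the restriction to at most \<open>p\<close> edges
  into a factor, so that the bound can be summed over all walks.\<close>

lemma expectation_noise_product:
  fixes n :: nat and Th :: rmat and r :: real
  assumes Th: "\<And>i j. i < j \<Longrightarrow> j < n \<Longrightarrow> 0 \<le> Th i j \<and> Th i j \<le> r" and r: "0 < r" "r \<le> 1"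
    and es: "set es \<subseteq> {(i, j). i \<le> j \<and> j < n}" "length es = 2 * p" and z: "1 \<le> z"
  shows "measure_pmf.expectation (pabm_pmf n Th) (\<lambda>G. prod_list (map (edge_noise Th G) es))
     \<le> z ^ p * (r / z) ^ card (set es)"
proof (cases "set es \<subseteq> node_pairs n")
  case False
  then obtain e where "e \<in> set es" "e \<notin> node_pairs n" by blast
  with es(1) obtain i where "(i, i) \<in> set es" by (cases e) (auto simp: node_pairs_def)
  then have "prod_list (map (edge_noise Th G) es) = 0" for G
    by (auto simp: prod_list_zero_iff edge_noise_def intro!: image_eqI[of _ _ "(i, i)"])
  then show ?thesis using r z by simp
next
  case True
  define c where "c = count_list es"
  let ?E = "\<lambda>e. measure_pmf.expectation (case e of (i, j) \<Rightarrow> bernoulli_pmf (Th i j))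
      (\<lambda>b. (of_bool b - Th (fst e) (snd e)) ^ c e)"
  have c0: "c e = 0 \<longleftrightarrow> e \<notin> set es" for e by (simp add: c_def count_list_0_iff)
  have "prod_list (map (edge_noise Th G) es) = (\<Prod>e\<in>node_pairs n. (of_bool (G e) - Th (fst e) (snd e)) ^ c e)" for G
  proof -
    have "prod_list (map (edge_noise Th G) es) = (\<Prod>e\<in>node_pairs n. edge_noise Th G e ^ c e)"
      unfolding c_def by (rule prod_list_map_eq_prod_count[OF _ True]) simp
    then show ?thesis
      by (auto simp: edge_noise_def node_pairs_def intro!: prod.cong)
  qed
  then have "measure_pmf.expectation (pabm_pmf n Th) (\<lambda>G. prod_list (map (edge_noise Th G) es)) = (\<Prod>e\<in>node_pairs n. ?E e)"
    unfolding pabm_pmf_alt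
    by (simp, intro expectation_prod_Pi_pmf_real) (auto intro: integrable_measure_pmf_finite)
  also have "\<dots> \<le> (\<Prod>e\<in>node_pairs n. \<bar>?E e\<bar>)" by (subst abs_prod[symmetric]) simp
  also have "\<dots> \<le> (\<Prod>e\<in>node_pairs n. if c e = 0 then 1 else if c e = 1 then 0 else r)"
  proof (rule prod_mono, intro conjI)
    fix e assume e: "e \<in> node_pairs n"
    then obtain i j where ij: "e = (i, j)" "i < j" "j < n" by (auto simp: node_pairs_def)
    show "\<bar>?E e\<bar> \<le> (if c e = 0 then 1 else if c e = 1 then 0 else r)"
      using centered_bernoulli_moment[of "Th i j" "c e"] Th[OF ij(2,3)] r by (auto simp: ij(1))
  qed simp
  also have "\<dots> = (\<Prod>e\<in>set es. if c e = 1 then 0 else r)"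
    using True by (intro prod.mono_neutral_cong_right) (auto simp: c0)
  also have "\<dots> \<le> z ^ p * (r / z) ^ card (set es)"
  proof (cases "\<exists>e\<in>set es. c e = 1")
    case True
    then have zero: "(\<Prod>e\<in>set es. if c e = 1 then 0 else r) = 0" by (intro prod_zero) auto
    show ?thesis unfolding zero using r z by simp
  next
    case False
    have "2 * card (set es) = (\<Sum>e\<in>set es. 2)" by simp
    also have "\<dots> \<le> (\<Sum>e\<in>set es. c e)"
    proof (rule sum_mono)
      fix e assume "e \<in> set es"
      then show "2 \<le> c e" using False c0[of e] by (cases "c e"; force)
    qed
    also have "\<dots> = 2 * p" using sum_count_set[of es "set es"] es(2) by (simp add: c_def)
    finally have d: "card (set es) \<le> p" by simp
    have "(\<Prod>e\<in>set es. if c e = 1 then 0 else r) = (\<Prod>e\<in>set es. r)"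
      using False by (intro prod.cong) auto
    also have "\<dots> = r ^ card (set es)" by simp
    also have "\<dots> = z ^ card (set es) * (r / z) ^ card (set es)" using z by (simp add: power_divide)
    also have "\<dots> \<le> z ^ p * (r / z) ^ card (set es)"
      using z r d by (intro mult_right_mono power_increasing) auto
    finally show ?thesis .
  qed
  finally show ?thesis .
qed

context
  fixes n :: nat and Th :: rmat
begin

definition walk_prod :: "(nat \<times> nat \<Rightarrow> bool) \<Rightarrow> nat \<Rightarrow> nat list \<Rightarrow> real" where
  "walk_prod G v us = prod_list (map (edge_noise Th G) (walk_edges v us))"

text \<open>The trace of the \<open>2 * k\<close>-th power of the noise: a closed walk of length
  \<open>2 * k\<close> is cut into two walks of length \<open>k\<close> with common start and common
  end, which makes the sum the squared Frobenius norm of the \<open>k\<close>-th power.\<close>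

definition closed_walk_sum :: "nat \<Rightarrow> (nat \<times> nat \<Rightarrow> bool) \<Rightarrow> real" where
  "closed_walk_sum k G = (\<Sum>i<n. \<Sum>us\<in>walks n k. \<Sum>us'\<in>walks n k.
     walk_prod G i us * walk_prod G i us' * of_bool (last (i # us) = last (i # us')))"

lemma noise_power_eq:
  "(mvec n (noise Th G) ^^ k) x i = (\<Sum>us\<in>walks n k. walk_prod G i us * x (last (i # us)))"
proof (induction k arbitrary: i)
  case (Suc k)
  have "(mvec n (noise Th G) ^^ Suc k) x i
      = (\<Sum>u<n. noise Th G i u * (\<Sum>us\<in>walks n k. walk_prod G u us * x (last (u # us))))"
    by (simp add: Suc.IH)
  also have "\<dots> = (\<Sum>us\<in>walks n (Suc k). walk_prod G i us * x (last (i # us)))"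
    unfolding sum_walks_Suc sum_distrib_left
    by (intro sum.cong refl) (simp add: walk_prod_def noise_def mult.assoc)
  finally show ?case .
qed (simp add: walks_0 walk_prod_def)

lemma closed_walk_sum_eq:
  "closed_walk_sum k G = (\<Sum>i<n. \<Sum>j<n. (\<Sum>us\<in>walks n k. walk_prod G i us * of_bool (last (i # us) = j))^2)"
proof -
  have "(\<Sum>j<n. (\<Sum>us\<in>walks n k. walk_prod G i us * of_bool (last (i # us) = j))^2)
      = (\<Sum>us\<in>walks n k. \<Sum>us'\<in>walks n k.
          walk_prod G i us * walk_prod G i us' * of_bool (last (i # us) = last (i # us')))"
    if i: "i < n" for i
  proof -
    let ?P = "walk_prod G i" and ?l = "\<lambda>us. last (i # us)"
    have l: "?l us < n" if "us \<in> walks n k" for us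
      using that i last_in_set[of "i # us"] by (auto simp: walks_def simp del: last.simps)
    have "(\<Sum>j<n. (\<Sum>us\<in>walks n k. ?P us * of_bool (?l us = j))^2)
        = (\<Sum>j<n. \<Sum>us\<in>walks n k. \<Sum>us'\<in>walks n k. ?P us * of_bool (?l us = j) * (?P us' * of_bool (?l us' = j)))"
      unfolding power2_eq_square sum_product ..
    also have "\<dots> = (\<Sum>us\<in>walks n k. \<Sum>us'\<in>walks n k. \<Sum>j<n. ?P us * of_bool (?l us = j) * (?P us' * of_bool (?l us' = j)))"
      by (subst sum.swap, intro sum.cong refl, rule sum.swap)
    also have "\<dots> = (\<Sum>us\<in>walks n k. \<Sum>us'\<in>walks n k. ?P us * ?P us' * of_bool (?l us = ?l us'))"
    proof (intro sum.cong refl)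
      fix us us' assume us: "us \<in> walks n k"
      have "(\<Sum>j<n. ?P us * of_bool (?l us = j) * (?P us' * of_bool (?l us' = j)))
          = (\<Sum>j<n. if ?l us = j then ?P us * ?P us' * of_bool (?l us = ?l us') else 0)"
        by (intro sum.cong refl) (simp del: last.simps)
      then show "(\<Sum>j<n. ?P us * of_bool (?l us = j) * (?P us' * of_bool (?l us' = j)))
          = ?P us * ?P us' * of_bool (?l us = ?l us')"
        using l[OF us] by (simp del: last.simps)
    qed
    finally show ?thesis .
  qed
  then show ?thesis unfolding closed_walk_sum_def by (intro sum.cong) auto
qed

lemma noise_power_vnorm:
  "(vnorm n ((mvec n (noise Th G) ^^ k) x))^2 \<le> closed_walk_sum k G * (vnorm n x)^2"
proof -
  let ?M = "\<lambda>i j. \<Sum>us\<in>walks n k. walk_prod G i us * of_bool (last (i # us) = j)"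
  have M: "(mvec n (noise Th G) ^^ k) x i = dot n (?M i) x" if i: "i < n" for i
  proof -
    have l: "last (i # us) < n" if "us \<in> walks n k" for us
      using that i last_in_set[of "i # us"] by (auto simp: walks_def simp del: last.simps)
    have "dot n (?M i) x = (\<Sum>us\<in>walks n k. \<Sum>j<n. if last (i # us) = j then walk_prod G i us * x (last (i # us)) else 0)"
      unfolding sum_distrib_right by (subst sum.swap, intro sum.cong refl) (simp del: last.simps)
    also have "\<dots> = (\<Sum>us\<in>walks n k. walk_prod G i us * x (last (i # us)))"
      using l by (intro sum.cong refl) (simp del: last.simps)
    finally show ?thesis by (simp only: noise_power_eq)
  qed
  have "(vnorm n ((mvec n (noise Th G) ^^ k) x))^2 = (\<Sum>i<n. (dot n (?M i) x)^2)"
    unfolding L2_set_power2 by (intro sum.cong refl arg_cong[where f="\<lambda>x. x^2"] M) simp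
  also have "\<dots> \<le> (\<Sum>i<n. (vnorm n (?M i))^2 * (vnorm n x)^2)"
  proof (rule sum_mono)
    fix i
    have "\<bar>dot n (?M i) x\<bar>^2 \<le> (vnorm n (?M i) * vnorm n x)^2" by (intro power_mono abs_dot_le) simp
    then show "(dot n (?M i) x)^2 \<le> (vnorm n (?M i))^2 * (vnorm n x)^2"
      by (simp only: power2_abs power_mult_distrib)
  qed
  also have "\<dots> = closed_walk_sum k G * (vnorm n x)^2"
    unfolding closed_walk_sum_eq sum_distrib_right by (simp only: L2_set_power2 sum_distrib_right)
  finally show ?thesis .
qed

end

lemma expectation_closed_walk_sum:
  fixes n :: nat and Th :: rmat
  assumes Th: "\<And>i j. i < j \<Longrightarrow> j < n \<Longrightarrow> 0 \<le> Th i j \<and> Th i j \<le> r" and r: "0 < r" "r \<le> 1"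
    and p: "0 < p" "2 * real p \<le> real n * r"
  shows "measure_pmf.expectation (pabm_pmf n Th) (closed_walk_sum n Th p) \<le> real n * (8 * real p * (real n * r)) ^ p"
proof -
  \<comment> \<open>With this \<open>z\<close>, all new edges together cost
    \<open>n * q = 2 * p\<close>, as much as the at most \<open>2 * p\<close> choices of an old
    edge. Every step of the walk then contributes \<open>4 * p\<close>, and
    \<open>z ^ p * (4 * p) ^ (2 * p)\<close> is the claimed power.\<close>
  define z where "z = real n * r / (2 * real p)"
  define q where "q = r / z"
  have z: "1 \<le> z" using p by (simp add: z_def field_simps)
  have "0 < n" using p by (cases n) auto
  then have nq: "real n * q = 2 * real p" using p r by (simp add: q_def z_def)
  have q: "0 \<le> q" using z r by (simp add: q_def)
  have "measure_pmf.expectation (pabm_pmf n Th) (closed_walk_sum n Th p)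
      = (\<Sum>i<n. \<Sum>us\<in>walks n p. \<Sum>us'\<in>walks n p. measure_pmf.expectation (pabm_pmf n Th)
          (\<lambda>G. walk_prod Th G i us * walk_prod Th G i us') * of_bool (last (i # us) = last (i # us')))"
    unfolding closed_walk_sum_def by simp
  also have "\<dots> \<le> (\<Sum>i<n. \<Sum>us\<in>walks n p. \<Sum>us'\<in>walks n p.
      z ^ p * q ^ card (set (walk_edges i us) \<union> set (walk_edges i us')))"
  proof (intro sum_mono)
    fix i us us' assume *: "i \<in> {..<n}" "us \<in> walks n p" "us' \<in> walks n p"
    let ?es = "walk_edges i us @ walk_edges i us'"
    have "set ?es \<subseteq> {(i, j). i \<le> j \<and> j < n}" "length ?es = 2 * p"
      using * walk_edges_range[of i n us] walk_edges_range[of i n us'] by (auto simp: walks_def)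
    from expectation_noise_product[OF Th r this z]
    have "measure_pmf.expectation (pabm_pmf n Th) (\<lambda>G. walk_prod Th G i us * walk_prod Th G i us')
        \<le> z ^ p * q ^ card (set (walk_edges i us) \<union> set (walk_edges i us'))"
      by (simp add: walk_prod_def q_def)
    moreover have "0 \<le> z ^ p * q ^ card (set (walk_edges i us) \<union> set (walk_edges i us'))"
      using z q by simp
    ultimately show "measure_pmf.expectation (pabm_pmf n Th) (\<lambda>G. walk_prod Th G i us * walk_prod Th G i us')
        * of_bool (last (i # us) = last (i # us'))
        \<le> z ^ p * q ^ card (set (walk_edges i us) \<union> set (walk_edges i us'))" by (simp only: of_bool_def split: if_split) simp
  qed
  \<comment> \<open>The second half of the closed walk is summed first, with the edges of the first
    half as the set of old edges.\<close>
  also have "\<dots> \<le> (\<Sum>i<n. \<Sum>us\<in>walks n p. z ^ p * (q ^ card ({} \<union> set (walk_edges i us)) * (4 * real p) ^ p))"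
  proof (intro sum_mono)
    fix i us assume us: "us \<in> walks n p"
    have "(\<Sum>us'\<in>walks n p. q ^ card (set (walk_edges i us) \<union> set (walk_edges i us')))
        \<le> q ^ card (set (walk_edges i us)) * (real n * q + real (2 * p)) ^ p"
      using card_length[of "walk_edges i us"] us q
      by (intro sum_walks_distinct_edges) (auto simp: walks_def)
    also have "real n * q + real (2 * p) = 4 * real p" using nq by simp
    finally show "(\<Sum>us'\<in>walks n p. z ^ p * q ^ card (set (walk_edges i us) \<union> set (walk_edges i us')))
        \<le> z ^ p * (q ^ card ({} \<union> set (walk_edges i us)) * (4 * real p) ^ p)"
      using z by (simp add: sum_distrib_left[symmetric] mult_left_mono)
  qed
  also have "\<dots> = (\<Sum>i<n. z ^ p * (4 * real p) ^ p * (\<Sum>us\<in>walks n p. q ^ card ({} \<union> set (walk_edges i us))))"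
    by (simp add: sum_distrib_left mult_ac)
  also have "\<dots> \<le> (\<Sum>i<n. z ^ p * (4 * real p) ^ p * (4 * real p) ^ p)"
  proof (intro sum_mono mult_left_mono)
    fix i
    have "(\<Sum>us\<in>walks n p. q ^ card ({} \<union> set (walk_edges i us)))
        \<le> q ^ card {} * (real n * q + real (2 * p)) ^ p"
      using sum_walks_distinct_edges[where S="{}" and k=p and N="2 * p" and q=q and n=n and v=i] q by simp
    then show "(\<Sum>us\<in>walks n p. q ^ card ({} \<union> set (walk_edges i us))) \<le> (4 * real p) ^ p"
      using nq by simp
  qed (use z in simp)
  also have "\<dots> = real n * (z * (4 * real p) * (4 * real p)) ^ p"
    by (simp only: power_mult_distrib sum_constant card_lessThan)
  also have "z * (4 * real p) * (4 * real p) = 8 * real p * (real n * r)"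
    using p by (simp add: z_def field_simps)
  finally show ?thesis .
qed


text \<open>By symmetry and the Cauchy--Schwarz inequality the norms \<open>a k\<close> of the
  iterates are log-convex, so the ratio of consecutive ones never decreases. A first ratio above
  \<open>B\<close> would make \<open>a p\<close> exceed \<open>B ^ p * a 0\<close>.\<close>

lemma symmetric_norm_le_power:
  assumes sym: "\<And>i j. i < n \<Longrightarrow> j < n \<Longrightarrow> M i j = M j i"
    and B: "0 \<le> B" "\<And>x. vnorm n ((mvec n M ^^ p) x) \<le> B ^ p * vnorm n x" and p: "0 < p"
  shows "vnorm n (mvec n M x) \<le> B * vnorm n x"
proof (rule ccontr)
  assume contr: "\<not> vnorm n (mvec n M x) \<le> B * vnorm n x"
  define a where "a k = vnorm n ((mvec n M ^^ k) x)" for k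
  have a_nonneg: "0 \<le> a k" for k by (simp add: a_def)
  have a01: "B * a 0 < a 1" using contr by (simp add: a_def)
  have "a 0 \<noteq> 0"
  proof
    assume "a 0 = 0"
    then have "mvec n M x i = 0" for i by (simp add: a_def vnorm_eq_0_iff)
    then have "a 1 = 0" by (simp add: a_def L2_set_def)
    with a01 \<open>a 0 = 0\<close> show False by simp
  qed
  with a_nonneg[of 0] have a0: "0 < a 0" by simp
  define t where "t = a 1 / a 0"
  have t: "B < t" using a01 a0 by (simp add: t_def field_simps)
  then have "0 < t" using B(1) by simp
  have log_convex: "(a (Suc k))^2 \<le> a k * a (Suc (Suc k))" for k
  proof -
    let ?y = "(mvec n M ^^ k) x"
    have "(a (Suc k))^2 = dot n (mvec n M ?y) (mvec n M ?y)" by (simp add: a_def vnorm_power2_dot)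
    also have "\<dots> = dot n ?y (mvec n M (mvec n M ?y))"
      by (rule dot_mvec_symmetric[OF sym, symmetric])
    also have "\<dots> \<le> a k * a (Suc (Suc k))"
      using abs_dot_le[of ?y "mvec n M (mvec n M ?y)" n] by (simp add: a_def)
    finally show ?thesis .
  qed
  have step: "0 < a k \<and> t * a k \<le> a (Suc k)" for k
  proof (induction k)
    case (Suc k)
    have pos: "0 < a (Suc k)" using Suc.IH \<open>0 < t\<close> by (meson less_le_trans mult_pos_pos)
    have "t * a k * a (Suc k) \<le> a (Suc k) * a (Suc k)" using Suc.IH pos by (intro mult_right_mono) auto
    also have "\<dots> \<le> a k * a (Suc (Suc k))" using log_convex[of k] by (simp add: power2_eq_square)
    finally have "a k * (t * a (Suc k)) \<le> a k * a (Suc (Suc k))" by (simp add: mult_ac)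
    then show ?case using pos Suc.IH by (simp only: mult_le_cancel_left_pos)
  qed (use a0 in \<open>simp add: t_def\<close>)
  have "t ^ k * a 0 \<le> a k" for k
  proof (induction k)
    case (Suc k)
    have "t ^ Suc k * a 0 \<le> t * a k" using Suc.IH \<open>0 < t\<close> by (simp add: mult.assoc)
    with step[of k] show ?case by linarith
  qed simp
  moreover have "a p \<le> B ^ p * a 0" using B(2)[of x] by (simp add: a_def)
  ultimately have "t ^ p * a 0 \<le> B ^ p * a 0" using order.trans by blast
  then have "t ^ p \<le> B ^ p" using a0 by simp
  moreover have "B ^ p < t ^ p" using t B(1) p by (intro power_strict_mono) auto
  ultimately show False by simp
qed

text \<open>Markov's inequality for the trace of the \<open>2 * p\<close>-th power. The factor
  \<open>exp 1\<close> under the root makes the quotient of the bound on the expectation and the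
  threshold equal to \<open>n * exp (- p)\<close>.\<close>

lemma noise_operator_norm:
  fixes Th :: rmat
  assumes Th: "\<And>i j. i < j \<Longrightarrow> j < n \<Longrightarrow> 0 \<le> Th i j \<and> Th i j \<le> r" and r: "0 < r" "r \<le> 1"
    and p: "0 < p" "2 * real p \<le> real n * r"
  shows "measure_pmf.prob (pabm_pmf n Th)
      {G. \<not> (\<forall>x. vnorm n (mvec n (noise Th G) x) \<le> sqrt (8 * exp 1 * real p * (real n * r)) * vnorm n x)}
    \<le> real n * exp (- real p)"
proof -
  let ?P = "pabm_pmf n Th" and ?T = "closed_walk_sum n Th p"
  define b where "b = 8 * exp 1 * real p * (real n * r)"
  have "0 < n" using p by (cases n) auto
  then have b: "0 < b" using p r by (simp add: b_def)
  have T_nonneg: "0 \<le> ?T G" for G unfolding closed_walk_sum_eq by (intro sum_nonneg) simp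
  have "{G. \<not> (\<forall>x. vnorm n (mvec n (noise Th G) x) \<le> sqrt b * vnorm n x)} \<subseteq> {G. ?T G \<ge> b ^ p}"
  proof (rule ccontr)
    assume "\<not> ?thesis"
    then obtain G where w: "\<not> (\<forall>x. vnorm n (mvec n (noise Th G) x) \<le> sqrt b * vnorm n x)" "?T G < b ^ p"
      by force
    have "vnorm n (mvec n (noise Th G) x) \<le> sqrt b * vnorm n x" for x
    proof (rule symmetric_norm_le_power)
      fix y
      show "vnorm n ((mvec n (noise Th G) ^^ p) y) \<le> sqrt b ^ p * vnorm n y"
      proof (rule power2_le_imp_le)
        have "(vnorm n ((mvec n (noise Th G) ^^ p) y))^2 \<le> ?T G * (vnorm n y)^2" by (rule noise_power_vnorm)
        also have "\<dots> \<le> b ^ p * (vnorm n y)^2" using w(2) by (intro mult_right_mono) auto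
        also have "\<dots> = (sqrt b ^ p * vnorm n y)^2"
          using b by (simp add: power_mult_distrib power_mult[symmetric] mult.commute[of p] power_mult)
        finally show "(vnorm n ((mvec n (noise Th G) ^^ p) y))^2 \<le> (sqrt b ^ p * vnorm n y)^2" .
      qed (use b in simp)
    qed (use b p noise_commute in auto)
    with w(1) show False by blast
  qed
  then have "measure_pmf.prob ?P {G. \<not> (\<forall>x. vnorm n (mvec n (noise Th G) x) \<le> sqrt b * vnorm n x)}
      \<le> measure_pmf.prob ?P {G. ?T G \<ge> b ^ p}" by (intro measure_pmf.finite_measure_mono) auto
  also have "\<dots> \<le> measure_pmf.expectation ?P ?T / b ^ p"
    using integral_Markov_inequality_measure[of "measure_pmf ?P" ?T "{}" "b ^ p"] b T_nonneg by simp
  also have "\<dots> \<le> (real n * (8 * real p * (real n * r)) ^ p) / b ^ p"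
    using b expectation_closed_walk_sum[OF Th r p] by (intro divide_right_mono) auto
  also have "\<dots> = real n * exp (- real p)"
  proof -
    have "b ^ p = (8 * real p * (real n * r)) ^ p * exp (real p)"
      by (simp add: b_def power_mult_distrib exp_of_nat_mult[symmetric] mult_ac)
    moreover have "(8 * real p * (real n * r)) ^ p \<noteq> 0" using \<open>0 < n\<close> p r by simp
    moreover have "real n * c / (c * exp (real p)) = real n * exp (- real p)" if "c \<noteq> 0" for c :: real
      using that by (simp add: exp_minus field_simps)
    ultimately show ?thesis by metis
  qed
  finally show ?thesis unfolding b_def .
qed

section \<open>Row sums of the noise\<close>

lemma exp_le_quadratic:
  fixes u :: real
  assumes "\<bar>u\<bar> \<le> 1"
  shows "exp u \<le> 1 + u + u^2"
proof (cases "u \<ge> 0")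
  case True
  then show ?thesis using assms by (intro exp_bound) auto
next
  case False
  have "exp u \<le> 1 / (1 - u)"
    using exp_ge_add_one_self[of "- u"] False by (simp add: exp_minus field_simps)
  also have "\<dots> \<le> 1 + u + u^2"
  proof -
    have "(1 + u + u^2) * (1 - u) = 1 - u ^ 3" by (simp add: algebra_simps power2_eq_square power3_eq_cube)
    moreover have "u ^ 3 \<le> 0" using False by (simp add: power_le_zero_eq)
    ultimately have "1 \<le> (1 + u + u^2) * (1 - u)" by linarith
    then show ?thesis using False by (subst pos_divide_le_eq) auto
  qed
  finally show ?thesis .
qed

text \<open>The exponent keeps the factor \<open>p\<close>, the order of the variance; Hoeffding's
  lemma would lose it, and with it the factor \<open>rho\<close> in the row bounds.\<close>

lemma centered_bernoulli_exp:
  assumes p: "0 \<le> p" "p \<le> 1" and u: "\<bar>u\<bar> \<le> 1"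
  shows "measure_pmf.expectation (bernoulli_pmf p) (\<lambda>b. exp (u * (of_bool b - p))) \<le> exp (p * u^2)"
proof -
  have "measure_pmf.expectation (bernoulli_pmf p) (\<lambda>b. exp (u * (of_bool b - p)))
      = p * exp (u * (1 - p)) + (1 - p) * exp (- (u * p))"
    using p by (simp add: mult.commute)
  also have "\<dots> = exp (- (u * p)) * (1 + p * (exp u - 1))"
    by (simp add: algebra_simps exp_diff exp_minus divide_inverse)
  also have "1 + p * (exp u - 1) \<le> 1 + p * (u + u^2)"
    using exp_le_quadratic[OF u] p by (intro add_left_mono mult_left_mono) auto
  also have "\<dots> \<le> exp (p * (u + u^2))" by (rule exp_ge_add_one_self)
  also have "exp (- (u * p)) * exp (p * (u + u^2)) = exp (p * u^2)"
    by (simp add: exp_add[symmetric] algebra_simps)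
  finally show ?thesis by (simp add: mult_left_mono)
qed

section \<open>Tails and second moments of weighted edge sums\<close>

definition noise_sum :: "rmat \<Rightarrow> (nat \<times> nat \<Rightarrow> bool) \<Rightarrow> (nat \<times> nat) set \<Rightarrow> (nat \<times> nat \<Rightarrow> real) \<Rightarrow> real" where
  "noise_sum Th G S w = (\<Sum>e\<in>S. w e * (of_bool (G e) - Th (fst e) (snd e)))"

context
  fixes n :: nat and Th :: rmat and r :: real
  assumes Th: "\<And>i j. i < j \<Longrightarrow> j < n \<Longrightarrow> 0 \<le> Th i j \<and> Th i j \<le> r" and r: "0 < r" "r \<le> 1"
begin

private abbreviation (input) "P \<equiv> pabm_pmf n Th"

lemma noise_sum_mgf:
  assumes S: "S \<subseteq> node_pairs n" and w: "(\<Sum>e\<in>S. (w e)^2) \<le> 1"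
    and s: "0 \<le> s" "\<And>e. e \<in> S \<Longrightarrow> s * \<bar>w e\<bar> \<le> 1"
  shows "measure_pmf.expectation P (\<lambda>G. exp (s * noise_sum Th G S w)) \<le> exp (r * s^2)"
proof -
  let ?f = "\<lambda>e b. if e \<in> S then exp (s * w e * (of_bool b - Th (fst e) (snd e))) else (1 :: real)"
  have fS: "finite S" using S by (rule finite_subset) simp
  have "exp (s * noise_sum Th G S w) = (\<Prod>e\<in>node_pairs n. ?f e (G e))" for G
  proof -
    have "exp (s * noise_sum Th G S w) = (\<Prod>e\<in>S. exp (s * w e * (of_bool (G e) - Th (fst e) (snd e))))"
      unfolding noise_sum_def sum_distrib_left exp_sum[OF fS] by (simp only: mult.assoc)
    also have "\<dots> = (\<Prod>e\<in>node_pairs n. ?f e (G e))"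
      using S by (intro prod.mono_neutral_cong_left) auto
    finally show ?thesis .
  qed
  then have "measure_pmf.expectation P (\<lambda>G. exp (s * noise_sum Th G S w))
     = (\<Prod>e\<in>node_pairs n. measure_pmf.expectation (case e of (i, j) \<Rightarrow> bernoulli_pmf (Th i j)) (?f e))"
    unfolding pabm_pmf_alt
    by (simp only:, intro expectation_prod_Pi_pmf_real) (auto intro: integrable_measure_pmf_finite)
  also have "\<dots> \<le> (\<Prod>e\<in>node_pairs n. if e \<in> S then exp (r * (s * w e)^2) else 1)"
  proof (rule prod_mono, intro conjI)
    fix e assume e: "e \<in> node_pairs n"
    then obtain i j where ij: "e = (i, j)" "i < j" "j < n" by (auto simp: node_pairs_def)
    show "0 \<le> measure_pmf.expectation (case e of (i, j) \<Rightarrow> bernoulli_pmf (Th i j)) (?f e)"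
      by (intro Bochner_Integration.integral_nonneg) simp
    have "measure_pmf.expectation (bernoulli_pmf (Th i j)) (\<lambda>b. exp (s * w e * (of_bool b - Th i j))) \<le> exp (r * (s * w e)^2)"
      if "e \<in> S"
    proof -
      have "\<bar>s * w e\<bar> \<le> 1" using s that by (simp add: abs_mult)
      then have "measure_pmf.expectation (bernoulli_pmf (Th i j)) (\<lambda>b. exp (s * w e * (of_bool b - Th i j)))
          \<le> exp (Th i j * (s * w e)^2)"
        using Th[OF ij(2,3)] r by (intro centered_bernoulli_exp) auto
      also have "\<dots> \<le> exp (r * (s * w e)^2)" using Th[OF ij(2,3)] by (simp add: mult_right_mono)
      finally show ?thesis .
    qed
    then show "measure_pmf.expectation (case e of (i, j) \<Rightarrow> bernoulli_pmf (Th i j)) (?f e)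
        \<le> (if e \<in> S then exp (r * (s * w e)^2) else 1)"
      by (cases "e \<in> S") (simp_all only: ij(1) prod.case fst_conv snd_conv if_True if_False, simp_all)
  qed
  also have "\<dots> = (\<Prod>e\<in>S. exp (r * (s * w e)^2))"
    using S by (intro prod.mono_neutral_cong_right) auto
  also have "\<dots> = exp (\<Sum>e\<in>S. r * (s * w e)^2)" by (rule exp_sum[OF fS, symmetric])
  also have "(\<Sum>e\<in>S. r * (s * w e)^2) = r * s^2 * (\<Sum>e\<in>S. (w e)^2)"
    by (simp add: sum_distrib_left power_mult_distrib mult_ac)
  also have "exp (r * s^2 * (\<Sum>e\<in>S. (w e)^2)) \<le> exp (r * s^2)"
    using w r by (simp add: mult_left_le)
  finally show ?thesis .
qed

lemma noise_sum_tail: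
  assumes S: "S \<subseteq> node_pairs n" and w: "(\<Sum>e\<in>S. (w e)^2) \<le> 1"
    and s: "0 \<le> s" "\<And>e. e \<in> S \<Longrightarrow> s * \<bar>w e\<bar> \<le> 1"
  shows "measure_pmf.prob P {G. noise_sum Th G S w \<ge> t} \<le> exp (r * s^2 - s * t)"
proof -
  let ?X = "\<lambda>G. exp (s * noise_sum Th G S w)"
  have "measure_pmf.prob P {G. noise_sum Th G S w \<ge> t} \<le> measure_pmf.prob P {G. ?X G \<ge> exp (s * t)}"
    using s(1) by (intro measure_pmf.finite_measure_mono) (auto intro: mult_left_mono)
  also have "\<dots> \<le> measure_pmf.expectation P ?X / exp (s * t)"
    using integral_Markov_inequality_measure[of "measure_pmf P" ?X "{}" "exp (s * t)"] by simp
  also have "\<dots> \<le> exp (r * s^2) / exp (s * t)" by (intro divide_right_mono noise_sum_mgf[OF S w s]) auto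
  finally show ?thesis by (simp add: exp_diff)
qed

lemma noise_sum_uminus: "noise_sum Th G S (\<lambda>e. - w e) = - noise_sum Th G S w"
  by (simp add: noise_sum_def sum_negf)

lemma noise_sum_abs_tail:
  assumes S: "S \<subseteq> node_pairs n" and w: "(\<Sum>e\<in>S. (w e)^2) \<le> 1"
    and s: "0 \<le> s" "\<And>e. e \<in> S \<Longrightarrow> s * \<bar>w e\<bar> \<le> 1"
  shows "measure_pmf.prob P {G. \<bar>noise_sum Th G S w\<bar> \<ge> t} \<le> 2 * exp (r * s^2 - s * t)"
proof -
  let ?A = "\<lambda>w. {G. noise_sum Th G S w \<ge> t}"
  have "measure_pmf.prob P {G. \<bar>noise_sum Th G S w\<bar> \<ge> t} \<le> measure_pmf.prob P (?A w \<union> ?A (\<lambda>e. - w e))"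
    by (intro measure_pmf.finite_measure_mono) (auto simp: noise_sum_uminus)
  also have "\<dots> \<le> measure_pmf.prob P (?A w) + measure_pmf.prob P (?A (\<lambda>e. - w e))"
    by (rule measure_Un_le) auto
  also have "\<dots> \<le> exp (r * s^2 - s * t) + exp (r * s^2 - s * t)"
    using w s by (intro add_mono noise_sum_tail[OF S]) auto
  finally show ?thesis by simp
qed

text \<open>Instead of computing the variance, the square is dominated by
  \<open>2 * (exp x + exp (- x) - 2)\<close> and the exponential moment is used at
  \<open>s = 1\<close>, which is admissible because each weight is at most 1 in absolute
  value.\<close>

lemma noise_sum_second_moment:
  assumes S: "S \<subseteq> node_pairs n" and w: "(\<Sum>e\<in>S. (w e)^2) \<le> 1"
  shows "measure_pmf.expectation P (\<lambda>G. (noise_sum Th G S w)^2) \<le> 8 * r"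
proof -
  let ?X = "\<lambda>w G. exp (1 * noise_sum Th G S w)"
  have fS: "finite S" using S by (rule finite_subset) simp
  have w1: "1 * \<bar>w e\<bar> \<le> 1" if "e \<in> S" for e
  proof -
    have "(w e)^2 \<le> 1" using member_le_sum[OF that, of "\<lambda>e. (w e)^2"] fS w by simp
    then show ?thesis by (simp add: abs_square_le_1)
  qed
  have sq: "x^2 \<le> 2 * (exp x + exp (- x) - 2)" for x :: real
  proof -
    have *: "y^2 \<le> 2 * (exp y + exp (- y) - 2)" if "0 \<le> y" for y :: real
      using exp_lower_Taylor_quadratic[OF that] exp_ge_add_one_self[of "- y"] by (simp add: field_simps)
    show ?thesis using *[of x] *[of "- x"] by (cases "0 \<le> x") (auto simp: add.commute)
  qed
  have "measure_pmf.expectation P (\<lambda>G. (noise_sum Th G S w)^2)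
      \<le> measure_pmf.expectation P (\<lambda>G. 2 * (?X w G + ?X (\<lambda>e. - w e) G - 2))"
    using sq by (intro integral_mono) (auto simp: noise_sum_uminus)
  also have "\<dots> = 2 * (measure_pmf.expectation P (?X w) + measure_pmf.expectation P (?X (\<lambda>e. - w e)) - 2)"
    by (simp add: Bochner_Integration.integral_add Bochner_Integration.integral_diff del: mult_1)
  also have "\<dots> \<le> 2 * (exp (r * 1^2) + exp (r * 1^2) - 2)"
    using w w1 by (intro mult_left_mono diff_right_mono add_mono noise_sum_mgf[OF S]) auto
  also have "\<dots> \<le> 8 * r"
  proof -
    have "r^2 \<le> r" using r by (simp add: power2_eq_square)
    then show ?thesis using exp_le_quadratic[of r] r by simp
  qed
  finally show ?thesis .
qed

lemma indep_vars_noise_sum: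
  assumes S: "\<And>i. i \<in> I \<Longrightarrow> S i \<subseteq> node_pairs n" and disj: "disjoint_family_on S I"
  shows "prob_space.indep_vars (measure_pmf P) (\<lambda>_. borel)
     (\<lambda>i G. min ((noise_sum Th G (S i) (w i))^2) M) I"
proof -
  have "prob_space.indep_vars (measure_pmf P) (\<lambda>i. PiM (S i) (\<lambda>_. count_space UNIV))
     (\<lambda>i G. restrict (\<lambda>e. G e) (S i)) I"
    unfolding pabm_pmf_alt
    by (rule prob_space.indep_vars_restrict[OF measure_pmf.prob_space_axioms indep_vars_Pi_pmf S disj]) auto
  then have "prob_space.indep_vars (measure_pmf P) (\<lambda>_. borel)
     (\<lambda>i G. min ((noise_sum Th (restrict (\<lambda>e. G e) (S i)) (S i) (w i))^2) M) I"
  proof (rule prob_space.indep_vars_compose2[OF measure_pmf.prob_space_axioms])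
    fix i assume "i \<in> I"
    have [measurable]: "(\<lambda>f. of_bool (f e) :: real) \<in> borel_measurable (PiM (S i) (\<lambda>_. count_space UNIV))" if "e \<in> S i" for e
      using measurable_component_singleton[OF that] by (rule measurable_compose) simp
    show "(\<lambda>f. min ((noise_sum Th f (S i) (w i))^2) M) \<in> borel_measurable (PiM (S i) (\<lambda>_. count_space UNIV))"
      unfolding noise_sum_def by measurable
  qed
  moreover have "noise_sum Th (restrict (\<lambda>e. G e) (S i)) (S i) (w i) = noise_sum Th G (S i) (w i)" for i G
    unfolding noise_sum_def by (intro sum.cong) auto
  ultimately show ?thesis by simp
qed

text \<open>Truncation at \<open>M\<close> makes the squares bounded, as Hoeffding's inequality
  requires, and disjoint edge sets make them independent. Each mean is at most \<open>8 * r\<close>,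
  which leaves a deviation of \<open>n * r\<close>.\<close>

lemma truncated_row_sum_tail:
  assumes S: "\<And>i. i < n \<Longrightarrow> S i \<subseteq> node_pairs n" and disj: "disjoint_family_on S {..<n}"
    and w: "\<And>i. i < n \<Longrightarrow> (\<Sum>e\<in>S i. (w i e)^2) \<le> 1" and M: "0 < M" and n: "0 < n"
  shows "measure_pmf.prob P {G. (\<Sum>i<n. min ((noise_sum Th G (S i) (w i))^2) M) \<ge> 9 * real n * r}
     \<le> exp (- 2 * real n * r^2 / M^2)"
proof -
  let ?X = "\<lambda>i G. min ((noise_sum Th G (S i) (w i))^2) M"
  interpret Hoeffding_ineq "measure_pmf P" "{..<n}" ?X "\<lambda>_. 0" "\<lambda>_. M"
    "\<Sum>i<n. measure_pmf.expectation P (?X i)"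
  proof (unfold_locales)
    show "prob_space.indep_vars (measure_pmf P) (\<lambda>_. borel) ?X {..<n}"
      by (rule indep_vars_noise_sum) (use S disj in auto)
  qed (use M in auto)
  have "measure_pmf.expectation P (?X i) \<le> 8 * r" if "i < n" for i
  proof -
    have "measure_pmf.expectation P (?X i) \<le> measure_pmf.expectation P (\<lambda>G. (noise_sum Th G (S i) (w i))^2)"
      by (intro integral_mono) auto
    also have "\<dots> \<le> 8 * r" by (rule noise_sum_second_moment[OF S[OF that] w[OF that]])
    finally show ?thesis .
  qed
  then have "(\<Sum>i<n. measure_pmf.expectation P (?X i)) \<le> (\<Sum>i<n. 8 * r)" by (intro sum_mono) auto
  then have "measure_pmf.prob P {G. (\<Sum>i<n. ?X i G) \<ge> 9 * real n * r}
     \<le> measure_pmf.prob P {G \<in> space (measure_pmf P). (\<Sum>i<n. ?X i G) \<ge> (\<Sum>i<n. measure_pmf.expectation P (?X i)) + real n * r}"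
    by (intro measure_pmf.finite_measure_mono) auto
  also have "\<dots> \<le> exp (- 2 * (real n * r)^2 / (\<Sum>i<n. (M - 0)^2))"
    using r M n by (intro Hoeffding_ineq_ge) auto
  also have "- 2 * (real n * r)^2 / (\<Sum>i<n. (M - 0)^2) = - 2 * real n * r^2 / M^2"
    using n by (simp add: power_mult_distrib power2_eq_square)
  finally show ?thesis .
qed

end

definition upper_edges :: "nat \<Rightarrow> nat \<Rightarrow> (nat \<times> nat) set" where
  "upper_edges n i = (\<lambda>j. (i, j)) ` {i<..<n}"

definition lower_edges :: "nat \<Rightarrow> (nat \<times> nat) set" where
  "lower_edges i = (\<lambda>j. (j, i)) ` {..<i}"

text \<open>An edge lies in two rows of the symmetric noise, but in only one upper and one lower
  half row. Splitting every row according to \<open>up\<close> gives two families of pairwise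
  disjoint edge sets.\<close>

definition row_edges :: "nat \<Rightarrow> bool \<Rightarrow> nat \<Rightarrow> (nat \<times> nat) set" where
  "row_edges n up i = (if up then upper_edges n i else lower_edges i)"

text \<open>An edge of half row \<open>i\<close> is weighted by the entry of \<open>X\<close> at its
  other endpoint.\<close>

definition row_weight :: "rmat \<Rightarrow> bool \<Rightarrow> nat \<Rightarrow> nat \<times> nat \<Rightarrow> real" where
  "row_weight X up a e = X (if up then snd e else fst e) a"

lemma row_edges_subset: "i < n \<Longrightarrow> row_edges n up i \<subseteq> node_pairs n"
  by (auto simp: row_edges_def upper_edges_def lower_edges_def node_pairs_def)

lemma row_edges_disjoint: "disjoint_family_on (row_edges n up) I"
  by (auto simp: disjoint_family_on_def row_edges_def upper_edges_def lower_edges_def)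

lemma sum_upper_edges: "(\<Sum>e\<in>upper_edges n i. f e) = (\<Sum>j\<in>{i<..<n}. f (i, j))"
  unfolding upper_edges_def by (subst sum.reindex) (auto simp: inj_on_def)

lemma sum_lower_edges: "(\<Sum>e\<in>lower_edges i. f e) = (\<Sum>j<i. f (j, i))"
  unfolding lower_edges_def by (subst sum.reindex) (auto simp: inj_on_def)

lemma noise_row_split:
  assumes i: "i < n"
  shows "mvec n (noise Th G) (col X a) i
    = noise_sum Th G (row_edges n True i) (row_weight X True a) + noise_sum Th G (row_edges n False i) (row_weight X False a)"
proof -
  have "{..<n} = {..<i} \<union> insert i {i<..<n}" using i by auto
  then have "mvec n (noise Th G) (col X a) i = (\<Sum>j\<in>{..<i} \<union> insert i {i<..<n}. noise Th G i j * X j a)"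
    by simp
  also have "\<dots> = (\<Sum>j<i. noise Th G i j * X j a) + (\<Sum>j\<in>insert i {i<..<n}. noise Th G i j * X j a)"
    by (rule sum.union_disjoint) auto
  also have "(\<Sum>j\<in>insert i {i<..<n}. noise Th G i j * X j a) = (\<Sum>j\<in>{i<..<n}. noise Th G i j * X j a)"
    by (simp add: noise_def edge_noise_def node_pair_def)
  also have "(\<Sum>j\<in>{i<..<n}. noise Th G i j * X j a) = noise_sum Th G (row_edges n True i) (row_weight X True a)"
    by (simp add: noise_sum_def row_edges_def row_weight_def sum_upper_edges noise_def edge_noise_def node_pair_def mult.commute)
  also have "(\<Sum>j<i. noise Th G i j * X j a) = noise_sum Th G (row_edges n False i) (row_weight X False a)"
    by (simp add: noise_sum_def row_edges_def row_weight_def sum_lower_edges noise_def edge_noise_def node_pair_def mult.commute)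
  finally show ?thesis by simp
qed

lemma row_weight_sum:
  assumes on: "orthonormal_cols n m X" and i: "i < n" and a: "a < m"
  shows "(\<Sum>e\<in>row_edges n up i. (row_weight X up a e)^2) \<le> 1"
proof -
  have "(\<Sum>j<n. (X j a)^2) = 1" using on a by (simp add: orthonormal_cols_def power2_eq_square)
  moreover have "(\<Sum>j\<in>{i<..<n}. (X j a)^2) \<le> (\<Sum>j<n. (X j a)^2)" by (rule sum_mono2) auto
  moreover have "(\<Sum>j<i. (X j a)^2) \<le> (\<Sum>j<n. (X j a)^2)" using i by (intro sum_mono2) auto
  ultimately show ?thesis
    by (simp add: row_edges_def row_weight_def sum_upper_edges sum_lower_edges)
qed

lemma pabm_prob_UN_le:
  assumes "finite I" "\<And>i. i \<in> I \<Longrightarrow> measure_pmf.prob p (B i) \<le> (b :: real)"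
  shows "measure_pmf.prob p (\<Union>i\<in>I. B i) \<le> real (card I) * b"
proof -
  have "measure_pmf.prob p (\<Union>i\<in>I. B i) \<le> (\<Sum>i\<in>I. measure_pmf.prob p (B i))"
    by (rule measure_pmf.finite_measure_subadditive_finite[OF assms(1)]) auto
  also have "\<dots> \<le> real (card I) * b" using assms(2) by (rule sum_bounded_above)
  finally show ?thesis .
qed

text \<open>The second clause is uniform over the entries at the price of a logarithm; the third
  bounds column norms without it, which summing the second could not give. The two halves of each
  row lead to \<open>18 = 9 + 9\<close> and \<open>36 = 2 * 9 + 2 * 9\<close>, and
  \<open>12^2 = 8 * 3 * 6\<close> comes from \<open>exp 1 \<le> 3\<close> and
  \<open>p \<le> 6 * l\<close>.\<close>

definition noise_controlled ::
  "nat \<Rightarrow> nat \<Rightarrow> real \<Rightarrow> real \<Rightarrow> rmat \<Rightarrow> rmat \<Rightarrow> (nat \<times> nat \<Rightarrow> bool) \<Rightarrow> bool" where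
  "noise_controlled n K rho l Th X G \<longleftrightarrow>
     (\<forall>x. vnorm n (mvec n (noise Th G) x) \<le> 12 * rho * sqrt (real n * l) * vnorm n x) \<and>
     (\<forall>i<n. \<forall>a<K^2. \<bar>mvec n (noise Th G) (col X a) i\<bar> \<le> 18 * rho * sqrt l) \<and>
     (\<forall>a<K^2. (\<Sum>i<n. (mvec n (noise Th G) (col X a) i)^2) \<le> 36 * real n * rho^2)"

lemma noise_controlled_prob:
  fixes Th X :: rmat and rho l a4 :: real
  assumes Th: "\<And>i j. i < n \<Longrightarrow> j < n \<Longrightarrow> 0 \<le> Th i j \<and> Th i j \<le> rho^2"
    and on: "orthonormal_cols n (K^2) X"
    and rows: "\<And>j. j < n \<Longrightarrow> vnorm (K^2) (X j) \<le> a4 * real K / sqrt (real n)"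
    and K: "0 < K" "K^2 \<le> n" and rho: "0 < rho" "rho \<le> 1" and l: "l = ln (real n)" "1 \<le> l"
    and nrho: "12 * (real K)^2 * l^2 \<le> real n * rho^2" "a4^2 * (real K)^2 * l^2 \<le> real n * rho^2"
    and big: "16403 * l ^ 3 \<le> real n"
  shows "measure_pmf.prob (pabm_pmf n Th) {G. \<not> noise_controlled n K rho l Th X G} \<le> 7 / real n ^ 4"
proof -
  let ?P = "pabm_pmf n Th"
  have n: "0 < n" using K by (auto simp: power2_eq_square dest: le_trans[rotated] intro: gr0I)
  have n1: "1 \<le> real n" using n by simp
  have r: "0 < rho^2" "rho^2 \<le> 1" using rho by (auto simp: power_le_one)
  have Th': "0 \<le> Th i j \<and> Th i j \<le> rho^2" if "i < j" "j < n" for i j using that by (intro Th) auto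
  have exp_l: "exp (- (real k * l)) = 1 / real n ^ k" for k :: nat
  proof -
    have "exp (real k * l) = real n ^ k" using n by (simp add: l(1) exp_of_nat_mult)
    then show ?thesis by (simp add: exp_minus divide_inverse)
  qed
  \<comment> \<open>\<open>s\<close> is the Chernoff parameter and \<open>t\<close> the threshold
    for half rows: \<open>rho^2 * s^2 - s * t = l - 9 * l\<close>, hence a probability of order
    \<open>n^-8\<close> for each of at most \<open>2 * n^2\<close> sums. The moment order
    \<open>p\<close> is about \<open>5 * l\<close>, so that
    \<open>n * exp (- p) \<le> n^-4\<close>.\<close>
  define t where "t = 9 * rho * sqrt l"
  define s where "s = sqrt l / rho"
  define p where "p = nat \<lceil>5 * l\<rceil>"
  define S where "S up i = row_edges n up i" for up i
  define w where "w up a = row_weight X up a" for up a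
  define B1 where "B1 = {G. \<not> (\<forall>x. vnorm n (mvec n (noise Th G) x) \<le> sqrt (8 * exp 1 * real p * (real n * rho^2)) * vnorm n x)}"
  define B2 where "B2 = (\<Union>z\<in>(UNIV :: bool set) \<times> ({..<n} \<times> {..<K^2}).
      {G. \<bar>noise_sum Th G (S (fst z) (fst (snd z))) (w (fst z) (snd (snd z)))\<bar> \<ge> t})"
  define B3 where "B3 = (\<Union>z\<in>(UNIV :: bool set) \<times> {..<K^2}.
      {G. (\<Sum>i<n. min ((noise_sum Th G (S (fst z) i) (w (fst z) (snd z)))^2) (t^2)) \<ge> 9 * real n * rho^2})"
  have p: "5 * l \<le> real p" "real p \<le> 6 * l" "0 < p" using l(2) unfolding p_def by linarith+
  have p2: "2 * real p \<le> real n * rho^2"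
  proof -
    have "1 * 1 \<le> (real K)^2 * (1 :: real)" using K by (simp add: one_le_power)
    then have "12 * l^2 \<le> 12 * (real K)^2 * l^2" by (simp add: mult_right_mono)
    then have 1: "12 * l^2 \<le> real n * rho^2" using nrho by linarith
    have "12 * l \<le> 12 * l^2" using l(2) by (simp add: power2_eq_square)
    then show ?thesis using 1 p by linarith
  qed
  have "measure_pmf.prob ?P B1 \<le> real n * exp (- real p)"
    unfolding B1_def by (rule noise_operator_norm[OF Th' r p(3) p2])
  also have "\<dots> \<le> real n * exp (- (real 5 * l))" using p by (intro mult_left_mono) auto
  also have "\<dots> = 1 / real n ^ 4" unfolding exp_l using n by (simp add: power_def field_simps)
  finally have B1: "measure_pmf.prob ?P B1 \<le> 1 / real n ^ 4" .
  \<comment> \<open>The Chernoff parameter is admissible because the rows of \<open>X\<close> are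
    short: \<open>s\<close> times their bound is at most 1 by the second part of
    \<open>nrho\<close>.\<close>
  have weight: "s * \<bar>w up a e\<bar> \<le> 1" if "i < n" "a < K^2" "e \<in> S up i" for up i a e
  proof -
    have "(if up then snd e else fst e) < n"
      using row_edges_subset[OF that(1), of up] that(3) by (auto simp: S_def node_pairs_def)
    then have "\<bar>w up a e\<bar> \<le> a4 * real K / sqrt (real n)"
      unfolding w_def row_weight_def
    proof (intro order.trans[OF _ rows])
      fix j
      have "\<bar>X j a\<bar> \<le> vnorm (K^2) (\<lambda>a. \<bar>X j a\<bar>)" using that(2) by (intro member_le_L2_set) auto
      then show "\<bar>X j a\<bar> \<le> vnorm (K^2) (X j)" by (simp only: vnorm_abs)
    qed
    then have "s * \<bar>w up a e\<bar> \<le> s * (a4 * real K / sqrt (real n))" using rho l by (intro mult_left_mono) (auto simp: s_def)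
    also have "\<dots> \<le> 1"
    proof -
      have "(a4 * real K * sqrt l)^2 \<le> a4^2 * (real K)^2 * l^2"
      proof -
        have "(a4 * real K * sqrt l)^2 = (a4 * real K)^2 * l" using l(2) by (simp add: power_mult_distrib)
        also have "\<dots> \<le> (a4 * real K)^2 * l^2" using l(2) by (intro mult_left_mono) (auto simp: power2_eq_square)
        finally show ?thesis by (simp add: power_mult_distrib)
      qed
      also have "\<dots> \<le> (rho * sqrt (real n))^2" using nrho(2) by (simp add: power_mult_distrib mult.commute)
      finally have sq: "(a4 * real K * sqrt l)^2 \<le> (rho * sqrt (real n))^2" .
      have "a4 * real K * sqrt l \<le> rho * sqrt (real n)" by (rule power2_le_imp_le[OF sq]) (use rho in simp)
      then have "a4 * real K * sqrt l / (rho * sqrt (real n)) \<le> 1" using rho n by (subst pos_divide_le_eq) auto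
      then show ?thesis by (simp add: s_def mult_ac)
    qed
    finally show ?thesis .
  qed
  have st: "rho^2 * s^2 - s * t = - (real 8 * l)"
    using rho l by (simp add: s_def t_def power_divide)
  have "measure_pmf.prob ?P B2 \<le> real (card ((UNIV :: bool set) \<times> ({..<n} \<times> {..<K^2}))) * (2 / real n ^ 8)"
    unfolding B2_def
  proof (rule pabm_prob_UN_le)
    fix z :: "bool \<times> nat \<times> nat" assume "z \<in> UNIV \<times> ({..<n} \<times> {..<K^2})"
    then obtain up i a where z: "z = (up, i, a)" "i < n" "a < K^2" by auto
    have "measure_pmf.prob ?P {G. \<bar>noise_sum Th G (S up i) (w up a)\<bar> \<ge> t} \<le> 2 * exp (rho^2 * s^2 - s * t)"
      using z(2,3) row_edges_subset row_weight_sum[OF on] weight rho l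
      by (intro noise_sum_abs_tail[OF Th' r]) (auto simp: S_def w_def s_def)
    also have "\<dots> = 2 / real n ^ 8" unfolding st exp_l by simp
    finally show "measure_pmf.prob ?P {G. \<bar>noise_sum Th G (S (fst z) (fst (snd z))) (w (fst z) (snd (snd z)))\<bar> \<ge> t} \<le> 2 / real n ^ 8"
      by (simp add: z(1))
  qed simp
  also have "\<dots> = 4 * (real n * real (K^2)) / real n ^ 8" by (simp add: card_cartesian_product)
  also have "\<dots> \<le> 4 * (real n * real n) / real n ^ 8"
    using K(2) n by (intro divide_right_mono mult_left_mono) (auto simp del: of_nat_power)
  also have "\<dots> \<le> 4 / real n ^ 4"
  proof -
    have "real n * real n * real n ^ 4 \<le> 1 * real n ^ 8"
      using n1 power_increasing[of 6 8 "real n"] by (simp add: power_numeral_reduce)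
    then show ?thesis using n by (simp add: field_simps)
  qed
  finally have B2: "measure_pmf.prob ?P B2 \<le> 4 / real n ^ 4" .
  have t0: "0 < t^2" using rho l by (simp add: t_def)
  have "measure_pmf.prob ?P B3 \<le> real (card ((UNIV :: bool set) \<times> {..<K^2})) * (1 / real n ^ 5)"
    unfolding B3_def
  proof (rule pabm_prob_UN_le)
    fix z :: "bool \<times> nat" assume "z \<in> UNIV \<times> {..<K^2}"
    then obtain up a where z: "z = (up, a)" "a < K^2" by auto
    have "measure_pmf.prob ?P {G. (\<Sum>i<n. min ((noise_sum Th G (S up i) (w up a))^2) (t^2)) \<ge> 9 * real n * rho^2}
        \<le> exp (- 2 * real n * (rho^2)^2 / (t^2)^2)"
      unfolding S_def w_def
      by (rule truncated_row_sum_tail[OF Th' r row_edges_subset row_edges_disjoint row_weight_sum[OF on _ z(2)] t0 n])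
    \<comment> \<open>\<open>6561 = 9 ^ 4\<close>. The exponent exceeds \<open>5 * l\<close> in size
      as soon as \<open>n \<ge> 16402.5 * l ^ 3\<close>, whence the constant in
      \<open>big\<close>.\<close>
    also have "- 2 * real n * (rho^2)^2 / (t^2)^2 = - (2 * real n / (6561 * l^2))"
      using rho l by (simp add: t_def power_mult_distrib)
    also have "exp \<dots> \<le> exp (- (real 5 * l))"
      using big l by (simp add: field_simps power2_eq_square power3_eq_cube)
    also have "\<dots> = 1 / real n ^ 5" by (rule exp_l)
    finally show "measure_pmf.prob ?P {G. (\<Sum>i<n. min ((noise_sum Th G (S (fst z) i) (w (fst z) (snd z)))^2) (t^2)) \<ge> 9 * real n * rho^2}
        \<le> 1 / real n ^ 5" by (simp add: z(1))
  qed simp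
  also have "\<dots> = 2 * real (K^2) / real n ^ 5" by (simp add: card_cartesian_product)
  also have "\<dots> \<le> 2 * real n / real n ^ 5"
    using K(2) n by (intro divide_right_mono mult_left_mono) (auto simp del: of_nat_power)
  also have "\<dots> = 2 / real n ^ 4" using n by (simp add: field_simps power_numeral_reduce)
  finally have B3: "measure_pmf.prob ?P B3 \<le> 2 / real n ^ 4" .
  have "{G. \<not> noise_controlled n K rho l Th X G} \<subseteq> B1 \<union> (B2 \<union> B3)"
  proof (rule subsetI, rule ccontr)
    fix G assume bad: "G \<in> {G. \<not> noise_controlled n K rho l Th X G}" and "G \<notin> B1 \<union> (B2 \<union> B3)"
    then have g: "G \<notin> B1" "G \<notin> B2" "G \<notin> B3" by auto
    let ?N = "\<lambda>up i a. noise_sum Th G (S up i) (w up a)"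
    have N: "\<bar>?N up i a\<bar> < t" if "i < n" "a < K^2" for up i a
      using g(2) that unfolding B2_def by (auto simp: not_le dest: spec[of _ up])
    have split: "mvec n (noise Th G) (col X a) i = ?N True i a + ?N False i a" if "i < n" for i a
      unfolding S_def w_def by (rule noise_row_split[OF that])
    have N2: "(\<Sum>i<n. (?N up i a)^2) \<le> 9 * real n * rho^2" if a: "a < K^2" for up a
    proof -
      \<comment> \<open>Outside \<open>B2\<close> no half row sum reaches \<open>t\<close>, so the
        truncation at \<open>t^2\<close> changes nothing.\<close>
      have "(\<Sum>i<n. (?N up i a)^2) = (\<Sum>i<n. min ((?N up i a)^2) (t^2))"
      proof (intro sum.cong refl)
        fix i assume "i \<in> {..<n}"
        then have "\<bar>?N up i a\<bar>^2 \<le> t^2" using N[of i a up] a by (intro power_mono) auto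
        then show "(?N up i a)^2 = min ((?N up i a)^2) (t^2)" by simp
      qed
      also have "\<dots> < 9 * real n * rho^2"
        using g(3) a unfolding B3_def by (auto simp: not_le dest: spec[of _ up])
      finally show ?thesis by simp
    qed
    have "noise_controlled n K rho l Th X G"
      unfolding noise_controlled_def
    proof (intro conjI allI impI)
      fix x
      have "vnorm n (mvec n (noise Th G) x) \<le> sqrt (8 * exp 1 * real p * (real n * rho^2)) * vnorm n x"
        using g(1) unfolding B1_def by blast
      also have "\<dots> \<le> 12 * rho * sqrt (real n * l) * vnorm n x"
      proof (rule mult_right_mono)
        have "8 * exp 1 * real p * (real n * rho^2) \<le> 8 * 3 * (6 * l) * (real n * rho^2)"
          using p l exp_le by (intro mult_right_mono mult_mono) auto
        then have "sqrt (8 * exp 1 * real p * (real n * rho^2)) \<le> sqrt ((12 * rho)^2 * (real n * l))"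
          by (intro real_sqrt_le_mono) (simp add: power_mult_distrib mult_ac)
        also have "\<dots> = 12 * rho * sqrt (real n * l)" using rho by (simp add: real_sqrt_mult)
        finally show "sqrt (8 * exp 1 * real p * (real n * rho^2)) \<le> 12 * rho * sqrt (real n * l)" .
      qed simp
      finally show "vnorm n (mvec n (noise Th G) x) \<le> 12 * rho * sqrt (real n * l) * vnorm n x" .
    next
      fix i a assume "i < n" "a < K^2"
      then show "\<bar>mvec n (noise Th G) (col X a) i\<bar> \<le> 18 * rho * sqrt l"
        using N[of i a True] N[of i a False] split[of i a] by (simp add: t_def)
    next
      fix a assume a: "a < K^2"
      have "(\<Sum>i<n. (mvec n (noise Th G) (col X a) i)^2) \<le> (\<Sum>i<n. 2 * (?N True i a)^2 + 2 * (?N False i a)^2)"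
      proof (intro sum_mono)
        fix i assume "i \<in> {..<n}"
        show "(mvec n (noise Th G) (col X a) i)^2 \<le> 2 * (?N True i a)^2 + 2 * (?N False i a)^2"
          using split[of i a] \<open>i \<in> {..<n}\<close> square_diff_le[of "?N True i a" "- ?N False i a" 0] by simp
      qed
      also have "\<dots> = 2 * (\<Sum>i<n. (?N True i a)^2) + 2 * (\<Sum>i<n. (?N False i a)^2)"
        by (simp add: sum.distrib sum_distrib_left)
      also have "\<dots> \<le> 36 * real n * rho^2" using N2[OF a, of True] N2[OF a, of False] by simp
      finally show "(\<Sum>i<n. (mvec n (noise Th G) (col X a) i)^2) \<le> 36 * real n * rho^2" .
    qed
    with bad show False by simp
  qed
  then have "measure_pmf.prob ?P {G. \<not> noise_controlled n K rho l Th X G} \<le> measure_pmf.prob ?P (B1 \<union> (B2 \<union> B3))"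
    by (intro measure_pmf.finite_measure_mono) auto
  also have "\<dots> \<le> measure_pmf.prob ?P B1 + measure_pmf.prob ?P (B2 \<union> B3)" by (rule measure_Un_le) auto
  also have "measure_pmf.prob ?P (B2 \<union> B3) \<le> measure_pmf.prob ?P B2 + measure_pmf.prob ?P B3" by (rule measure_Un_le) auto
  finally show ?thesis using B1 B2 B3 by simp
qed

section \<open>Eigenvectors of the edge probability matrix\<close>

lemma comm_gram_commute: "comm_gram n c L k a b = comm_gram n c L k b a"
  by (simp add: comm_gram_def mult.commute)

text \<open>Both sides are the same entry of \<open>P G P^T\<close>, with \<open>P G\<close>
  cancelled on the left or on the right.\<close>

lemma inverse_mat_symmetric:
  assumes inv: "is_inverse_mat m G P" and G: "\<And>a b. G a b = G b a" and ab: "a < m" "b < m"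
  shows "P a b = P b a"
proof -
  have PG: "(\<Sum>k<m. P a k * G k l) = (if a = l then 1 else 0)" if "a < m" "l < m" for a l
    using inv that by (simp add: is_inverse_mat_def)
  have "P b a = (\<Sum>l<m. (\<Sum>k<m. P a k * G k l) * P b l)"
  proof -
    have "(\<Sum>l<m. (\<Sum>k<m. P a k * G k l) * P b l) = (\<Sum>l<m. if a = l then P b l else 0)"
      using PG ab by (intro sum.cong) auto
    then show ?thesis using ab by simp
  qed
  also have "\<dots> = (\<Sum>l<m. \<Sum>k<m. P a k * (P b l * G l k))"
    unfolding sum_distrib_right by (intro sum.cong refl) (simp add: G[of _ "_ :: nat"] mult_ac)
  also have "\<dots> = (\<Sum>k<m. P a k * (\<Sum>l<m. P b l * G l k))"
    by (subst sum.swap) (simp add: sum_distrib_left)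
  also have "\<dots> = (\<Sum>k<m. if b = k then P a k else 0)"
    using PG ab by (intro sum.cong) auto
  also have "\<dots> = P a b" using ab by simp
  finally show ?thesis by simp
qed

lemma D_form_eq: "D_form m P x y = dot m (\<lambda>b. \<Sum>a<m. x a * P a b) y"
  unfolding D_form_def by (subst sum.swap) (simp add: sum_distrib_right)

lemma D_form_commute:
  assumes "is_inverse_mat m G P" "\<And>a b. G a b = G b a"
  shows "D_form m P x y = D_form m P y x"
  unfolding D_form_def
  by (subst sum.swap, intro sum.cong refl)
     (simp add: inverse_mat_symmetric[OF assms, of _ "_ :: nat"] mult_ac)

text \<open>\<open>P\<close> cancels against the Gram matrix \<open>M^T M\<close> of the rows
  \<open>M\<close> of \<open>L\<close> in community \<open>k\<close>. For \<open>x = L i\<close>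
  this says that \<open>M P M^T\<close> fixes the combination \<open>M z\<close> of columns.\<close>

lemma D_form_reproducing:
  assumes inv: "is_inverse_mat K (comm_gram n c L k) P"
  shows "(\<Sum>j\<in>{j. j < n \<and> c j = k}. D_form K P x (L j) * dot K (L j) z) = dot K x z"
proof -
  define C where "C = {j. j < n \<and> c j = k}"
  define u where "u b = (\<Sum>a<K. x a * P a b)" for b
  define G where "G = comm_gram n c L k"
  have G: "G a b = (\<Sum>j\<in>C. L j a * L j b)" for a b by (simp add: G_def comm_gram_def C_def)
  have uG: "(\<Sum>b<K. u b * G b a) = x a" if a: "a < K" for a
  proof -
    have "(\<Sum>b<K. u b * G b a) = (\<Sum>b<K. \<Sum>l<K. x l * (P l b * G b a))"
      by (simp add: u_def sum_distrib_right mult.assoc)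
    also have "\<dots> = (\<Sum>l<K. x l * (\<Sum>b<K. P l b * G b a))"
      by (subst sum.swap) (simp add: sum_distrib_left)
    also have "\<dots> = (\<Sum>l<K. if l = a then x l else 0)"
      using inv a by (intro sum.cong refl) (simp add: is_inverse_mat_def G_def)
    finally show ?thesis using a by simp
  qed
  have "(\<Sum>j\<in>C. D_form K P x (L j) * dot K (L j) z) = (\<Sum>j\<in>C. \<Sum>b<K. \<Sum>a<K. u b * (L j b * L j a) * z a)"
    unfolding D_form_eq u_def[symmetric] sum_product by (intro sum.cong refl) (simp only: mult_ac)
  also have "\<dots> = (\<Sum>b<K. \<Sum>a<K. \<Sum>j\<in>C. u b * (L j b * L j a) * z a)"
  proof -
    have "(\<Sum>j\<in>C. \<Sum>b<K. \<Sum>a<K. u b * (L j b * L j a) * z a)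
        = (\<Sum>b<K. \<Sum>j\<in>C. \<Sum>a<K. u b * (L j b * L j a) * z a)" by (rule sum.swap)
    also have "\<dots> = (\<Sum>b<K. \<Sum>a<K. \<Sum>j\<in>C. u b * (L j b * L j a) * z a)" by (intro sum.cong refl sum.swap)
    finally show ?thesis .
  qed
  also have "\<dots> = (\<Sum>b<K. \<Sum>a<K. u b * G b a * z a)"
    unfolding G by (simp only: sum_distrib_left sum_distrib_right)
  also have "\<dots> = (\<Sum>a<K. (\<Sum>b<K. u b * G b a) * z a)"
    by (subst sum.swap) (simp only: sum_distrib_right)
  also have "\<dots> = dot K x z" using uG by (intro sum.cong) auto
  finally show ?thesis unfolding C_def .
qed

lemma D_form_trace:
  assumes inv: "is_inverse_mat K (comm_gram n c L k) P"
  shows "(\<Sum>j\<in>{j. j < n \<and> c j = k}. D_form K P (L j) (L j)) = real K"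
proof -
  let ?C = "{j. j < n \<and> c j = k}"
  have "(\<Sum>j\<in>?C. D_form K P (L j) (L j)) = (\<Sum>a<K. \<Sum>j\<in>?C. \<Sum>b<K. L j a * P a b * L j b)"
    unfolding D_form_def by (rule sum.swap)
  also have "\<dots> = (\<Sum>a<K. \<Sum>b<K. \<Sum>j\<in>?C. L j a * P a b * L j b)"
    by (intro sum.cong refl sum.swap)
  also have "\<dots> = (\<Sum>a<K. \<Sum>b<K. P a b * comm_gram n c L k b a)"
    unfolding comm_gram_def sum_distrib_left by (intro sum.cong refl) (simp only: mult_ac)
  also have "\<dots> = (\<Sum>a<K. 1)"
    using inv by (intro sum.cong refl) (simp add: is_inverse_mat_def)
  finally show ?thesis by simp
qed

text \<open>Both sides are orthogonal projections; the right-hand one fixes the columns of \<open>Th\<close>, and the traces agree.\<close>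

lemma eigvec_rows_dot:
  fixes c :: "nat \<Rightarrow> nat" and P :: "nat \<Rightarrow> rmat"
  assumes c: "\<And>i. i < n \<Longrightarrow> c i < K"
    and inv: "\<And>k. k < K \<Longrightarrow> is_inverse_mat K (comm_gram n c L k) (P k)"
    and dec: "nonzero_eigdecomp n (K^2) (pabm_theta c L) X mu"
    and ij: "i < n" "j < n"
  shows "dot (K^2) (X i) (X j) = (if c i = c j then D_form K (P (c i)) (L i) (L j) else 0)"
proof -
  define Q where "Q i j = (if c i = c j then D_form K (P (c i)) (L i) (L j) else 0)" for i j
  define Pi where "Pi i j = dot (K^2) (X i) (X j)" for i j
  let ?Th = "pabm_theta c L"
  have on: "orthonormal_cols n (K^2) X" and mu: "\<And>a. a < K^2 \<Longrightarrow> mu a \<noteq> 0"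
    and Th: "\<And>i j. i < n \<Longrightarrow> j < n \<Longrightarrow> ?Th i j = (\<Sum>a<K^2. mu a * X i a * X j a)"
    using dec by (auto simp: nonzero_eigdecomp_def)
  have restrict: "(\<Sum>j<n. Q i j * f j) = (\<Sum>j\<in>{j. j < n \<and> c j = c i}. D_form K (P (c i)) (L i) (L j) * f j)" for i f
    by (intro sum.mono_neutral_cong_right) (auto simp: Q_def)
  \<comment> \<open>Inside community \<open>k\<close>, column \<open>l\<close> of \<open>Th\<close>
    is \<open>L l k\<close> times column \<open>c l\<close> of \<open>L\<close>, and the projection
    belonging to that community fixes it.\<close>
  have QTh: "(\<Sum>j<n. Q i j * ?Th j l) = ?Th i l" if "i < n" "l < n" for i l
  proof -
    have "(\<Sum>j<n. Q i j * ?Th j l) = (\<Sum>j\<in>{j. j < n \<and> c j = c i}.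
        D_form K (P (c i)) (L i) (L j) * dot K (L j) (\<lambda>a. if a = c l then L l (c i) else 0))"
      unfolding restrict
      using c[OF that(2)] by (intro sum.cong refl) (simp add: pabm_theta_def if_distrib cong: if_cong)
    also have "\<dots> = dot K (L i) (\<lambda>a. if a = c l then L l (c i) else 0)"
      by (rule D_form_reproducing) (rule inv[OF c[OF that(1)]])
    finally show ?thesis using c[OF that(2)] by (simp add: pabm_theta_def if_distrib cong: if_cong)
  qed
  have ThX: "(\<Sum>j<n. ?Th i j * X j a) = mu a * X i a" if "i < n" "a < K^2" for i a
  proof -
    have "(\<Sum>j<n. ?Th i j * X j a) = dot n (\<lambda>j. \<Sum>b<K^2. (mu b * X i b) * X j b) (col X a)"
      using that by (intro sum.cong refl) (simp add: Th)
    then show ?thesis using orthonormal_cols_coeff[OF on that(2), of "\<lambda>b. mu b * X i b"] by simp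
  qed
  have QX: "(\<Sum>j<n. Q i j * X j a) = X i a" if i: "i < n" and a: "a < K^2" for i a
  proof -
    have "mu a * (\<Sum>j<n. Q i j * X j a) = (\<Sum>j<n. Q i j * (\<Sum>l<n. ?Th j l * X l a))"
      unfolding sum_distrib_left by (intro sum.cong refl) (simp add: ThX[OF _ a] flip: sum_distrib_left)
    also have "\<dots> = (\<Sum>j<n. \<Sum>l<n. Q i j * ?Th j l * X l a)" by (simp only: sum_distrib_left mult.assoc)
    also have "\<dots> = (\<Sum>l<n. (\<Sum>j<n. Q i j * ?Th j l) * X l a)" by (subst sum.swap) (simp only: sum_distrib_right)
    also have "\<dots> = (\<Sum>l<n. ?Th i l * X l a)" using QTh[OF i] by (intro sum.cong) auto
    also have "\<dots> = mu a * X i a" by (rule ThX[OF i a])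
    finally show ?thesis using mu[OF a] by simp
  qed
  have Q_sym: "Q i j = Q j i" if "i < n" for i j
    using D_form_commute[OF inv[OF c[OF that]] comm_gram_commute] by (simp add: Q_def)
  have Pi_sym: "Pi i j = Pi j i" for i j by (simp add: Pi_def mult.commute)
  have QPi: "(\<Sum>j<n. Q i j * Pi j l) = Pi i l" if "i < n" for i l
  proof -
    have "(\<Sum>j<n. Q i j * Pi j l) = (\<Sum>j<n. \<Sum>a<K^2. Q i j * X j a * X l a)"
      by (simp only: Pi_def sum_distrib_left mult.assoc)
    also have "\<dots> = (\<Sum>a<K^2. (\<Sum>j<n. Q i j * X j a) * X l a)"
      by (subst sum.swap) (simp only: sum_distrib_right)
    also have "\<dots> = Pi i l" unfolding Pi_def using QX[OF that] by (intro sum.cong) auto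
    finally show ?thesis .
  qed
  have QQ: "(\<Sum>j<n. Q i j * Q j l) = Q i l" if "i < n" for i l
  proof (cases "c i = c l")
    case True
    have "(\<Sum>j<n. Q i j * Q j l) = (\<Sum>j\<in>{j. j < n \<and> c j = c i}.
        D_form K (P (c i)) (L i) (L j) * dot K (L j) (\<lambda>a. \<Sum>b<K. P (c i) a b * L l b))"
      unfolding restrict using True
      by (intro sum.cong refl) (auto simp: Q_def D_form_def sum_distrib_left mult.assoc)
    also have "\<dots> = dot K (L i) (\<lambda>a. \<Sum>b<K. P (c i) a b * L l b)"
      by (rule D_form_reproducing) (rule inv[OF c[OF that]])
    also have "\<dots> = Q i l" using True by (simp add: Q_def D_form_def sum_distrib_left mult.assoc)
    finally show ?thesis .
  next
    case False
    then show ?thesis unfolding restrict by (simp add: Q_def)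
  qed
  have tr_Pi: "(\<Sum>i<n. Pi i i) = real (K^2)"
  proof -
    have "(\<Sum>i<n. Pi i i) = (\<Sum>a<K^2. \<Sum>i<n. X i a * X i a)" unfolding Pi_def by (rule sum.swap)
    also have "\<dots> = (\<Sum>a<K^2. 1)" using on by (intro sum.cong refl) (simp add: orthonormal_cols_def)
    finally show ?thesis by simp
  qed
  have tr_Q: "(\<Sum>i<n. Q i i) = real (K^2)"
  proof -
    have "(\<Sum>i<n. Q i i) = (\<Sum>k<K. \<Sum>i\<in>{i\<in>{..<n}. c i = k}. Q i i)"
      by (rule sum.group[symmetric]) (use c in auto)
    also have "\<dots> = (\<Sum>k<K. real K)"
    proof (rule sum.cong[OF refl])
      fix k assume "k \<in> {..<K}"
      have "(\<Sum>i\<in>{i\<in>{..<n}. c i = k}. Q i i) = (\<Sum>i\<in>{i. i < n \<and> c i = k}. D_form K (P k) (L i) (L i))"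
        by (intro sum.cong) (auto simp: Q_def)
      also have "\<dots> = real K" using \<open>k \<in> {..<K}\<close> by (intro D_form_trace inv) auto
      finally show "(\<Sum>i\<in>{i\<in>{..<n}. c i = k}. Q i i) = real K" .
    qed
    finally show ?thesis by (simp add: power2_eq_square)
  qed
  \<comment> \<open>With \<open>Q Q = Q\<close>, \<open>Q Pi = Pi\<close> and
    \<open>Pi Pi = Pi\<close>, the squared distance of the two rows is a difference of diagonal
    entries, and these differences sum to \<open>K^2 - K^2\<close>.\<close>
  have "(\<Sum>j<n. (Q i j - Pi i j)^2) = Q i i - Pi i i" if i: "i < n" for i
  proof -
    have PiPi: "(\<Sum>j<n. Pi i j * Pi i j) = Pi i i"
    proof -
      have "(\<Sum>j<n. Pi i j * Pi i j) = dot n (\<lambda>j. \<Sum>a<K^2. X i a * X j a) (\<lambda>j. \<Sum>a<K^2. X i a * X j a)"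
        by (simp only: Pi_def)
      also have "\<dots> = dot (K^2) (X i) (X i)" by (rule orthonormal_cols_dot[OF on])
      finally show ?thesis by (simp only: Pi_def)
    qed
    have "(\<Sum>j<n. (Q i j - Pi i j)^2) = (\<Sum>j<n. Q i j * Q j i - 2 * (Q i j * Pi j i) + Pi i j * Pi i j)"
      using Q_sym[OF i] Pi_sym[of i] by (intro sum.cong refl) (simp add: power2_eq_square algebra_simps)
    also have "\<dots> = (\<Sum>j<n. Q i j * Q j i) - 2 * (\<Sum>j<n. Q i j * Pi j i) + (\<Sum>j<n. Pi i j * Pi i j)"
      by (simp add: sum.distrib sum_subtractf sum_distrib_left)
    finally show ?thesis using QQ[OF i] QPi[OF i] PiPi by simp
  qed
  then have "(\<Sum>i<n. \<Sum>j<n. (Q i j - Pi i j)^2) = 0"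
    using tr_Q tr_Pi by (simp add: sum_subtractf)
  then have "(\<Sum>j<n. (Q i j - Pi i j)^2) = 0"
    using ij by (subst (asm) sum_nonneg_eq_0_iff) (auto intro: sum_nonneg)
  then have "(Q i j - Pi i j)^2 = 0"
    using ij by (subst (asm) sum_nonneg_eq_0_iff) auto
  then show ?thesis by (simp add: Q_def Pi_def)
qed

lemma eigvec_row_vnorm_le:
  assumes "\<And>i. i < n \<Longrightarrow> c i < K"
    and "\<And>k. k < K \<Longrightarrow> is_inverse_mat K (comm_gram n c L k) (P k)"
    and "nonzero_eigdecomp n (K^2) (pabm_theta c L) X mu"
    and "D_form K (P (c i)) (L i) (L i) \<le> d * (real K)^2 / real n" "0 < d" "i < n"
  shows "vnorm (K^2) (X i) \<le> sqrt d * real K / sqrt (real n)"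
proof -
  have "(vnorm (K^2) (X i))^2 = D_form K (P (c i)) (L i) (L i)"
    using eigvec_rows_dot[OF assms(1-3) assms(6) assms(6)] by (simp add: vnorm_power2_dot)
  also have "\<dots> \<le> d * (real K)^2 / real n" by (rule assms(4))
  also have "\<dots> = (sqrt d * real K / sqrt (real n))^2"
    using assms(5) by (simp add: power_mult_distrib power_divide)
  finally have sq: "(vnorm (K^2) (X i))^2 \<le> (sqrt d * real K / sqrt (real n))^2" .
  show ?thesis by (rule power2_le_imp_le[OF sq]) (use assms(5) in simp)
qed

text \<open>The bound of \<open>tcsc_mis_loss\<close> at \<open>l = ln n\<close>. Fractions of
  exceptional rows are multiplied by \<open>K\<close> because misclassifying a node costs only about
  \<open>n / K\<close> in the k-means objective; in the logarithmic term this \<open>K\<close>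
  cancels. \<open>K / n^2\<close> stems from the slack in the choice of centres.\<close>

definition loss_bound :: "real \<Rightarrow> real \<Rightarrow> nat \<Rightarrow> nat \<Rightarrow> real \<Rightarrow> real \<Rightarrow> real \<Rightarrow> real" where
  "loss_bound CA eps n K eta0 eta1 eta2 = 8 * CA * (1 + CA^2) *
    ((2 + eps) * (2 * (real K * (eta1 + eta2) + 1901068288 * CA / ln (real n)) + CA * \<bar>eta0\<bar>) + real K / (real n)^2)"

section \<open>Approximate k-means\<close>

lemma mis_loss_le:
  assumes "\<pi> permutes {0..<K}"
  shows "mis_loss n K c ch \<le> real (card {i. i < n \<and> c i \<noteq> \<pi> (ch i)}) / real n"
proof -
  have "{real (card {i. i < n \<and> c i \<noteq> \<pi> (ch i)}) / real n | \<pi>. \<pi> permutes {0..<K}}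
      = (\<lambda>\<pi>. real (card {i. i < n \<and> c i \<noteq> \<pi> (ch i)}) / real n) ` {\<pi>. \<pi> permutes {0..<K}}"
    by auto
  then have "finite {real (card {i. i < n \<and> c i \<noteq> \<pi> (ch i)}) / real n | \<pi>. \<pi> permutes {0..<K}}"
    by (simp add: finite_permutations)
  then show ?thesis unfolding mis_loss_def using assms by (intro Min_le) auto
qed

lemma partial_injection_extends_to_permutation:
  assumes "R \<subseteq> {0..<K}" "inj_on g R" "g ` R \<subseteq> {0..<(K :: nat)}"
  obtains s where "s permutes {0..<K}" "\<And>k. k \<in> R \<Longrightarrow> s k = g k"
proof -
  have fR: "finite R" using assms(1) by (rule finite_subset) simp
  have "card ({0..<K} - R) = card ({0..<K} - g ` R)"
    using assms fR by (simp add: card_Diff_subset card_image)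
  then obtain f where f: "bij_betw f ({0..<K} - R) ({0..<K} - g ` R)"
    using finite_same_card_bij[of "{0..<K} - R" "{0..<K} - g ` R"] by auto
  define s where "s k = (if k \<in> R then g k else if k < K then f k else k)" for k
  have "bij_betw s R (g ` R)" using assms(2) by (auto simp: bij_betw_def s_def inj_on_def)
  moreover have "bij_betw s ({0..<K} - R) ({0..<K} - g ` R)"
    using f by (rule bij_betw_cong[THEN iffD1, rotated]) (auto simp: s_def)
  ultimately have "bij_betw s (R \<union> ({0..<K} - R)) (g ` R \<union> ({0..<K} - g ` R))"
    by (rule bij_betw_combine) auto
  then have "bij_betw s {0..<K} {0..<K}" using assms by (simp add: Un_absorb1)
  then have "s permutes {0..<K}" using assms(1) by (intro bij_imp_permutes) (auto simp: s_def)
  then show thesis by (rule that) (simp add: s_def)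
qed

text \<open>A community with two labels outside \<open>S\<close> uses up the label of a community inside \<open>S\<close>.\<close>

lemma separated_labels_permutation:
  fixes c ch :: "nat \<Rightarrow> nat"
  assumes c: "\<And>i. i < n \<Longrightarrow> c i < K" and ch: "\<And>i. i < n \<Longrightarrow> ch i < K"
    and S: "S \<subseteq> {..<n}"
    and sep: "\<And>i j. i < n \<Longrightarrow> j < n \<Longrightarrow> i \<notin> S \<Longrightarrow> j \<notin> S \<Longrightarrow> c i \<noteq> c j \<Longrightarrow> ch i \<noteq> ch j"
    and size: "\<And>k. k < K \<Longrightarrow> lo \<le> real (comm_size n c k) \<and> real (comm_size n c k) \<le> hi" and lo: "0 < lo"
  obtains \<pi> where "\<pi> permutes {0..<K}"
    "real (card {i. i < n \<and> c i \<noteq> \<pi> (ch i)}) \<le> real (card S) * (1 + hi / lo)"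
proof -
  define T where "T k = {i. i < n \<and> i \<notin> S \<and> c i = k}" for k
  define R where "R = {k. k < K \<and> T k \<noteq> {}}"
  define g where "g k = (SOME l. l \<in> ch ` T k)" for k
  have fS: "finite S" using S by (rule finite_subset) simp
  have g: "g k \<in> ch ` T k" if "k \<in> R" for k
  proof -
    have "\<exists>l. l \<in> ch ` T k" using that by (auto simp: R_def)
    then show ?thesis unfolding g_def by (rule someI_ex)
  qed
  have disj: "k = l" if "x \<in> ch ` T k" "x \<in> ch ` T l" for k l x
    using that sep by (auto simp: T_def)
  have R: "R \<subseteq> {0..<K}" "finite R" by (auto simp: R_def)
  have g_inj: "inj_on g R" using g disj by (metis inj_onI)
  have g_range: "g ` R \<subseteq> {0..<K}" using g ch by (fastforce simp: T_def)
  obtain s where s: "s permutes {0..<K}" "\<And>k. k \<in> R \<Longrightarrow> s k = g k"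
    using partial_injection_extends_to_permutation[OF R(1) g_inj g_range] by metis
  define R' where "R' = {k\<in>R. \<exists>x\<in>ch ` T k. x \<noteq> g k}"
  define h where "h k = (SOME x. x \<in> ch ` T k \<and> x \<noteq> g k)" for k
  have h: "h k \<in> ch ` T k" "h k \<noteq> g k" if "k \<in> R'" for k
  proof -
    have "\<exists>x. x \<in> ch ` T k \<and> x \<noteq> g k" using that by (auto simp: R'_def)
    from someI_ex[OF this] show "h k \<in> ch ` T k" "h k \<noteq> g k" unfolding h_def by auto
  qed
  have R': "R' \<subseteq> R" "finite R'" using R by (auto simp: R'_def)
  have h_inj: "inj_on h R'" using h disj by (metis inj_onI)
  have gh: "g ` R \<inter> h ` R' = {}"
  proof (rule equals0I)
    fix x assume "x \<in> g ` R \<inter> h ` R'"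
    then obtain k l where kl: "k \<in> R" "l \<in> R'" "x = g k" "x = h l" by auto
    have "k = l" by (rule disj[of x]) (use g[OF kl(1)] h(1)[OF kl(2)] kl in simp_all)
    then show False using kl h(2) by simp
  qed
  \<comment> \<open>The first labels \<open>g k\<close> and the second labels \<open>h k\<close> are
    all distinct, so there are at most as many communities with two labels as communities in
    \<open>Z\<close>. Each of the latter takes up at least \<open>lo\<close> elements of
    \<open>S\<close>.\<close>
  have "card R + card R' = card (g ` R \<union> h ` R')"
    using g_inj h_inj gh R R' by (simp add: card_Un_disjoint card_image)
  also have "\<dots> \<le> card {0..<K}" using g_range h ch by (intro card_mono) (fastforce simp: T_def)+
  finally have cR': "card R' \<le> K - card R" by simp
  define Z where "Z = {0..<K} - R"
  have cZ: "card Z = K - card R" unfolding Z_def using R by (simp add: card_Diff_subset)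
  have "real (card Z) * lo \<le> (\<Sum>k\<in>Z. real (comm_size n c k))"
    using size by (intro sum_bounded_below[where K=lo, simplified]) (auto simp: Z_def)
  also have "(\<Sum>k\<in>Z. real (comm_size n c k)) = real (card (\<Union>k\<in>Z. {i. i < n \<and> c i = k}))"
    by (subst card_UN_disjoint) (auto simp: Z_def comm_size_def)
  also have "\<dots> \<le> real (card S)"
  proof -
    have "(\<Union>k\<in>Z. {i. i < n \<and> c i = k}) \<subseteq> S" by (auto simp: Z_def R_def T_def)
    then show ?thesis using fS by (simp add: card_mono)
  qed
  finally have Z: "real (card Z) \<le> real (card S) / lo" using lo by (simp add: field_simps)
  define \<pi> where "\<pi> = inv s"
  have \<pi>: "\<pi> permutes {0..<K}" unfolding \<pi>_def by (rule permutes_inv[OF s(1)])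
  have \<pi>g: "\<pi> (g k) = k" if "k \<in> R" for k
    using s(2)[OF that] permutes_inverses(2)[OF s(1), of k] by (simp add: \<pi>_def)
  \<comment> \<open>Outside \<open>S\<close> an error occurs only in a community with a second
    label, and such communities are given up entirely.\<close>
  have "{i. i < n \<and> c i \<noteq> \<pi> (ch i)} \<subseteq> S \<union> (\<Union>k\<in>R'. {i. i < n \<and> c i = k})"
  proof
    fix i assume i: "i \<in> {i. i < n \<and> c i \<noteq> \<pi> (ch i)}"
    show "i \<in> S \<union> (\<Union>k\<in>R'. {i. i < n \<and> c i = k})"
    proof (cases "i \<in> S")
      case False
      with i have iT: "i \<in> T (c i)" by (simp add: T_def)
      then have "c i \<in> R" using i c by (auto simp: R_def)
      moreover from this have "ch i \<noteq> g (c i)" using i \<pi>g by auto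
      ultimately have "c i \<in> R'" using iT by (auto simp: R'_def)
      with i show ?thesis by auto
    qed simp
  qed
  then have "card {i. i < n \<and> c i \<noteq> \<pi> (ch i)} \<le> card (S \<union> (\<Union>k\<in>R'. {i. i < n \<and> c i = k}))"
    using fS R' by (intro card_mono) auto
  also have "\<dots> \<le> card S + card (\<Union>k\<in>R'. {i. i < n \<and> c i = k})" by (rule card_Un_le)
  also have "card (\<Union>k\<in>R'. {i. i < n \<and> c i = k}) \<le> (\<Sum>k\<in>R'. comm_size n c k)"
    unfolding comm_size_def by (rule card_UN_le[OF R'(2)])
  finally have "real (card {i. i < n \<and> c i \<noteq> \<pi> (ch i)}) \<le> real (card S) + (\<Sum>k\<in>R'. real (comm_size n c k))"
    by (simp flip: of_nat_sum of_nat_add)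
  also have "(\<Sum>k\<in>R'. real (comm_size n c k)) \<le> real (card R') * hi"
    using size R R' by (intro sum_bounded_above[where K=hi, simplified]) auto
  also have "\<dots> \<le> real (card S) / lo * hi"
  proof (cases "R' = {}")
    case False
    then have "0 < K" using R R' by auto
    then have "0 \<le> hi" using size[of 0] by linarith
    moreover have "real (card R') \<le> real (card S) / lo" using cR' cZ Z by simp
    ultimately show ?thesis by (rule mult_right_mono[rotated])
  next
    case True
    have "0 \<le> hi \<or> real (card S) = 0"
    proof (cases "n = 0")
      case True
      then show ?thesis using S by simp
    next
      case False
      then have "c 0 < K" using c by simp
      then show ?thesis using size[of "c 0"] by auto
    qed
    then show ?thesis using True lo by auto
  qed
  finally have "real (card {i. i < n \<and> c i \<noteq> \<pi> (ch i)}) \<le> real (card S) * (1 + hi / lo)"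
    by (simp add: algebra_simps)
  with \<pi> show thesis by (rule that)
qed

lemma kmeans_obj_le:
  assumes "\<And>i. i < n \<Longrightarrow> c i < K"
  shows "kmeans_obj n K v c \<le> (\<Sum>i<n. \<Sum>j<n. (v i j - u (c i) j)^2)"
proof -
  have "kmeans_obj n K v c \<le> (\<Sum>k<K. \<Sum>i\<in>{i. i < n \<and> c i = k}. \<Sum>j<n. (v i j - u k j)^2)"
    unfolding kmeans_obj_def
    by (intro sum_mono cINF_lower bdd_belowI[of _ 0]) (auto intro!: sum_nonneg)
  also have "\<dots> = (\<Sum>k<K. \<Sum>i\<in>{i\<in>{..<n}. c i = k}. \<Sum>j<n. (v i j - u (c i) j)^2)"
    by (intro sum.cong) auto
  also have "\<dots> = (\<Sum>i<n. \<Sum>j<n. (v i j - u (c i) j)^2)"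
    by (rule sum.group) (use assms in auto)
  finally show ?thesis .
qed

lemma kmeans_obj_nonneg: "0 \<le> kmeans_obj n K v c"
  unfolding kmeans_obj_def by (intro sum_nonneg cINF_greatest) auto

text \<open>The infimum over centres is approached, not attained: every cluster receives the slack
  \<open>d / (K + 1)\<close>, whose denominator is positive even for \<open>K = 0\<close>.\<close>

lemma kmeans_obj_near_centers:
  assumes c: "\<And>i. i < n \<Longrightarrow> c i < K" and d: "0 < d"
  obtains \<nu> where "(\<Sum>i<n. \<Sum>j<n. (v i j - \<nu> (c i) j)^2) \<le> kmeans_obj n K v c + d"
proof -
  define f where "f k \<nu> = (\<Sum>i\<in>{i. i < n \<and> c i = k}. \<Sum>j<n. (v i j - \<nu> j)^2)" for k \<nu>
  have "\<exists>\<nu>. f k \<nu> < (INF \<nu>. f k \<nu>) + d / (real K + 1)" for k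
  proof -
    have "bdd_below (range (f k))" by (intro bdd_belowI[of _ 0]) (auto simp: f_def intro!: sum_nonneg)
    then show ?thesis
      using cINF_less_iff[of UNIV "f k" "(INF \<nu>. f k \<nu>) + d / (real K + 1)"] d by auto
  qed
  then obtain \<nu> where \<nu>: "\<And>k. f k (\<nu> k) < (INF \<nu>. f k \<nu>) + d / (real K + 1)" by metis
  have "(\<Sum>i<n. \<Sum>j<n. (v i j - \<nu> (c i) j)^2) = (\<Sum>k<K. \<Sum>i\<in>{i\<in>{..<n}. c i = k}. \<Sum>j<n. (v i j - \<nu> (c i) j)^2)"
    by (rule sum.group[symmetric]) (use c in auto)
  also have "\<dots> = (\<Sum>k<K. f k (\<nu> k))" unfolding f_def by (intro sum.cong) auto
  also have "\<dots> \<le> (\<Sum>k<K. (INF \<nu>. f k \<nu>) + d / (real K + 1))" using \<nu> by (intro sum_mono) (simp add: less_imp_le)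
  also have "\<dots> = kmeans_obj n K v c + real K * (d / (real K + 1))"
    by (simp add: kmeans_obj_def f_def sum.distrib)
  also have "real K * (d / (real K + 1)) \<le> d" using d by (simp add: field_simps)
  finally show thesis by (intro that) simp
qed

text \<open>The ideal row of a node is the indicator vector of its community. Near-optimal centres
  are close to the ideal rows on average, since the true labelling \<open>c\<close> competes with an
  objective of at most \<open>D\<close>. Nodes whose centre is far from their ideal row form
  \<open>S\<close>, which is small by Markov's inequality. Outside \<open>S\<close> the labels
  separate communities, as the indicators of different communities are far apart.\<close>

lemma kmeans_mis_loss:
  fixes c ch :: "nat \<Rightarrow> nat" and CA :: real
  assumes n: "0 < n" and K: "0 < K" and CA: "1 \<le> CA" and eps: "0 < eps"
    and c: "\<And>i. i < n \<Longrightarrow> c i < K"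
    and size: "\<And>k. k < K \<Longrightarrow> real n / (CA * real K) \<le> real (comm_size n c k)
        \<and> real (comm_size n c k) \<le> CA * real n / real K"
    and ch: "ch \<in> labelings n K"
    and opt: "kmeans_obj n K v ch \<le> (1 + eps) * (INF c'\<in>labelings n K. kmeans_obj n K v c')"
    and D: "(\<Sum>i<n. \<Sum>j<n. (v i j - of_bool (c j = c i))^2) \<le> D"
  shows "mis_loss n K c ch \<le> 8 * CA * (1 + CA^2) * real K * ((2 + eps) * D + 1) / (real n)^2"
proof -
  let ?u = "\<lambda>k j. of_bool (c j = k) :: real"
  have "kmeans_obj n K v c \<le> D" using kmeans_obj_le[of n c K v ?u] c D by auto
  moreover have "(INF c'\<in>labelings n K. kmeans_obj n K v c') \<le> kmeans_obj n K v c"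
    using c by (intro cINF_lower bdd_belowI[of _ 0]) (auto simp: labelings_def kmeans_obj_nonneg)
  ultimately have "(INF c'\<in>labelings n K. kmeans_obj n K v c') \<le> D" by linarith
  then have obj: "kmeans_obj n K v ch \<le> (1 + eps) * D"
    using opt eps by (smt (verit) mult_left_mono)
  have ch': "ch i < K" if "i < n" for i using ch that by (simp add: labelings_def)
  obtain \<nu> where \<nu>: "(\<Sum>i<n. \<Sum>j<n. (v i j - \<nu> (ch i) j)^2) \<le> kmeans_obj n K v ch + 1"
    by (rule kmeans_obj_near_centers[of n ch K 1 v]) (use ch' in auto)
  define dist where "dist i = (\<Sum>j<n. (\<nu> (ch i) j - ?u (c i) j)^2)" for i
  define F where "F = 2 * ((2 + eps) * D + 1)"
  have "(\<Sum>i<n. dist i) \<le> (\<Sum>i<n. \<Sum>j<n. 2 * (v i j - \<nu> (ch i) j)^2 + 2 * (v i j - ?u (c i) j)^2)"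
    unfolding dist_def
    by (intro sum_mono square_diff_le)
  also have "\<dots> = 2 * (\<Sum>i<n. \<Sum>j<n. (v i j - \<nu> (ch i) j)^2) + 2 * (\<Sum>i<n. \<Sum>j<n. (v i j - ?u (c i) j)^2)"
    by (simp only: sum.distrib sum_distrib_left)
  also have "\<dots> \<le> 2 * ((1 + eps) * D + 1) + 2 * D"
    using \<nu> obj D by (intro add_mono mult_left_mono) auto
  finally have sum_dist: "(\<Sum>i<n. dist i) \<le> F" by (simp add: F_def algebra_simps)
  \<comment> \<open>\<open>4 * thr\<close> is the guaranteed community size: if two nodes of
    different communities outside \<open>S\<close> shared a centre, the squared distance of their
    indicators would be less than \<open>4 * thr\<close>, although it is the sum of both
    sizes.\<close>
  define thr where "thr = real n / (4 * CA * real K)"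
  have thr: "0 < thr" using n K CA by (simp add: thr_def)
  define S where "S = {i\<in>{..<n}. thr \<le> dist i}"
  have dist_nonneg: "0 \<le> dist i" for i by (simp add: dist_def sum_nonneg)
  have "real (card S) * thr \<le> (\<Sum>i\<in>S. dist i)"
    by (rule sum_bounded_below) (simp add: S_def)
  also have "\<dots> \<le> (\<Sum>i<n. dist i)" by (rule sum_mono2) (auto simp: S_def dist_nonneg)
  finally have cS: "real (card S) \<le> F / thr" using sum_dist thr by (simp add: field_simps)
  have sep: "ch i \<noteq> ch j" if ij: "i < n" "j < n" "i \<notin> S" "j \<notin> S" "c i \<noteq> c j" for i j
  proof
    assume eq: "ch i = ch j"
    have "real (comm_size n c (c i)) + real (comm_size n c (c j)) = (\<Sum>l<n. (?u (c i) l - ?u (c j) l)^2)"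
    proof -
      have "(\<Sum>l<n. (?u (c i) l - ?u (c j) l)^2) = (\<Sum>l<n. of_bool (c l = c i) + of_bool (c l = c j))"
        using ij(5) by (intro sum.cong refl) auto
      then show ?thesis by (simp add: comm_size_def sum.distrib of_bool_def sum.If_cases Int_def)
    qed
    also have "\<dots> \<le> (\<Sum>l<n. 2 * (\<nu> (ch i) l - ?u (c i) l)^2 + 2 * (\<nu> (ch i) l - ?u (c j) l)^2)"
      by (intro sum_mono square_diff_le)
    also have "\<dots> = 2 * dist i + 2 * dist j"
      unfolding dist_def eq by (simp only: sum.distrib sum_distrib_left)
    also have "\<dots> < 2 * thr + 2 * thr" using ij by (auto simp: S_def)
    also have "\<dots> = real n / (CA * real K)" by (simp add: thr_def field_simps)
    also have "\<dots> \<le> real (comm_size n c (c i))" using size c ij by blast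
    finally show False by simp
  qed
  have SS: "S \<subseteq> {..<n}" by (auto simp: S_def)
  have lo: "0 < real n / (CA * real K)" using n K CA by simp
  obtain \<pi> where \<pi>: "\<pi> permutes {0..<K}" "real (card {i. i < n \<and> c i \<noteq> \<pi> (ch i)})
      \<le> real (card S) * (1 + (CA * real n / real K) / (real n / (CA * real K)))"
    by (rule separated_labels_permutation[OF c ch' SS sep size lo])
  have "(CA * real n / real K) / (real n / (CA * real K)) = CA^2"
    using n K CA by (simp add: field_simps power2_eq_square)
  with \<pi>(2) have "real (card {i. i < n \<and> c i \<noteq> \<pi> (ch i)}) \<le> real (card S) * (1 + CA^2)" by simp
  also have "\<dots> \<le> F / thr * (1 + CA^2)" using cS by (intro mult_right_mono) auto
  finally have "mis_loss n K c ch \<le> F / thr * (1 + CA^2) / real n"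
    using mis_loss_le[OF \<pi>(1), of n c ch] n by (meson divide_right_mono of_nat_0_le_iff order_trans)
  also have "\<dots> = 8 * CA * (1 + CA^2) * real K * ((2 + eps) * D + 1) / (real n)^2"
    using n K CA by (simp add: F_def thr_def field_simps power2_eq_square)
  finally show ?thesis .
qed

section \<open>Recovery from the thresholded cosines\<close>

lemma cosv_eq: "cosv m x y = dot m x y / (vnorm m x * vnorm m y)"
  by (simp add: cosv_def L2_set_def)

text \<open>Errors are relative to the row lengths, in units of \<open>h = phi / 32\<close>. The
  product of the two lengths changes to between \<open>1 / 4\<close> and \<open>7 / 4\<close> of its
  value. An orthogonal pair thus gets a cosine below \<open>4 * h * 4 = phi / 2\<close>, and a
  cosine of at least \<open>32 * h\<close> stays at least
  \<open>28 * h * 4 / 7 = phi / 2\<close>.\<close>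

lemma row_tau_threshold:
  fixes phi :: real
  defines "h \<equiv> phi / 32"
  assumes phi: "0 < phi" "phi \<le> 1" and r: "0 < vnorm m (X i)" "0 < vnorm m (X j)"
    and norm_i: "(1 - 2 * h) * vnorm m (X i) \<le> vnorm m (Xh i)" "vnorm m (Xh i) \<le> (1 + 2 * h) * vnorm m (X i)"
    and norm_j: "(1 - 2 * h) * vnorm m (X j) \<le> vnorm m (Xh j)" "vnorm m (Xh j) \<le> (1 + 2 * h) * vnorm m (X j)"
    and dots: "\<bar>dot m (Xh i) (Xh j) - dot m (X i) (X j)\<bar> \<le> 4 * h * (vnorm m (X i) * vnorm m (X j))"
  shows "dot m (X i) (X j) = 0 \<Longrightarrow> row_tau m Xh i j < phi / 2"
    and "phi \<le> row_tau m X i j \<Longrightarrow> phi / 2 \<le> row_tau m Xh i j"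
proof -
  define rr where "rr = vnorm m (X i) * vnorm m (X j)"
  define N where "N = vnorm m (Xh i) * vnorm m (Xh j)"
  have rr: "0 < rr" using r by (simp add: rr_def)
  have h: "0 < h" "h \<le> 1 / 32" "phi = 32 * h" using phi by (simp_all add: h_def)
  have N_ge: "(1 - 2 * h)^2 * rr \<le> N"
  proof -
    have "((1 - 2 * h) * vnorm m (X i)) * ((1 - 2 * h) * vnorm m (X j)) \<le> N"
      unfolding N_def using h by (intro mult_mono norm_i norm_j) auto
    then show ?thesis by (simp add: rr_def power2_eq_square mult_ac)
  qed
  have N_le: "N \<le> (1 + 2 * h)^2 * rr"
  proof -
    have "N \<le> ((1 + 2 * h) * vnorm m (X i)) * ((1 + 2 * h) * vnorm m (X j))"
      unfolding N_def using h by (intro mult_mono norm_i norm_j) auto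
    then show ?thesis by (simp add: rr_def power2_eq_square mult_ac)
  qed
  have "(15 / 16)^2 \<le> (1 - 2 * h)^2" using h by (intro power_mono) auto
  moreover have "1 / 4 < (15 / 16 :: real)^2" by (simp add: power2_eq_square)
  ultimately have "1 / 4 < (1 - 2 * h)^2" by linarith
  then have "1 / 4 * rr < (1 - 2 * h)^2 * rr" using rr by (rule mult_strict_right_mono)
  with N_ge have N1: "rr / 4 < N" by simp
  have "(1 + 2 * h)^2 \<le> (17 / 16)^2" using h by (intro power_mono) auto
  moreover have "(17 / 16 :: real)^2 \<le> 7 / 4" by (simp add: power2_eq_square)
  ultimately have "(1 + 2 * h)^2 \<le> 7 / 4" by linarith
  then have "(1 + 2 * h)^2 * rr \<le> 7 / 4 * rr" using rr by (intro mult_right_mono) auto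
  with N_le have N2: "N \<le> 7 / 4 * rr" by simp
  have N: "0 < N" using N1 rr by simp
  have tau: "row_tau m Xh i j = \<bar>dot m (Xh i) (Xh j)\<bar> / N"
    using N by (simp add: row_tau_def cosv_eq abs_divide flip: N_def)
  {
    assume "dot m (X i) (X j) = 0"
    with dots have "\<bar>dot m (Xh i) (Xh j)\<bar> \<le> 4 * h * rr" by (simp add: rr_def)
    also have "\<dots> < 16 * h * N" using N1 h by simp
    finally show "row_tau m Xh i j < phi / 2" unfolding tau using N h by (simp add: divide_less_eq)
  }
  {
    assume "phi \<le> row_tau m X i j"
    then have "32 * h * rr \<le> \<bar>dot m (X i) (X j)\<bar>"
      using rr h by (simp add: row_tau_def cosv_eq abs_divide le_divide_eq flip: rr_def)
    with dots have "28 * h * rr \<le> \<bar>dot m (Xh i) (Xh j)\<bar>" unfolding rr_def by linarith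
    moreover have "16 * h * N \<le> 28 * h * rr" using N2 h by simp
    ultimately have "16 * h * N \<le> \<bar>dot m (Xh i) (Xh j)\<bar>" by (rule order.trans[rotated])
    then show "phi / 2 \<le> row_tau m Xh i j" unfolding tau using N h by (simp add: le_divide_eq)
  }
qed

text \<open>\<open>Xh\<close> is the sum of a matrix whose rows have nearly the Gram matrix of
  \<open>X\<close> and of \<open>Y\<close>, whose rows are short. The case \<open>k = l\<close> of
  the Gram hypothesis controls lengths, the mixed case inner products. The errors add up to
  \<open>3 * h + 3 * h^2\<close>, and the square is absorbed since
  \<open>h \<le> 1 / 32\<close>.\<close>

lemma perturbed_rows:
  fixes phi :: real
  defines "h \<equiv> phi / 32"
  assumes h: "0 \<le> h" "h \<le> 1 / 32" and eps: "0 \<le> eps" "eps \<le> h"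
    and Y: "\<And>k. k = i \<or> k = j \<Longrightarrow> vnorm m (Y k) \<le> h * vnorm m (X k)"
    and Z: "\<And>k l. k = i \<or> k = j \<Longrightarrow> l = i \<or> l = j \<Longrightarrow>
      \<bar>dot m (\<lambda>b. Xh k b - Y k b) (\<lambda>b. Xh l b - Y l b) - dot m (X k) (X l)\<bar> \<le> eps * (vnorm m (X k) * vnorm m (X l))"
  shows "\<And>k. k = i \<or> k = j \<Longrightarrow> (1 - 2 * h) * vnorm m (X k) \<le> vnorm m (Xh k) \<and> vnorm m (Xh k) \<le> (1 + 2 * h) * vnorm m (X k)"
    and "\<bar>dot m (Xh i) (Xh j) - dot m (X i) (X j)\<bar> \<le> 4 * h * (vnorm m (X i) * vnorm m (X j))"
proof -
  define Zv where "Zv k b = Xh k b - Y k b" for k b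
  have Zn: "(1 - h) * vnorm m (X k) \<le> vnorm m (Zv k)" "vnorm m (Zv k) \<le> (1 + h) * vnorm m (X k)"
    if k: "k = i \<or> k = j" for k
  proof -
    have *: "\<bar>(vnorm m (Zv k))^2 - (vnorm m (X k))^2\<bar> \<le> eps * (vnorm m (X k))^2"
      using Z[OF k k] unfolding vnorm_power2_dot Zv_def by (simp add: vnorm_power2_dot[symmetric] power2_eq_square)
    have "eps * (vnorm m (X k))^2 \<le> h * (vnorm m (X k))^2" using eps by (intro mult_right_mono) auto
    with * have "(1 - h) * (vnorm m (X k))^2 \<le> (vnorm m (Zv k))^2" "(vnorm m (Zv k))^2 \<le> (1 + h) * (vnorm m (X k))^2"
      by (auto simp: algebra_simps abs_le_iff)
    moreover have "(1 - h)^2 \<le> 1 - h" "1 + h \<le> (1 + h)^2" using h by (auto simp: power2_eq_square algebra_simps mult_left_le)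
    then have "((1 - h) * vnorm m (X k))^2 \<le> (1 - h) * (vnorm m (X k))^2" "(1 + h) * (vnorm m (X k))^2 \<le> ((1 + h) * vnorm m (X k))^2"
      unfolding power_mult_distrib by (auto intro: mult_right_mono)
    ultimately have "((1 - h) * vnorm m (X k))^2 \<le> (vnorm m (Zv k))^2" "(vnorm m (Zv k))^2 \<le> ((1 + h) * vnorm m (X k))^2"
      by linarith+
    then show "(1 - h) * vnorm m (X k) \<le> vnorm m (Zv k)" "vnorm m (Zv k) \<le> (1 + h) * vnorm m (X k)"
      using h by (auto intro: power2_le_imp_le)
  qed
  show "(1 - 2 * h) * vnorm m (X k) \<le> vnorm m (Xh k) \<and> vnorm m (Xh k) \<le> (1 + 2 * h) * vnorm m (X k)"
    if k: "k = i \<or> k = j" for k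
  proof -
    have "vnorm m (Zv k) \<le> vnorm m (Xh k) + vnorm m (Y k)" unfolding Zv_def by (rule vnorm_diff_le)
    moreover have "vnorm m (Xh k) - vnorm m (Y k) \<le> vnorm m (Zv k)" unfolding Zv_def by (rule vnorm_diff_ge)
    ultimately show ?thesis using Zn[OF k] Y[OF k] by (simp add: algebra_simps)
  qed
  define R where "R = vnorm m (X i) * vnorm m (X j)"
  have R: "0 \<le> R" by (simp add: R_def)
  have "dot m (Xh i) (Xh j) = dot m (Zv i) (Zv j) + dot m (Zv i) (Y j) + dot m (Y i) (Zv j) + dot m (Y i) (Y j)"
    by (simp add: Zv_def sum.distrib[symmetric] algebra_simps)
  moreover have "\<bar>dot m (Zv i) (Zv j) - dot m (X i) (X j)\<bar> \<le> h * R"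
    using Z[of i j] eps R mult_right_mono[of eps h R] unfolding Zv_def R_def by simp
  moreover have "\<bar>dot m (Zv i) (Y j)\<bar> \<le> (1 + h) * h * R"
  proof -
    have "\<bar>dot m (Zv i) (Y j)\<bar> \<le> vnorm m (Zv i) * vnorm m (Y j)" by (rule abs_dot_le)
    also have "\<dots> \<le> ((1 + h) * vnorm m (X i)) * (h * vnorm m (X j))" using h by (intro mult_mono Zn Y) auto
    finally show ?thesis by (simp add: R_def mult_ac)
  qed
  moreover have "\<bar>dot m (Y i) (Zv j)\<bar> \<le> (1 + h) * h * R"
  proof -
    have "\<bar>dot m (Y i) (Zv j)\<bar> \<le> vnorm m (Y i) * vnorm m (Zv j)" by (rule abs_dot_le)
    also have "\<dots> \<le> (h * vnorm m (X i)) * ((1 + h) * vnorm m (X j))" using h by (intro mult_mono Zn Y) auto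
    finally show ?thesis by (simp add: R_def mult_ac)
  qed
  moreover have "\<bar>dot m (Y i) (Y j)\<bar> \<le> h * h * R"
  proof -
    have "\<bar>dot m (Y i) (Y j)\<bar> \<le> vnorm m (Y i) * vnorm m (Y j)" by (rule abs_dot_le)
    also have "\<dots> \<le> (h * vnorm m (X i)) * (h * vnorm m (X j))" using h by (intro mult_mono Y) auto
    finally show ?thesis by (simp add: R_def mult_ac)
  qed
  ultimately have "\<bar>dot m (Xh i) (Xh j) - dot m (X i) (X j)\<bar> \<le> h * R + (1 + h) * h * R + (1 + h) * h * R + h * h * R"
    by linarith
  also have "\<dots> = (3 * h + 3 * (h * h)) * R" by (simp add: algebra_simps)
  also have "\<dots> \<le> 4 * h * R"
  proof (rule mult_right_mono[OF _ R])
    have "h * h \<le> h * (1 / 32)" using h by (intro mult_left_mono) auto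
    then show "3 * h + 3 * (h * h) \<le> 4 * h" using h by linarith
  qed
  finally show "\<bar>dot m (Xh i) (Xh j) - dot m (X i) (X j)\<bar> \<le> 4 * h * (vnorm m (X i) * vnorm m (X j))"
    by (simp add: R_def)
qed

lemma card_exceeding_le:
  fixes y :: "nat \<Rightarrow> real"
  assumes "0 < t"
  shows "real (card {i. i < n \<and> t < y i}) * t^2 \<le> (\<Sum>i<n. (y i)^2)"
proof -
  have "real (card {i. i < n \<and> t < y i}) * t^2 \<le> (\<Sum>i\<in>{i. i < n \<and> t < y i}. (y i)^2)"
    using assms by (intro sum_bounded_below power_mono) auto
  also have "\<dots> \<le> (\<Sum>i<n. (y i)^2)" by (intro sum_mono2) auto
  finally show ?thesis .
qed

lemma sum_sq_diff_of_bool: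
  fixes n :: nat
  shows "(\<Sum>j<n. ((if P j then 1 else 0) - of_bool (Q j) :: real)^2) = real (card {j. j < n \<and> P j \<noteq> Q j})"
proof -
  have "(\<Sum>j<n. ((if P j then 1 else 0) - of_bool (Q j) :: real)^2) = (\<Sum>j<n. of_bool (P j \<noteq> Q j))"
    by (intro sum.cong refl) auto
  also have "\<dots> = real (card ({..<n} \<inter> {j. P j \<noteq> Q j}))"
    unfolding of_bool_def by (subst sum.If_cases) simp_all
  also have "{..<n} \<inter> {j. P j \<noteq> Q j} = {j. j < n \<and> P j \<noteq> Q j}" by auto
  finally show ?thesis .
qed

section \<open>Deterministic recovery for a fixed number of nodes\<close>

context
  fixes n K :: nat and c :: "nat \<Rightarrow> nat" and L X :: rmat and P :: "nat \<Rightarrow> rmat"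
    and mu :: "nat \<Rightarrow> real" and CA cA4 phi1 phi2 eta0 eta1 eta2 :: real and Hs Is :: "nat set"
  defines "Hs \<equiv> {i. i < n \<and> real (card {j. j < n \<and> c j = c i \<and> row_tau (K^2) X i j \<ge> phi1})
                              \<ge> real (comm_size n c (c i)) * (1 - eta0)}"
    and "Is \<equiv> {i. i < n \<and> sqrt (D_form K (P (c i)) (L i) (L i)) \<ge> phi2}"
  assumes n: "0 < n" and K: "0 < K" and CA: "1 \<le> CA" and cA4: "0 < cA4"
    and c: "\<And>i. i < n \<Longrightarrow> c i < K"
    and dec: "nonzero_eigdecomp n (K^2) (pabm_theta c L) X mu"
    and inv: "\<And>k. k < K \<Longrightarrow> is_inverse_mat K (comm_gram n c L k) (P k)"
    and size: "\<And>k. k < K \<Longrightarrow> real n / (CA * real K) \<le> real (comm_size n c k)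
        \<and> real (comm_size n c k) \<le> CA * real n / real K"
    and D_le: "\<And>i. i < n \<Longrightarrow> D_form K (P (c i)) (L i) (L i) \<le> cA4 * (real K)^2 / real n"
    and phi1: "0 < phi1" "phi1 \<le> 1" and phi2: "0 < phi2"
    and H: "real (card ({0..<n} - Hs)) \<le> eta1 * real n"
    and I: "real (card Is) > real n * (1 - eta2)"
    and etas: "eta0 \<le> 1 / 4" "eta2 * (4 * CA * real K) \<le> 1" "eta1 + eta2 \<le> 1"
begin

private abbreviation (input) "m \<equiv> K^2"

lemma D_form_eq_vnorm: "i < n \<Longrightarrow> D_form K (P (c i)) (L i) (L i) = (vnorm m (X i))^2"
  using eigvec_rows_dot[OF c inv dec, of i i] by (simp add: vnorm_power2_dot)

lemma eigvec_rows_orthogonal: "i < n \<Longrightarrow> j < n \<Longrightarrow> c i \<noteq> c j \<Longrightarrow> dot m (X i) (X j) = 0"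
  using eigvec_rows_dot[OF c inv dec, of i j] by simp

lemma row_vnorm_le: "i < n \<Longrightarrow> vnorm m (X i) \<le> sqrt cA4 * real K / sqrt (real n)"
  by (rule eigvec_row_vnorm_le[OF c inv dec D_le cA4])

lemma Is_vnorm: "i \<in> Is \<longleftrightarrow> i < n \<and> phi2 \<le> vnorm m (X i)"
  by (auto simp: Is_def D_form_eq_vnorm)

lemma Is_finite: "finite Is" "Is \<subseteq> {..<n}" "real (card ({..<n} - Is)) \<le> eta2 * real n"
proof -
  show *: "Is \<subseteq> {..<n}" by (auto simp: Is_def)
  then show "finite Is" by (rule finite_subset) simp
  then have "card ({..<n} - Is) = n - card Is" using * by (simp add: card_Diff_subset)
  moreover have "card Is \<le> n" using card_mono[OF _ *] by simp
  ultimately show "real (card ({..<n} - Is)) \<le> eta2 * real n" using I by (simp add: of_nat_diff algebra_simps)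
qed

lemma Hs_finite: "finite Hs" "Hs \<subseteq> {..<n}" "real (card ({..<n} - Hs)) \<le> eta1 * real n"
proof -
  show *: "Hs \<subseteq> {..<n}" by (auto simp: Hs_def)
  then show "finite Hs" by (rule finite_subset) simp
  show "real (card ({..<n} - Hs)) \<le> eta1 * real n" using H by (simp add: lessThan_atLeast0)
qed

lemma Hs_Is_nonempty: "Hs \<inter> Is \<noteq> {}"
proof
  assume "Hs \<inter> Is = {}"
  then have "Is \<subseteq> {..<n} - Hs" using Is_finite by auto
  then have "card Is \<le> card ({..<n} - Hs)" by (intro card_mono) auto
  then have "real n * (1 - eta2) < eta1 * real n" using I Hs_finite(3) by linarith
  then have "real n * (1 - (eta1 + eta2)) < 0" by (simp add: algebra_simps)
  then show False using etas(3) n by (simp add: mult_less_0_iff)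
qed

text \<open>An element of \<open>Is\<close> has a row of length at least \<open>phi2\<close>, and
  all rows are short by \<open>D_le\<close>. Unlike \<open>phi_le\<close>, this bounds
  \<open>phi2\<close> alone and so keeps the factor \<open>phi1\<close> when \<open>e\<close> is
  compared with \<open>sg\<close>.\<close>

lemma phi2_le: "phi2 \<le> sqrt cA4 * real K / sqrt (real n)"
proof -
  obtain i where "i \<in> Is" using Hs_Is_nonempty by auto
  then show ?thesis using row_vnorm_le[of i] by (auto simp: Is_vnorm)
qed

text \<open>The row \<open>i\<close> of the projection \<open>X X\<^sup>T\<close> has squared norm equal to its diagonal entry, and
  most of its entries in the community of \<open>i\<close> are not small.\<close>

lemma phi_le: "(phi1 * phi2)^2 \<le> 2 * CA * real K / real n"
proof -
  obtain i where i: "i \<in> Hs" "i \<in> Is" using Hs_Is_nonempty by auto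
  then have "i < n" by (simp add: Hs_def)
  define r where "r = vnorm m (X i)"
  have r: "phi2 \<le> r" "0 < r" using i phi2 by (auto simp: Is_vnorm r_def)
  define G where "G = {j. j < n \<and> c j = c i \<and> row_tau m X i j \<ge> phi1}"
  \<comment> \<open>Of the guaranteed community size \<open>n / (CA * K)\<close>, the bound on
    \<open>eta0\<close> leaves three quarters, and the bound on \<open>eta2\<close> removes at most
    one further quarter.\<close>
  have "real n / (CA * real K) * (1 - 1 / 4) \<le> real (comm_size n c (c i)) * (1 - eta0)"
    using size[OF c[OF \<open>i < n\<close>]] etas(1) n CA K by (intro mult_mono) auto
  also have "\<dots> \<le> real (card G)" using i(1) by (simp add: Hs_def G_def)
  also have "\<dots> \<le> real (card (G \<inter> Is)) + real (card ({..<n} - Is))"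
  proof -
    have "G \<subseteq> (G \<inter> Is) \<union> ({..<n} - Is)" by (auto simp: G_def)
    then have "card G \<le> card ((G \<inter> Is) \<union> ({..<n} - Is))" using Is_finite by (intro card_mono) auto
    also have "\<dots> \<le> card (G \<inter> Is) + card ({..<n} - Is)" by (rule card_Un_le)
    finally show ?thesis by simp
  qed
  also have "real (card ({..<n} - Is)) \<le> real n / (4 * CA * real K)"
  proof -
    have "eta2 \<le> 1 / (4 * CA * real K)" using etas(2) CA K by (simp add: field_simps)
    then have "eta2 * real n \<le> 1 / (4 * CA * real K) * real n" by (intro mult_right_mono) auto
    then show ?thesis using Is_finite(3) by simp
  qed
  finally have card_GI: "real n / (2 * CA * real K) \<le> real (card (G \<inter> Is))" using CA K by (simp add: field_simps)
  have on: "orthonormal_cols n m X" using dec by (simp add: nonzero_eigdecomp_def)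
  have "real (card (G \<inter> Is)) * (phi1 * phi2 * r)^2 \<le> (\<Sum>j\<in>G \<inter> Is. (dot m (X i) (X j))^2)"
  proof (rule sum_bounded_below)
    fix j assume j: "j \<in> G \<inter> Is"
    then have rj: "phi2 \<le> vnorm m (X j)" by (simp add: Is_vnorm)
    have "phi1 \<le> \<bar>dot m (X i) (X j)\<bar> / (r * vnorm m (X j))"
      using j by (simp add: G_def row_tau_def cosv_eq abs_divide r_def)
    then have "phi1 * (r * vnorm m (X j)) \<le> \<bar>dot m (X i) (X j)\<bar>"
      using r rj phi2 by (subst (asm) le_divide_eq) (auto split: if_splits)
    moreover have "phi1 * (r * phi2) \<le> phi1 * (r * vnorm m (X j))"
      using phi1 r rj by (intro mult_left_mono) auto
    ultimately have "phi1 * phi2 * r \<le> \<bar>dot m (X i) (X j)\<bar>" by (simp add: mult_ac)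
    then have "(phi1 * phi2 * r)^2 \<le> \<bar>dot m (X i) (X j)\<bar>^2" using phi1 phi2 r by (intro power_mono) auto
    then show "(phi1 * phi2 * r)^2 \<le> (dot m (X i) (X j))^2" by simp
  qed
  also have "\<dots> \<le> (\<Sum>j<n. (dot m (X i) (X j))^2)" by (intro sum_mono2) (auto simp: G_def)
  also have "\<dots> = (vnorm n (\<lambda>j. \<Sum>a<m. X i a * X j a))^2" by (simp only: L2_set_power2)
  also have "\<dots> = r^2" unfolding r_def orthonormal_cols_vnorm[OF on] ..
  finally have "real (card (G \<inter> Is)) * (phi1 * phi2)^2 * r^2 \<le> 1 * r^2" by (simp add: power_mult_distrib mult_ac)
  then have "real (card (G \<inter> Is)) * (phi1 * phi2)^2 \<le> 1" using r by (subst (asm) mult_le_cancel_right) auto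
  moreover have "real n / (2 * CA * real K) * (phi1 * phi2)^2 \<le> real (card (G \<inter> Is)) * (phi1 * phi2)^2"
    by (intro mult_right_mono card_GI) simp
  ultimately have "real n / (2 * CA * real K) * (phi1 * phi2)^2 \<le> 1" by linarith
  then show ?thesis using n CA K by (simp add: field_simps)
qed

context
  fixes A Xh :: rmat and nu :: "nat \<Rightarrow> real" and sg rho l C2 :: real
  assumes top: "top_eigvecs n m A Xh nu" and A_sym: "\<And>i j. A i j = A j i"
    and sg: "\<And>a. a < m \<Longrightarrow> sg \<le> \<bar>mu a\<bar>" "0 < sg"
    and rho: "0 < rho" and l: "1 \<le> l"
    and C2: "1 \<le> C2" "896 * sqrt cA4 \<le> C2" "128 * (18 + 15 * sqrt cA4) \<le> C2"
    and phi_ge: "C2 * rho * real K * sqrt l / sg \<le> phi1 * phi2"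
    and E_norm: "\<And>x. vnorm n (mvec n (\<lambda>i j. A i j - pabm_theta c L i j) x) \<le> 14 * rho * sqrt (real n * l) * vnorm n x"
    and E_rows: "\<And>i. i < n \<Longrightarrow> vnorm m (\<lambda>a. mvec n (\<lambda>i j. A i j - pabm_theta c L i j) (col X a) i)
        \<le> (18 + sqrt cA4) * rho * real K * sqrt l"
    and E_frob: "(\<Sum>i<n. (vnorm m (\<lambda>a. mvec n (\<lambda>i j. A i j - pabm_theta c L i j) (col X a) i))^2)
        \<le> 74 * real n * rho^2 * (real K)^2"
begin

private abbreviation (input) "Err \<equiv> \<lambda>i j. A i j - pabm_theta c L i j"
private abbreviation (input) "e \<equiv> 14 * rho * sqrt (real n * l)"
private abbreviation (input) "Y \<equiv> \<lambda>i b. Xh i b - (\<Sum>a<m. dot n (col Xh b) (col X a) * X i a)"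

private lemma e_nonneg: "0 \<le> e" using rho l by simp

text \<open>\<open>896 = 14 * 64\<close>. The ratio \<open>e / sg\<close> has to be small in
  proportion to \<open>phi1\<close>, since cosines of size \<open>phi1\<close> must survive the
  perturbation.\<close>

private lemma e_le: "e \<le> phi1 / 64 * sg"
proof -
  have "C2 * rho * real K * sqrt l / sg \<le> phi1 * (sqrt cA4 * real K / sqrt (real n))"
    using phi_ge phi2_le phi1 by (smt (verit) mult_left_mono)
  then have "C2 * rho * real K * sqrt l * sqrt (real n) \<le> phi1 * sqrt cA4 * real K * sg"
    using sg n by (simp add: field_simps)
  then have *: "C2 * (rho * (sqrt l * sqrt (real n))) \<le> phi1 * sqrt cA4 * sg"
    using K by (simp add: field_simps)
  have "896 * sqrt cA4 * (rho * (sqrt l * sqrt (real n))) \<le> C2 * (rho * (sqrt l * sqrt (real n)))"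
    using C2 rho l by (intro mult_right_mono) auto
  with * have "sqrt cA4 * (896 * (rho * (sqrt l * sqrt (real n)))) \<le> sqrt cA4 * (phi1 * sg)" by (simp add: mult_ac)
  then have "896 * (rho * (sqrt l * sqrt (real n))) \<le> phi1 * sg"
    using cA4 by (subst (asm) mult_le_cancel_left_pos) auto
  then show ?thesis by (simp add: real_sqrt_mult mult_ac)
qed

private lemma e4: "4 * e \<le> sg"
proof -
  have "phi1 / 64 * sg \<le> 1 / 4 * sg" using phi1 sg by (intro mult_right_mono) auto
  then show ?thesis using e_le by simp
qed

private lemma eps_le: "0 \<le> (2 * e / sg)^2" "(2 * e / sg)^2 \<le> phi1 / 32"
proof -
  have "2 * e / sg \<le> phi1 / 32" using e_le sg by (simp add: field_simps)
  then have "(2 * e / sg)^2 \<le> (phi1 / 32)^2" using e_nonneg sg by (intro power_mono) auto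
  also have "\<dots> \<le> phi1 / 32 * 1" using phi1 by (simp add: power2_eq_square)
  finally show "(2 * e / sg)^2 \<le> phi1 / 32" by simp
qed simp

text \<open>Rows whose term \<open>E_i Y\<close> cannot be absorbed. After multiplication by
  \<open>2 / sg\<close> in \<open>proj_error_row_bound\<close> the threshold becomes
  \<open>phi1 * phi2 / 64\<close>, half of what \<open>proj_error_le\<close> permits.\<close>

definition "second_order_bad = {i. i < n \<and> sg * (phi1 * phi2) / 128 < vnorm m (\<lambda>b. mvec n Err (\<lambda>j. Y j b) i)}"

text \<open>The constant is \<open>128^2 * 4 * 74 * 14^2 * 2\<close>; the gain of a factor \<open>K\<close> over a plain
  Davis--Kahan bound comes from \<open>phi_le\<close>.\<close>

lemma card_second_order_bad:
  "real (card second_order_bad) \<le> 1901068288 * CA * real n / (real K * l)"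
proof -
  define phi where "phi = phi1 * phi2"
  have phi: "0 < phi" using phi1 phi2 by (simp add: phi_def)
  have sgphi: "C2 * rho * real K * sqrt l \<le> sg * phi"
    using phi_ge sg by (simp add: phi_def field_simps)
  have "real (card second_order_bad) * (sg * phi / 128)^2 \<le> (\<Sum>i<n. (vnorm m (\<lambda>b. mvec n Err (\<lambda>j. Y j b) i))^2)"
    unfolding second_order_bad_def phi_def[symmetric] using sg phi by (intro card_exceeding_le) simp
  also have "\<dots> \<le> (2 * e / sg)^2 * (\<Sum>i<n. (vnorm m (\<lambda>a. mvec n Err (col X a) i))^2)"
    by (rule E_proj_error_frobenius[OF dec top A_sym sg(1) E_norm e_nonneg e4 sg(2)])
  also have "\<dots> \<le> (2 * e / sg)^2 * (74 * real n * rho^2 * (real K)^2)"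
    by (intro mult_left_mono E_frob) simp
  finally have "real (card second_order_bad) * (sg * phi)^2 * sg^2
      \<le> 16384 * 4 * 74 * e^2 * (real n * rho^2 * (real K)^2)"
    using sg by (simp add: power_mult_distrib power_divide field_simps)
  also have "e^2 = 196 * rho^2 * (real n * l)" using l by (simp add: power_mult_distrib)
  finally have 1: "real (card second_order_bad) * (sg * phi)^2 * sg^2
      \<le> 950534144 * (rho^2 * (real n * l)) * (real n * rho^2 * (real K)^2)" by (simp add: mult_ac)
  have C2': "rho * real K * sqrt l \<le> sg * phi"
  proof -
    have "1 * (rho * real K * sqrt l) \<le> C2 * (rho * real K * sqrt l)"
      using C2 rho l by (intro mult_right_mono) auto
    then show ?thesis using sgphi by (simp add: mult_ac)
  qed
  then have "(rho * real K * sqrt l)^2 \<le> (sg * phi)^2" using rho l by (intro power_mono) auto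
  then have 2: "rho^2 * (real K)^2 * l \<le> (sg * phi)^2" using l by (simp add: power_mult_distrib)
  have "rho^2 * (real K)^2 * l \<le> sg^2 * (2 * CA * real K / real n)"
  proof -
    have "sg^2 * phi^2 \<le> sg^2 * (2 * CA * real K / real n)" unfolding phi_def by (intro mult_left_mono phi_le) simp
    then show ?thesis using 2 by (simp add: power_mult_distrib)
  qed
  then have 3: "rho^2 * real K * l * real n \<le> sg^2 * (2 * CA)"
    using n K by (simp add: field_simps power2_eq_square)
  define N where "N = real (card second_order_bad)"
  \<comment> \<open>The lower bound on \<open>sg * phi\<close> enters twice: directly, as fact
    \<open>2\<close>, for the threshold defining the bad rows, and through \<open>phi_le\<close>, as
    fact \<open>3\<close>, for the remaining \<open>sg^2\<close>.\<close>
  have "N * (rho^2 * (real K)^2 * l) * (rho^2 * real K * l * real n) \<le> N * (sg * phi)^2 * (sg^2 * (2 * CA))"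
    by (rule mult_mono[OF mult_left_mono[OF 2] 3]) (use rho l in \<open>auto simp: N_def\<close>)
  also have "\<dots> = (N * (sg * phi)^2 * sg^2) * (2 * CA)" by (simp only: mult.assoc)
  also have "\<dots> \<le> 950534144 * (rho^2 * (real n * l)) * (real n * rho^2 * (real K)^2) * (2 * CA)"
    using 1 CA unfolding N_def by (intro mult_right_mono) auto
  finally have "(rho^2 * rho^2 * (real K)^2 * l * real n) * (N * (real K * l))
      \<le> (rho^2 * rho^2 * (real K)^2 * l * real n) * (1901068288 * CA * real n)"
    by (simp add: mult_ac)
  then have "N * (real K * l) \<le> 1901068288 * CA * real n"
    using rho K l n by (subst (asm) mult_le_cancel_left_pos) auto
  then show ?thesis using K l by (simp add: N_def le_divide_eq)
qed

text \<open>The two first-order terms add up to \<open>(18 + sqrt cA4) + 14 * sqrt cA4\<close> times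
  \<open>rho * K * sqrt l\<close>, the origin of the third condition on \<open>C2\<close>. Together
  they take \<open>phi1 * phi2 / 64\<close>, and so does the second-order term; on
  \<open>Is\<close>, \<open>phi2\<close> is at most the row length.\<close>

private lemma proj_error_le:
  assumes i: "i \<in> Is" "i \<notin> second_order_bad"
  shows "vnorm m (Y i) \<le> phi1 / 32 * vnorm m (X i)"
proof -
  have "i < n" using i Is_vnorm by simp
  define phi where "phi = phi1 * phi2"
  let ?t = "rho * real K * sqrt l"
  have "vnorm m (Y i) \<le> 2 / sg * (vnorm m (\<lambda>a. mvec n Err (col X a) i)
           + vnorm m (\<lambda>b. mvec n Err (\<lambda>j. Y j b) i) + e * vnorm m (X i))"
    by (rule proj_error_row_bound[OF dec top A_sym sg(1) E_norm e_nonneg e4 sg(2) \<open>i < n\<close>])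
  also have "\<dots> \<le> 2 / sg * ((18 + sqrt cA4) * ?t + sg * phi / 128 + 14 * sqrt cA4 * ?t)"
  proof (intro mult_left_mono add_mono)
    show "vnorm m (\<lambda>a. mvec n Err (col X a) i) \<le> (18 + sqrt cA4) * ?t" using E_rows[OF \<open>i < n\<close>] by (simp add: mult_ac)
    show "vnorm m (\<lambda>b. mvec n Err (\<lambda>j. Y j b) i) \<le> sg * phi / 128"
      using i(2) \<open>i < n\<close> by (auto simp: second_order_bad_def phi_def)
    have "e * vnorm m (X i) \<le> e * (sqrt cA4 * real K / sqrt (real n))"
      by (intro mult_left_mono row_vnorm_le \<open>i < n\<close> e_nonneg)
    also have "\<dots> = 14 * sqrt cA4 * ?t" using n by (simp add: real_sqrt_mult)
    finally show "e * vnorm m (X i) \<le> 14 * sqrt cA4 * ?t" .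
  qed (use sg in simp)
  also have "\<dots> = 2 * ((18 + 15 * sqrt cA4) * ?t / sg) + phi / 64" using sg by (simp add: field_simps)
  also have "2 * ((18 + 15 * sqrt cA4) * ?t / sg) \<le> phi / 64"
  proof -
    have "128 * (18 + 15 * sqrt cA4) * (?t / sg) \<le> C2 * (?t / sg)"
      using C2 rho l sg by (intro mult_right_mono) auto
    also have "\<dots> \<le> phi" using phi_ge by (simp add: phi_def mult_ac)
    finally show ?thesis by (simp add: mult_ac)
  qed
  also have "phi / 64 + phi / 64 = phi1 / 32 * phi2" by (simp add: phi_def)
  also have "\<dots> \<le> phi1 / 32 * vnorm m (X i)" using i Is_vnorm phi1 by (intro mult_left_mono) auto
  finally show ?thesis by simp
qed

lemma thresholded_cosine:
  assumes i: "i \<in> Is" "i \<notin> second_order_bad" and j: "j \<in> Is" "j \<notin> second_order_bad"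
  shows "c i \<noteq> c j \<Longrightarrow> row_tau m Xh i j < phi1 / 2"
    and "phi1 \<le> row_tau m X i j \<Longrightarrow> phi1 / 2 \<le> row_tau m Xh i j"
proof -
  have ij: "i < n" "j < n" using i j by (auto simp: Is_vnorm)
  have pos: "0 < vnorm m (X i)" "0 < vnorm m (X j)"
    using i j phi2 by (auto simp: Is_vnorm)
  have h: "0 \<le> phi1 / 32" "phi1 / 32 \<le> 1 / 32" using phi1 by auto
  have Ybd: "vnorm m (Y k) \<le> phi1 / 32 * vnorm m (X k)" if "k = i \<or> k = j" for k
    using that proj_error_le[OF i] proj_error_le[OF j] by auto
  have Z: "\<bar>dot m (\<lambda>b. Xh k b - Y k b) (\<lambda>b. Xh k' b - Y k' b) - dot m (X k) (X k')\<bar>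
      \<le> (2 * e / sg)^2 * (vnorm m (X k) * vnorm m (X k'))" if "k = i \<or> k = j" "k' = i \<or> k' = j" for k k'
    by (rule proj_rows_dot[OF dec top A_sym sg(1) E_norm e_nonneg e4 sg(2)]) (use that ij in auto)
  have R: "(1 - 2 * (phi1 / 32)) * vnorm m (X k) \<le> vnorm m (Xh k) \<and> vnorm m (Xh k) \<le> (1 + 2 * (phi1 / 32)) * vnorm m (X k)"
    if "k = i \<or> k = j" for k
    by (rule perturbed_rows(1)[where Y=Y and i=i and j=j, OF h eps_le Ybd Z that])
  have dots: "\<bar>dot m (Xh i) (Xh j) - dot m (X i) (X j)\<bar> \<le> 4 * (phi1 / 32) * (vnorm m (X i) * vnorm m (X j))"
    by (rule perturbed_rows(2)[where Y=Y and i=i and j=j, OF h eps_le Ybd Z])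
  note Ri = R[OF disjI1[OF refl]] and Rj = R[OF disjI2[OF refl]]
  note thr = row_tau_threshold[OF phi1 pos conjunct1[OF Ri] conjunct2[OF Ri] conjunct1[OF Rj] conjunct2[OF Rj] dots]
  show "c i \<noteq> c j \<Longrightarrow> row_tau m Xh i j < phi1 / 2" using thr(1) eigvec_rows_orthogonal[OF ij] by blast
  show "phi1 \<le> row_tau m X i j \<Longrightarrow> phi1 / 2 \<le> row_tau m Xh i j" by (rule thr(2))
qed

text \<open>A row outside \<open>bad\<close> can disagree with its community indicator only in bad
  columns and at the few members of its community outside \<open>G\<close>. A bad row may disagree
  everywhere. So bad nodes count once as columns and once as rows, whence
  \<open>2 * b\<close>.\<close>

lemma thresholded_cosine_distance:
  defines "b \<equiv> (eta1 + eta2) * real n + 1901068288 * CA * real n / (real K * l)"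
  shows "(\<Sum>i<n. \<Sum>j<n. ((if row_tau m Xh i j \<ge> phi1 / 2 then 1 else 0) - of_bool (c j = c i) :: real)^2)
    \<le> real n * (2 * b + CA * \<bar>eta0\<bar> * real n / real K)"
proof -
  define bad where "bad = ({..<n} - Hs) \<union> ({..<n} - Is) \<union> second_order_bad"
  have fin: "finite second_order_bad" by (simp add: second_order_bad_def)
  then have fbad: "finite bad" by (simp add: bad_def)
  have bad: "real (card bad) \<le> b"
  proof -
    have "card bad \<le> card ({..<n} - Hs) + card ({..<n} - Is) + card second_order_bad"
      unfolding bad_def by (rule order.trans[OF card_Un_le add_right_mono[OF card_Un_le]])
    then have "real (card bad) \<le> real (card ({..<n} - Hs)) + real (card ({..<n} - Is)) + real (card second_order_bad)"
      by linarith
    then show ?thesis unfolding b_def using Hs_finite(3) Is_finite(3) card_second_order_bad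
      by (simp add: distrib_right)
  qed
  define f where "f i = real (card {j. j < n \<and> (row_tau m Xh i j \<ge> phi1 / 2) \<noteq> (c j = c i)})" for i
  have f_le: "f i \<le> real n" for i
    using card_mono[of "{..<n}" "{j. j < n \<and> (row_tau m Xh i j \<ge> phi1 / 2) \<noteq> (c j = c i)}"] by (auto simp: f_def)
  have f_good: "f i \<le> b + CA * \<bar>eta0\<bar> * real n / real K" if i: "i < n" "i \<notin> bad" for i
  proof -
    define C where "C = {j. j < n \<and> c j = c i}"
    define G where "G = {j. j < n \<and> c j = c i \<and> row_tau m X i j \<ge> phi1}"
    have GC: "G \<subseteq> C" "finite C" by (auto simp: G_def C_def)
    have iH: "i \<in> Hs" and iI: "i \<in> Is" "i \<notin> second_order_bad" using i by (auto simp: bad_def)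
    have "{j. j < n \<and> (row_tau m Xh i j \<ge> phi1 / 2) \<noteq> (c j = c i)} \<subseteq> bad \<union> (C - G)"
    proof
      fix j assume j: "j \<in> {j. j < n \<and> (row_tau m Xh i j \<ge> phi1 / 2) \<noteq> (c j = c i)}"
      show "j \<in> bad \<union> (C - G)"
      proof (rule ccontr)
        assume nj: "j \<notin> bad \<union> (C - G)"
        then have jI: "j \<in> Is" "j \<notin> second_order_bad" using j by (auto simp: bad_def)
        show False
        proof (cases "c j = c i")
          case True
          then have "j \<in> G" using j nj by (auto simp: C_def)
          then show False using thresholded_cosine(2)[OF iI jI] j True by (simp add: G_def)
        next
          case False
          then show False using thresholded_cosine(1)[OF iI jI] j by auto
        qed
      qed
    qed
    then have "card {j. j < n \<and> (row_tau m Xh i j \<ge> phi1 / 2) \<noteq> (c j = c i)} \<le> card (bad \<union> (C - G))"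
      using fbad GC by (intro card_mono) auto
    also have "\<dots> \<le> card bad + card (C - G)" by (rule card_Un_le)
    finally have "f i \<le> real (card bad) + real (card (C - G))" unfolding f_def by linarith
    moreover have "real (card (C - G)) \<le> CA * \<bar>eta0\<bar> * real n / real K"
    proof -
      have "card (C - G) = card C - card G" using GC by (intro card_Diff_subset finite_subset[OF GC])
      moreover have "card G \<le> card C" using GC by (intro card_mono)
      ultimately have "real (card (C - G)) = real (card C) - real (card G)" by simp
      also have "\<dots> \<le> real (card C) * eta0"
        using iH by (simp add: Hs_def C_def G_def comm_size_def algebra_simps)
      also have "\<dots> \<le> real (card C) * \<bar>eta0\<bar>" by (rule mult_left_mono) auto
      also have "\<dots> \<le> (CA * real n / real K) * \<bar>eta0\<bar>"
        using size[OF c[OF i(1)]] by (intro mult_right_mono) (auto simp: C_def comm_size_def)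
      finally show ?thesis by (simp add: mult_ac)
    qed
    ultimately show ?thesis using bad by linarith
  qed
  have b0: "0 \<le> b" using bad by linarith
  have "(\<Sum>i<n. \<Sum>j<n. ((if row_tau m Xh i j \<ge> phi1 / 2 then 1 else 0) - of_bool (c j = c i) :: real)^2) = (\<Sum>i<n. f i)"
    unfolding f_def by (intro sum.cong refl sum_sq_diff_of_bool)
  also have "\<dots> \<le> (\<Sum>i<n. (b + CA * \<bar>eta0\<bar> * real n / real K) + (if i \<in> bad then real n else 0))"
  proof (intro sum_mono)
    fix i assume "i \<in> {..<n}"
    moreover have "0 \<le> b + CA * \<bar>eta0\<bar> * real n / real K" using b0 CA by simp
    ultimately show "f i \<le> (b + CA * \<bar>eta0\<bar> * real n / real K) + (if i \<in> bad then real n else 0)"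
      using f_le[of i] f_good[of i] by auto
  qed
  also have "\<dots> = real n * (b + CA * \<bar>eta0\<bar> * real n / real K) + real (card ({..<n} \<inter> bad)) * real n"
    by (simp add: sum.distrib sum.If_cases)
  also have "real (card ({..<n} \<inter> bad)) * real n \<le> b * real n"
  proof (rule mult_right_mono)
    have "card ({..<n} \<inter> bad) \<le> card bad" using fbad by (intro card_mono) auto
    then show "real (card ({..<n} \<inter> bad)) \<le> b" using bad by linarith
  qed simp
  finally show ?thesis by (simp add: algebra_simps)
qed

lemma tcsc_mis_loss:
  assumes eps: "0 < eps" and out: "tcsc_output n K Xh (phi1 / 2) eps ch"
  shows "mis_loss n K c ch \<le> 8 * CA * (1 + CA^2) *
     ((2 + eps) * (2 * (real K * (eta1 + eta2) + 1901068288 * CA / l) + CA * \<bar>eta0\<bar>) + real K / (real n)^2)"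
proof -
  define b where "b = (eta1 + eta2) * real n + 1901068288 * CA * real n / (real K * l)"
  define D where "D = real n * (2 * b + CA * \<bar>eta0\<bar> * real n / real K)"
  have "mis_loss n K c ch \<le> 8 * CA * (1 + CA^2) * real K * ((2 + eps) * D + 1) / (real n)^2"
  proof (rule kmeans_mis_loss[OF n K CA eps c size])
    show "(\<Sum>i<n. \<Sum>j<n. ((if row_tau m Xh i j \<ge> phi1 / 2 then 1 else 0) - of_bool (c j = c i))^2) \<le> D"
      unfolding D_def b_def by (rule thresholded_cosine_distance)
  qed (use out in \<open>auto simp: tcsc_output_def Let_def\<close>)
  also have "\<dots> = 8 * CA * (1 + CA^2) * ((2 + eps) * (real K * D / (real n)^2) + real K / (real n)^2)"
    by (simp add: algebra_simps add_divide_distrib)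
  also have "real K * D / (real n)^2 = 2 * (real K * b / real n) + CA * \<bar>eta0\<bar>"
    using n K by (simp add: D_def field_simps power2_eq_square)
  also have "real K * b / real n = real K * (eta1 + eta2) + 1901068288 * CA / l"
    using n K l by (simp add: b_def field_simps)
  finally show ?thesis .
qed

end

end

section \<open>Probability of recovery\<close>

text \<open>\<open>adj_of\<close> has zero diagonal whereas \<open>Th\<close> need not, so
  \<open>Th\<close> is the mean of the adjacency matrix only off the diagonal.\<close>

lemma adjacency_minus_mean:
  assumes "i < n" "j < n" "Th i j = Th j i"
  shows "adj_of G i j - Th i j = noise Th G i j - (if i = j then Th i i else 0)"
  using assms by (auto simp: adj_of_def noise_def edge_noise_def node_pair_def min_def max_def)

lemma adj_of_commute: "adj_of G i j = adj_of G j i"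
  by (auto simp: adj_of_def)

context
  fixes n K :: nat and rho l a4 :: real and Th X :: rmat and G
  assumes controlled: "noise_controlled n K rho l Th X G"
    and Th: "\<And>i j. i < n \<Longrightarrow> j < n \<Longrightarrow> 0 \<le> Th i j \<and> Th i j \<le> rho^2"
    and Th_sym: "\<And>i j. i < n \<Longrightarrow> j < n \<Longrightarrow> Th i j = Th j i"
    and on: "orthonormal_cols n (K^2) X"
    and rows: "\<And>j. j < n \<Longrightarrow> vnorm (K^2) (X j) \<le> a4 * real K / sqrt (real n)" and a4: "0 \<le> a4"
    and rho: "0 < rho" "rho \<le> 1" and l: "1 \<le> l" and n: "0 < n"
begin

private abbreviation (input) "Dev \<equiv> \<lambda>i j. adj_of G i j - Th i j"

private lemma mvec_E: "i < n \<Longrightarrow> mvec n Dev x i = mvec n (noise Th G) x i - Th i i * x i"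
proof -
  assume i: "i < n"
  have "mvec n Dev x i = (\<Sum>j<n. noise Th G i j * x j - (if i = j then Th i i * x i else 0))"
  proof (intro sum.cong refl)
    fix j assume "j \<in> {..<n}"
    then have "Dev i j = noise Th G i j - (if i = j then Th i i else 0)"
      using i by (intro adjacency_minus_mean Th_sym) auto
    then show "Dev i j * x j = noise Th G i j * x j - (if i = j then Th i i * x i else 0)"
      by (auto simp: left_diff_distrib)
  qed
  then show ?thesis using i by (simp add: sum_subtractf)
qed

lemma adjacency_error_norm: "vnorm n (mvec n Dev x) \<le> 14 * rho * sqrt (real n * l) * vnorm n x"
proof -
  have "vnorm n (mvec n Dev x) = vnorm n (\<lambda>i. mvec n (noise Th G) x i - Th i i * x i)"
    by (intro L2_set_cong refl mvec_E) simp
  also have "\<dots> \<le> vnorm n (mvec n (noise Th G) x) + vnorm n (\<lambda>i. Th i i * x i)" by (rule vnorm_diff_le)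
  also have "vnorm n (mvec n (noise Th G) x) \<le> 12 * rho * sqrt (real n * l) * vnorm n x"
    using controlled unfolding noise_controlled_def by blast
  also have "vnorm n (\<lambda>i. Th i i * x i) \<le> rho * sqrt (real n * l) * vnorm n x"
  proof -
    have "vnorm n (\<lambda>i. Th i i * x i) = vnorm n (\<lambda>i. \<bar>Th i i * x i\<bar>)" by (simp only: vnorm_abs)
    also have "\<dots> \<le> vnorm n (\<lambda>i. rho^2 * \<bar>x i\<bar>)"
      using Th by (intro L2_set_mono) (auto simp: abs_mult intro!: mult_right_mono)
    also have "\<dots> = rho^2 * vnorm n x" unfolding vnorm_scale vnorm_abs by simp
    also have "\<dots> \<le> rho * sqrt (real n * l) * vnorm n x"
    proof (rule mult_right_mono)
      have "1 * 1 \<le> real n * l" using n l by (intro mult_mono) auto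
      then have "1 \<le> sqrt (real n * l)" by simp
      then have "rho \<le> sqrt (real n * l)" using rho by linarith
      then show "rho^2 \<le> rho * sqrt (real n * l)" using rho by (simp add: power2_eq_square)
    qed simp
    finally show ?thesis .
  qed
  finally have "vnorm n (mvec n Dev x) \<le> 13 * (rho * sqrt (real n * l) * vnorm n x)" by (simp add: mult_ac)
  also have "\<dots> \<le> 14 * (rho * sqrt (real n * l) * vnorm n x)"
    using rho l by (intro mult_right_mono) auto
  finally show ?thesis by (simp add: mult.assoc)
qed

lemma adjacency_error_rows:
  assumes i: "i < n"
  shows "vnorm (K^2) (\<lambda>a. mvec n Dev (col X a) i) \<le> (18 + a4) * rho * real K * sqrt l"
proof -
  have "vnorm (K^2) (\<lambda>a. mvec n Dev (col X a) i) = vnorm (K^2) (\<lambda>a. mvec n (noise Th G) (col X a) i - Th i i * X i a)"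
    by (intro L2_set_cong refl mvec_E i)
  also have "\<dots> \<le> vnorm (K^2) (\<lambda>a. mvec n (noise Th G) (col X a) i) + vnorm (K^2) (\<lambda>a. Th i i * X i a)"
    by (rule vnorm_diff_le)
  also have "vnorm (K^2) (\<lambda>a. mvec n (noise Th G) (col X a) i) \<le> 18 * rho * real K * sqrt l"
  proof -
    have "vnorm (K^2) (\<lambda>a. mvec n (noise Th G) (col X a) i) = vnorm (K^2) (\<lambda>a. \<bar>mvec n (noise Th G) (col X a) i\<bar>)"
      by (simp only: vnorm_abs)
    also have "\<dots> \<le> vnorm (K^2) (\<lambda>_. 18 * rho * sqrt l)"
      using controlled i unfolding noise_controlled_def by (intro L2_set_mono) auto
    also have "\<dots> = 18 * rho * real K * sqrt l" using rho l by (simp add: L2_set_constant)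
    finally show ?thesis .
  qed
  also have "vnorm (K^2) (\<lambda>a. Th i i * X i a) \<le> a4 * rho * real K * sqrt l"
  proof -
    have "vnorm (K^2) (\<lambda>a. Th i i * X i a) = Th i i * vnorm (K^2) (X i)" unfolding vnorm_scale using Th[OF i i] by simp
    also have "\<dots> \<le> rho^2 * (a4 * real K / sqrt (real n))"
      using Th[OF i i] rows[OF i] by (intro mult_mono) auto
    also have "\<dots> \<le> (rho * 1) * (a4 * real K / 1)"
      unfolding power2_eq_square using rho n a4 by (intro mult_mono divide_left_mono) auto
    also have "\<dots> = a4 * rho * real K * 1" by simp
    also have "\<dots> \<le> a4 * rho * real K * sqrt l" using rho l a4 by (intro mult_left_mono) auto
    finally show ?thesis .
  qed
  finally show ?thesis by (simp add: algebra_simps)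
qed

text \<open>The columns of \<open>X\<close> are unit vectors, so the diagonal correction has squared
  norm at most \<open>rho^2\<close> per column, and
  \<open>2 * 36 * n + 2 \<le> 74 * n\<close>.\<close>

lemma adjacency_error_frobenius:
  "(\<Sum>i<n. (vnorm (K^2) (\<lambda>a. mvec n Dev (col X a) i))^2) \<le> 74 * real n * rho^2 * (real K)^2"
proof -
  let ?W = "\<lambda>i a. mvec n (noise Th G) (col X a) i"
  have "(\<Sum>i<n. (vnorm (K^2) (\<lambda>a. mvec n Dev (col X a) i))^2) = (\<Sum>i<n. \<Sum>a<K^2. (mvec n Dev (col X a) i)^2)"
    by (simp only: L2_set_power2)
  also have "\<dots> \<le> (\<Sum>i<n. \<Sum>a<K^2. 2 * (?W i a)^2 + 2 * (rho^2 * (X i a)^2))"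
  proof (intro sum_mono)
    fix i a assume "i \<in> {..<n}"
    then have i: "i < n" by simp
    have "(mvec n Dev (col X a) i)^2 \<le> 2 * (?W i a)^2 + 2 * (Th i i * X i a)^2"
      unfolding mvec_E[OF i] using square_diff_le[of "?W i a" "Th i i * X i a" 0] by simp
    also have "(Th i i * X i a)^2 \<le> rho^2 * (X i a)^2"
    proof -
      have "Th i i * Th i i \<le> rho^2 * 1"
        using Th[OF i i] rho power_le_one[of rho 2] by (intro mult_mono) auto
      then show ?thesis by (simp add: power_mult_distrib power2_eq_square[of "Th i i"] mult_right_mono)
    qed
    finally show "(mvec n Dev (col X a) i)^2 \<le> 2 * (?W i a)^2 + 2 * (rho^2 * (X i a)^2)" by simp
  qed
  also have "\<dots> = (\<Sum>a<K^2. 2 * (\<Sum>i<n. (?W i a)^2) + 2 * (rho^2 * (\<Sum>i<n. (X i a)^2)))"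
    by (subst sum.swap) (simp only: sum.distrib sum_distrib_left)
  also have "\<dots> \<le> (\<Sum>a<K^2. 2 * (36 * real n * rho^2) + 2 * (rho^2 * 1))"
    using controlled on unfolding noise_controlled_def orthonormal_cols_def
    by (intro sum_mono add_mono mult_left_mono) (auto simp: power2_eq_square)
  also have "\<dots> = (real K)^2 * rho^2 * (72 * real n + 2)" by (simp add: algebra_simps)
  also have "\<dots> \<le> (real K)^2 * rho^2 * (74 * real n)" using n by (intro mult_left_mono) auto
  finally show ?thesis by (simp add: mult_ac)
qed

end

text \<open>For \<open>k\<close> the number of communities: it may grow with \<open>n\<close>, and
  the exceptional fractions have to stay negligible after multiplication by it.\<close>

lemma tendsto_zero_times_smallo:
  fixes f g k :: "nat \<Rightarrow> real"
  assumes f: "f \<in> o(g)" and g: "\<forall>\<^sub>F n in sequentially. k n * \<bar>g n\<bar> \<le> 1 \<and> 0 \<le> k n"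
  shows "(\<lambda>n. k n * \<bar>f n\<bar>) \<longlonglongrightarrow> 0"
proof (rule LIMSEQ_I)
  fix r :: real assume r: "0 < r"
  have "\<forall>\<^sub>F n in sequentially. \<bar>f n\<bar> \<le> r / 2 * \<bar>g n\<bar>" using landau_o.smallD[OF f, of "r / 2"] r by simp
  with g have "\<forall>\<^sub>F n in sequentially. norm (k n * \<bar>f n\<bar> - 0) < r"
  proof eventually_elim
    case (elim n)
    have "k n * \<bar>f n\<bar> \<le> k n * (r / 2 * \<bar>g n\<bar>)" using elim by (intro mult_left_mono) auto
    also have "\<dots> = r / 2 * (k n * \<bar>g n\<bar>)" by simp
    also have "\<dots> \<le> r / 2 * 1" using elim r by (intro mult_left_mono) auto
    finally show ?case using elim r by (simp add: abs_mult)
  qed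
  then show "\<exists>no. \<forall>n\<ge>no. norm (k n * \<bar>f n\<bar> - 0) < r" by (simp add: eventually_sequentially)
qed

lemma eventually_log_cube_le: "\<forall>\<^sub>F n in sequentially. 1 \<le> ln (real n) \<and> 16403 * ln (real n) ^ 3 \<le> real n"
  by (intro eventually_conj; real_asymp)

text \<open>The bound for one fixed \<open>n\<close>. The event \<open>noise_controlled\<close>
  speaks only of the graph, the mean and \<open>X\<close>. On it the conclusion holds for every
  choice of leading eigenvectors and every admissible labelling, so these quantifiers can stay
  inside the probability.\<close>

lemma recovery_probability:
  fixes c :: "nat \<Rightarrow> nat" and L X :: rmat and P :: "nat \<Rightarrow> rmat" and mu :: "nat \<Rightarrow> real"
  assumes K: "0 < K" and CA: "1 \<le> CA" and cA4: "0 < cA4" and eps: "0 < eps"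
    and c: "\<And>i. i < n \<Longrightarrow> c i < K" and rho: "0 < rho" "rho \<le> 1"
    and L: "\<And>i a. i < n \<Longrightarrow> a < K \<Longrightarrow> 0 \<le> L i a \<and> L i a \<le> rho"
    and dec: "nonzero_eigdecomp n (K^2) (pabm_theta c L) X mu"
    and inv: "\<And>k. k < K \<Longrightarrow> is_inverse_mat K (comm_gram n c L k) (P k)"
    and size: "\<And>k. k < K \<Longrightarrow> real n / (CA * real K) \<le> real (comm_size n c k)
        \<and> real (comm_size n c k) \<le> CA * real n / real K"
    and D_le: "\<And>i. i < n \<Longrightarrow> D_form K (P (c i)) (L i) (L i) \<le> cA4 * (real K)^2 / real n"
    and phi1: "0 < phi1" "phi1 \<le> 1"
    and H: "real (card ({0..<n} - {i. i < n \<and> real (card {j. j < n \<and> c j = c i \<and> row_tau (K^2) X i j \<ge> phi1})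
                              \<ge> real (comm_size n c (c i)) * (1 - eta0)})) \<le> eta1 * real n"
    and I: "real (card {i. i < n \<and> sqrt (D_form K (P (c i)) (L i) (L i)) \<ge> phi2}) > real n * (1 - eta2)"
    and etas: "eta0 \<le> 1 / 4" "eta2 * (4 * CA * real K) \<le> 1" "eta1 + eta2 \<le> 1"
    and C2: "1 \<le> C2" "896 * sqrt cA4 \<le> C2" "128 * (18 + 15 * sqrt cA4) \<le> C2"
    and phi: "C2 * rho * real K * sqrt (ln (real n)) / Min {\<bar>mu a\<bar> | a. a < K^2} \<le> phi1 * phi2"
    and nrho: "12 * (real K)^2 * (ln (real n))^2 \<le> real n * rho^2" "cA4 * (real K)^2 * (ln (real n))^2 \<le> real n * rho^2"
    and large: "1 \<le> ln (real n)" "16403 * ln (real n) ^ 3 \<le> real n"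
  shows "measure_pmf.prob (pabm_pmf n (pabm_theta c L))
      {G. \<forall>Xh nu. top_eigvecs n (K^2) (adj_of G) Xh nu \<longrightarrow>
          (\<forall>ch. tcsc_output n K Xh (phi1 / 2) eps ch \<longrightarrow>
             mis_loss n K c ch \<le> loss_bound CA eps n K eta0 eta1 eta2)}
     \<ge> 1 - 7 / real n ^ 4" (is "measure_pmf.prob ?P ?good \<ge> _")
proof -
  define l where "l = ln (real n)"
  define sg where "sg = Min {\<bar>mu a\<bar> | a. a < K^2}"
  let ?Th = "pabm_theta c L"
  have n: "0 < n" using large(1) by (cases n) auto
  have fin: "finite {\<bar>mu a\<bar> | a. a < K^2}" by (simp add: setcompr_eq_image)
  have sg_le: "sg \<le> \<bar>mu a\<bar>" if "a < K^2" for a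
    unfolding sg_def using that by (intro Min_le[OF fin]) auto
  have "sg \<in> {\<bar>mu a\<bar> | a. a < K^2}" unfolding sg_def using K by (intro Min_in[OF fin]) (auto intro!: exI[of _ 0])
  then have sg: "0 < sg" using dec by (auto simp: nonzero_eigdecomp_def)
  \<comment> \<open>The sign of \<open>phi2\<close> comes from the lower bound on
    \<open>phi1 * phi2\<close>.\<close>
  have "0 < C2 * rho * real K * sqrt l / sg" using C2 rho K large sg by (simp add: l_def)
  then have "0 < phi1 * phi2" using phi by (simp add: l_def sg_def)
  then have phi2: "0 < phi2" using phi1 by (simp add: zero_less_mult_iff)
  have on: "orthonormal_cols n (K^2) X" using dec by (simp add: nonzero_eigdecomp_def)
  have Th: "0 \<le> ?Th i j \<and> ?Th i j \<le> rho^2" if "i < n" "j < n" for i j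
    unfolding pabm_theta_def power2_eq_square using L[OF that(1) c[OF that(2)]] L[OF that(2) c[OF that(1)]] rho
    by (auto intro: mult_mono)
  have rows: "vnorm (K^2) (X i) \<le> sqrt cA4 * real K / sqrt (real n)" if "i < n" for i
    by (rule eigvec_row_vnorm_le[OF c inv dec D_le[OF that] cA4 that])
  have Kn: "K^2 \<le> n"
  proof -
    have "(real K)^2 * 1 \<le> (real K)^2 * (12 * l^2)"
      using one_le_power[OF large(1), of 2] by (intro mult_left_mono) (auto simp: l_def)
    also have "\<dots> \<le> real n * rho^2" using nrho(1) by (simp add: l_def mult_ac)
    also have "\<dots> \<le> real n * 1" using rho by (intro mult_left_mono) (auto simp: power_le_one)
    finally show ?thesis by (simp flip: of_nat_power)
  qed
  have "measure_pmf.prob ?P {G. \<not> noise_controlled n K rho l ?Th X G} \<le> 7 / real n ^ 4"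
    using cA4 nrho large
    by (intro noise_controlled_prob[where ?a4.0="sqrt cA4", OF Th on rows K Kn rho]) (auto simp: l_def)
  moreover have "measure_pmf.prob ?P {G. \<not> noise_controlled n K rho l ?Th X G}
      = 1 - measure_pmf.prob ?P {G. noise_controlled n K rho l ?Th X G}"
    using measure_pmf.prob_compl[of "{G. noise_controlled n K rho l ?Th X G}" ?P]
    by (simp add: Compl_eq_Diff_UNIV[symmetric] Collect_neg_eq)
  moreover have "measure_pmf.prob ?P {G. noise_controlled n K rho l ?Th X G} \<le> measure_pmf.prob ?P ?good"
  proof (rule measure_pmf.finite_measure_mono)
    show "{G. noise_controlled n K rho l ?Th X G} \<subseteq> ?good"
    proof (intro subsetI CollectI allI impI)
      fix G Xh nu ch
      assume "G \<in> {G. noise_controlled n K rho l ?Th X G}"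
        and top: "top_eigvecs n (K^2) (adj_of G) Xh nu"
        and out: "tcsc_output n K Xh (phi1 / 2) eps ch"
      then have nc: "noise_controlled n K rho l ?Th X G" by simp
      have l: "1 \<le> l" using large by (simp add: l_def)
      have Th_sym: "?Th i j = ?Th j i" for i j by (simp add: pabm_theta_def)
      have a4: "0 \<le> sqrt cA4" using cA4 by simp
      have phi': "C2 * rho * real K * sqrt l / sg \<le> phi1 * phi2" using phi by (simp add: l_def sg_def)
      show "mis_loss n K c ch \<le> loss_bound CA eps n K eta0 eta1 eta2"
        unfolding loss_bound_def l_def[symmetric]
        by (rule tcsc_mis_loss[OF n K CA cA4 c dec inv size D_le phi1 phi2 H I etas top adj_of_commute sg_le sg rho(1) l C2 phi'
              adjacency_error_norm[OF nc Th Th_sym on rows a4 rho l n]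
              adjacency_error_rows[OF nc Th Th_sym on rows a4 rho l n]
              adjacency_error_frobenius[OF nc Th Th_sym on rows a4 rho l n] eps out])
    qed
  qed simp
  ultimately show ?thesis by linarith
qed

theorem theorem1:
  fixes eps C1 CA1 cA4 cphi :: real
  assumes "eps > 0" and "C1 > 0" and "CA1 \<ge> 1" and "cA4 > 0" and "cphi > 0"
  shows "\<exists>CA2_0 C2_0 :: real. \<forall>(CA2 :: real) (C2 :: real) (K :: nat \<Rightarrow> nat)
      (cs :: nat \<Rightarrow> nat \<Rightarrow> nat) (L0 :: nat \<Rightarrow> nat \<Rightarrow> nat \<Rightarrow> real) (rho :: nat \<Rightarrow> real)
      (Xi :: nat \<Rightarrow> nat \<Rightarrow> nat \<Rightarrow> real) (mu :: nat \<Rightarrow> nat \<Rightarrow> real)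
      (P :: nat \<Rightarrow> nat \<Rightarrow> nat \<Rightarrow> nat \<Rightarrow> real)
      (phi1 :: nat \<Rightarrow> real) (phi2 :: nat \<Rightarrow> real)
      (eta0 :: nat \<Rightarrow> real) (eta1 :: nat \<Rightarrow> real) (eta2 :: nat \<Rightarrow> real).
    CA2 \<ge> CA2_0 \<and> C2 \<ge> C2_0 \<and>
    (\<forall>\<^sub>F n in sequentially.
       (let Kn = K n; m = (K n)\<^sup>2; c = cs n; L = (\<lambda>i a. rho n * L0 n i a);
            sig1 = Max {\<bar>mu n a\<bar> | a. a < m}; sigm = Min {\<bar>mu n a\<bar> | a. a < m};
            H = {i. i < n \<and> real (card {j. j < n \<and> c j = c i \<and> row_tau m (Xi n) i j \<ge> phi1 n})
                              \<ge> real (comm_size n c (c i)) * (1 - eta0 n)} in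
         2 \<le> Kn \<and> (\<forall>i<n. c i < Kn) \<and> 0 < rho n \<and> rho n \<le> 1 \<and>
         (\<forall>i<n. \<forall>a<Kn. 0 < L0 n i a \<and> L0 n i a < 1) \<and>
         nonzero_eigdecomp n m (pabm_theta c L) (Xi n) (mu n) \<and>
         sig1 / sigm \<le> C1 * sqrt (ln (real n)) \<and>
         (\<forall>k<Kn. real n / (CA1 * real Kn) \<le> real (comm_size n c k) \<and>
                 real (comm_size n c k) \<le> CA1 * real n / real Kn) \<and>
         real n * (rho n)\<^sup>2 / (real Kn)\<^sup>2 \<ge> CA2 * (ln (real n))\<^sup>2 \<and>
         0 < phi1 n \<and> phi1 n \<le> 1 \<and>
         real (card ({0..<n} - H)) \<le> eta1 n * real n \<and>
         (\<forall>k<Kn. is_inverse_mat Kn (comm_gram n c L k) (P n k)) \<and>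
         real (card {i. i < n \<and> sqrt (D_form Kn (P n (c i)) (L i) (L i)) \<ge> phi2 n})
            > real n * (1 - eta2 n) \<and>
         (\<forall>i<n. D_form Kn (P n (c i)) (L i) (L i) \<le> cA4 * (real Kn)\<^sup>2 / real n) \<and>
         phi1 n * phi2 n \<le> cphi * real Kn / sqrt (real n) \<and>
         phi1 n * phi2 n \<ge> C2 * rho n * real Kn * sqrt (ln (real n)) / sigm)) \<and>
    eta1 \<in> o(\<lambda>n. (ln (real n))\<^sup>2 / (real n * (rho n)\<^sup>2)) \<and>
    eta0 \<in> o(\<lambda>n. ln (real n) / sqrt (real n * (rho n)\<^sup>2)) \<and>
    eta2 \<in> o(\<lambda>n. (ln (real n))\<^sup>2 / (real n * (rho n)\<^sup>2))
    \<longrightarrow>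
    (\<exists>C > 0. \<exists>eta :: nat \<Rightarrow> real. eta \<longlonglongrightarrow> 0 \<and>
       (\<forall>\<^sub>F n in sequentially.
          (let Kn = K n; m = (K n)\<^sup>2; c = cs n; L = (\<lambda>i a. rho n * L0 n i a) in
            measure_pmf.prob (pabm_pmf n (pabm_theta c L))
              {\<omega>. \<forall>Xh nu. top_eigvecs n m (adj_of \<omega>) Xh nu \<longrightarrow>
                    (\<forall>ch. tcsc_output n Kn Xh (phi1 n / 2) eps ch \<longrightarrow>
                          mis_loss n Kn c ch \<le> eta n)}
            \<ge> 1 - C / real n ^ 4)))"
\<comment> \<open>\<open>12\<close> makes \<open>n * rho^2\<close> large enough for the moment order
  \<open>p \<le> 6 * l\<close> of the trace method, and \<open>cA4\<close> serves the Chernoff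
  parameter of the row sums. The three lower bounds on \<open>C2\<close> are those used in
  \<open>card_second_order_bad\<close>, \<open>e_le\<close> and
  \<open>proj_error_le\<close>.\<close>
proof (rule exI[of _ "max 12 cA4"], rule exI[of _ "max 1 (max (896 * sqrt cA4) (128 * (18 + 15 * sqrt cA4)))"],
    intro allI impI, elim conjE, goal_cases)
  case (1 CA2 C2 K cs L0 rho Xi mu P phi1 phi2 eta0 eta1 eta2)
  note CA2 = 1(1) and C2 = 1(2) and ev = 1(3) and eta1 = 1(4) and eta0 = 1(5) and eta2 = 1(6)
  have le_sq: "x \<le> 12 * x^2" if "1 \<le> x" for x :: real
  proof -
    have "x \<le> x^2" by (rule self_le_power[OF that]) simp
    then show ?thesis using zero_le_power2[of x] by linarith
  qed
  have scale: "\<forall>\<^sub>F n in sequentially. 1 \<le> real (K n) \<and> real (K n) \<le> real n \<and> 0 < rho n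
      \<and> 12 * (real (K n))^2 * (ln (real n))^2 \<le> real n * (rho n)^2
      \<and> cA4 * (real (K n))^2 * (ln (real n))^2 \<le> real n * (rho n)^2"
    using ev eventually_log_cube_le
  proof eventually_elim
    case (elim n)
    then have K: "1 \<le> real (K n)" and rho: "0 < rho n" "rho n \<le> 1"
      and A2: "CA2 * (ln (real n))^2 \<le> real n * (rho n)^2 / (real (K n))^2" and l: "1 \<le> ln (real n)"
      by (auto simp: Let_def)
    have A2': "CA2 * (ln (real n))^2 * (real (K n))^2 \<le> real n * (rho n)^2"
      using A2 K by (subst (asm) le_divide_eq) auto
    have le: "x * (real (K n))^2 * (ln (real n))^2 \<le> real n * (rho n)^2" if "x \<le> CA2" for x
    proof -
      have "x * ((ln (real n))^2 * (real (K n))^2) \<le> CA2 * ((ln (real n))^2 * (real (K n))^2)"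
        by (rule mult_right_mono[OF that]) simp
      then show ?thesis using A2' by (simp add: mult_ac)
    qed
    have "real (K n) * 1 \<le> 12 * (real (K n))^2 * (ln (real n))^2"
    proof (rule mult_mono)
      show "real (K n) \<le> 12 * (real (K n))^2" by (rule le_sq[OF K])
      show "1 \<le> (ln (real n))^2" using l by (simp add: one_le_power)
    qed auto
    also have "\<dots> \<le> real n * (rho n)^2" by (rule le) (use CA2 in simp)
    also have "\<dots> \<le> real n * 1" using rho by (intro mult_left_mono) (auto simp: power_le_one)
    finally show ?case using K rho le CA2 by simp
  qed
  \<comment> \<open>\<open>scale\<close> bounds \<open>12 * K^2 * (ln n)^2\<close> by
    \<open>n * rho^2\<close>, which leaves room for one factor \<open>K\<close> in front of the
    quadratic rate.\<close>
  have quad: "\<forall>\<^sub>F n in sequentially. real (K n) * \<bar>(ln (real n))^2 / (real n * (rho n)^2)\<bar> \<le> 1 \<and> 0 \<le> real (K n)"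
    using scale eventually_log_cube_le
  proof eventually_elim
    case (elim n)
    have pos: "0 < real n * (rho n)^2" using elim by auto
    have "real (K n) * (ln (real n))^2 \<le> 12 * (real (K n))^2 * (ln (real n))^2"
      by (rule mult_right_mono[OF le_sq]) (use elim in auto)
    also have "\<dots> \<le> real n * (rho n)^2" using elim by blast
    finally show ?case using pos by (simp add: abs_mult)
  qed
  \<comment> \<open>The square root of the same bound gives exactly one factor \<open>K\<close> in
    front of the linear rate.\<close>
  have lin: "\<forall>\<^sub>F n in sequentially. real (K n) * \<bar>ln (real n) / sqrt (real n * (rho n)^2)\<bar> \<le> 1 \<and> 0 \<le> real (K n)"
    using scale eventually_log_cube_le
  proof eventually_elim
    case (elim n)
    have pos: "0 < real n * (rho n)^2" using elim by auto
    have "(real (K n) * ln (real n))^2 \<le> 12 * ((real (K n))^2 * (ln (real n))^2)"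
      by (simp add: power_mult_distrib)
    also have "\<dots> \<le> real n * (rho n)^2" using elim by (simp add: mult.assoc)
    finally have "real (K n) * ln (real n) \<le> sqrt (real n * (rho n)^2)" by (rule real_le_rsqrt)
    then have "real (K n) * ln (real n) / sqrt (real n * (rho n)^2) \<le> 1" using pos by (subst pos_divide_le_eq) auto
    then show ?case using elim pos by (simp add: abs_divide)
  qed
  have K1: "(\<lambda>n. real (K n) * \<bar>eta1 n\<bar>) \<longlonglongrightarrow> 0" by (rule tendsto_zero_times_smallo[OF eta1 quad])
  have K2: "(\<lambda>n. real (K n) * \<bar>eta2 n\<bar>) \<longlonglongrightarrow> 0" by (rule tendsto_zero_times_smallo[OF eta2 quad])
  have K0: "(\<lambda>n. real (K n) * \<bar>eta0 n\<bar>) \<longlonglongrightarrow> 0" by (rule tendsto_zero_times_smallo[OF eta0 lin])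
  \<comment> \<open>\<open>loss_bound\<close> with every term replaced by a null sequence: absolute
    values because the signs of the sequences are free, \<open>K * \<bar>eta0 n\<bar>\<close> in
    place of \<open>\<bar>eta0 n\<bar>\<close>, and \<open>1 / n\<close> in place of
    \<open>K / n^2\<close>.\<close>
  define eta where "eta n = 8 * CA1 * (1 + CA1^2) *
      ((2 + eps) * (2 * (real (K n) * \<bar>eta1 n\<bar> + real (K n) * \<bar>eta2 n\<bar> + 1901068288 * CA1 / ln (real n))
        + CA1 * (real (K n) * \<bar>eta0 n\<bar>)) + 1 / real n)" for n
  have log0: "(\<lambda>n. 1901068288 * CA1 / ln (real n)) \<longlonglongrightarrow> 0" by real_asymp
  have "eta \<longlonglongrightarrow> 8 * CA1 * (1 + CA1^2) * ((2 + eps) * (2 * (0 + 0 + 0) + CA1 * 0) + 0)"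
    unfolding eta_def
    by (intro tendsto_intros K0 K1 K2 log0 lim_1_over_n)
  then have eta_lim: "eta \<longlonglongrightarrow> 0" by simp
  \<comment> \<open>The constants are those that \<open>etas\<close> in
    \<open>recovery_probability\<close> asks for.\<close>
  have small: "\<forall>\<^sub>F n in sequentially. real (K n) * \<bar>eta0 n\<bar> < 1 / 4 \<and> real (K n) * \<bar>eta1 n\<bar> < 1 / 2
      \<and> real (K n) * \<bar>eta2 n\<bar> < 1 / (4 * CA1)"
    using assms(3) by (intro eventually_conj order_tendstoD(2)[OF K0] order_tendstoD(2)[OF K1] order_tendstoD(2)[OF K2]) auto
  have "\<forall>\<^sub>F n in sequentially.
          (let Kn = K n; m = (K n)^2; c = cs n; L = (\<lambda>i a. rho n * L0 n i a) in
            measure_pmf.prob (pabm_pmf n (pabm_theta c L))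
              {G. \<forall>Xh nu. top_eigvecs n m (adj_of G) Xh nu \<longrightarrow>
                    (\<forall>ch. tcsc_output n Kn Xh (phi1 n / 2) eps ch \<longrightarrow>
                          mis_loss n Kn c ch \<le> eta n)}
            \<ge> 1 - 7 / real n ^ 4)"
    using ev scale small eventually_log_cube_le
  proof eventually_elim
    case (elim n)
    note h = elim(1)[unfolded Let_def]
    define L where "L = (\<lambda>i a. rho n * L0 n i a)"
    have K: "1 \<le> real (K n)" "0 < K n" and n: "0 < n" using elim(2,4) by (auto intro: gr0I)
    have abs_le: "\<bar>x\<bar> \<le> real (K n) * \<bar>x\<bar>" for x :: real using K mult_right_mono[of 1 "real (K n)" "\<bar>x\<bar>"] by simp
    have L: "0 \<le> L i a \<and> L i a \<le> rho n" if "i < n" "a < K n" for i a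
      using h that by (auto simp: L_def mult_left_le less_imp_le)
    have CA1': "1 / (4 * CA1) \<le> 1 / 4" using assms(3) by (simp add: field_simps)
    have e0: "eta0 n \<le> 1 / 4" using abs_le[of "eta0 n"] elim(3) by linarith
    have e2: "eta2 n * (4 * CA1 * real (K n)) \<le> 1"
    proof -
      have "eta2 n * real (K n) \<le> \<bar>eta2 n\<bar> * real (K n)" by (intro mult_right_mono) auto
      then have "eta2 n * real (K n) \<le> 1 / (4 * CA1)" using elim(3) by (simp add: mult.commute)
      then show ?thesis using assms(3) by (simp add: field_simps)
    qed
    have e12: "eta1 n + eta2 n \<le> 1"
      using abs_le[of "eta1 n"] abs_le[of "eta2 n"] elim(3) CA1' by linarith
    have "1 - 7 / real n ^ 4 \<le> measure_pmf.prob (pabm_pmf n (pabm_theta (cs n) L))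
      {G. \<forall>Xh nu. top_eigvecs n ((K n)^2) (adj_of G) Xh nu \<longrightarrow>
          (\<forall>ch. tcsc_output n (K n) Xh (phi1 n / 2) eps ch \<longrightarrow>
             mis_loss n (K n) (cs n) ch \<le> loss_bound CA1 eps n (K n) (eta0 n) (eta1 n) (eta2 n))}"
      by (rule recovery_probability[where X="Xi n" and P="P n" and mu="mu n" and ?cA4.0=cA4 and ?C2.0=C2
            and rho="rho n" and ?phi2.0="phi2 n" and L=L, OF K(2) assms(3,4,1) _ _ _ L])
         (use h elim(2,4) C2 e0 e2 e12 in \<open>simp_all add: L_def\<close>)
    also have "\<dots> \<le> measure_pmf.prob (pabm_pmf n (pabm_theta (cs n) L))
      {G. \<forall>Xh nu. top_eigvecs n ((K n)^2) (adj_of G) Xh nu \<longrightarrow>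
          (\<forall>ch. tcsc_output n (K n) Xh (phi1 n / 2) eps ch \<longrightarrow> mis_loss n (K n) (cs n) ch \<le> eta n)}"
    proof -
      have "loss_bound CA1 eps n (K n) (eta0 n) (eta1 n) (eta2 n)
          \<le> eta n"
        unfolding eta_def loss_bound_def
      proof (intro mult_left_mono add_mono)
        show "real (K n) * (eta1 n + eta2 n) \<le> real (K n) * \<bar>eta1 n\<bar> + real (K n) * \<bar>eta2 n\<bar>"
          unfolding distrib_left[symmetric] by (intro mult_left_mono) auto
        show "\<bar>eta0 n\<bar> \<le> real (K n) * \<bar>eta0 n\<bar>" by (rule abs_le)
        have "real (K n) / (real n)^2 \<le> real n / (real n)^2" using elim(2) by (intro divide_right_mono) auto
        then show "real (K n) / (real n)^2 \<le> 1 / real n" using n by (simp add: power2_eq_square)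
      qed (use assms in auto)
      then show ?thesis by (intro measure_pmf.finite_measure_mono) (auto intro: order.trans)
    qed
    finally show ?case by (simp add: L_def Let_def)
  qed
  \<comment> \<open>\<open>7 = 1 + 4 + 2\<close> collects the failure probabilities for operator
    norm, entries and column norms in \<open>noise_controlled_prob\<close>.\<close>
  with eta_lim show ?case
    by (intro exI[of _ 7] exI[of _ eta] conjI) auto
qed

end
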